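(* Let $n\ge2$, $j\ge1$, $j\not\equiv0\pmod n$. Let $H_j$ be the functionals on $C^\infty(S^1,V_n)$ defined in the context and $\hat H_j=H_j\circ\Psi$, where $\Psi$ is the central affine curvature map on $\mathcal{M}_n(S^1)$. Then the $j$-th central affine curve flow $\gamma_t=gZ_{j,0}(u)e_1$ on $\mathcal{M}_n(S^1)$ is the Hamiltonian equation for $\hat H_j$ with respect to $\{\,,\}_2^\wedge$, and the Hamiltonian equation for $\hat H_{n+j}$ with respect to $\{\,,\}_1^\wedge$.
   Context: $S^1=\mathbb{R}/2\pi\mathbb{Z}$. $\mathcal{M}_n(S^1)$ is the set of smooth $\gamma:S^1\to\mathbb{R}^n\setminus\{0\}$ with $\det(\gamma,\gamma_x,\ldots,\gamma_x^{(n-1)})=1$. The central affine moving frame $g=(\gamma,\ldots,\gamma_x^{(n-1)})$ satisfies $g_x=g(b+u)$ with $b=\sum_{i=1}^{n-1}e_{i+1,i}$, $u=\sum_{i=1}^{n-1}u_ie_{in}$, $\gamma_x^{(n)}=u_1\gamma+\cdots+u_{n-1}\gamma_x^{(n-2)}$; $\Psi(\gamma)=u$. $V_n=\bigoplus_{i=1}^{n-1}\mathbb{R}e_{in}$, $V_n^t=\bigoplus_{i=1}^{n-1}\mathbb{R}e_{ni}$, $e_1=(1,0,\ldots,0)^t$, $J=e_{1n}\lambda+b$, $[\partial_x+A,B]=B_x+[A,B]$, $\langle y_1,y_2\rangle=\oint\mathrm{tr}(y_1y_2)dx$, $\pi_0(y)=\sum_{i=1}^{n-1}y_{ni}e_{ni}$.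 For $v\in C^\infty(S^1,V_n^t)$, $P_u(v)=C$ is the unique smooth $sl(n,\mathbb{R})$-valued map with $\pi_0(C)=v$ and $[\partial_x+b+u,C]\in C^\infty(S^1,V_n)$. The gradient $\nabla F(u)\in C^\infty(S^1,V_n^t)$ is defined by $dF_u(v)=\langle\nabla F(u),v\rangle$. The Poisson operators $(J_i)_u:C^\infty(S^1,V_n^t)\to C^\infty(S^1,V_n)$ are given by $\langle(J_1)_u(\xi),\eta\rangle=\langle[e_{1n},P_u(\xi)],P_u(\eta)\rangle$ and $(J_2)_u(\xi)=[\partial_x+b+u,P_u(\xi)]$, and $\{F_1,F_2\}_i(u)=\langle(J_i)_u(\nabla F_1(u)),\nabla F_2(u)\rangle$. The pulled back structure is $\{F_1\circ\Psi,F_2\circ\Psi\}_i^\wedge=\{F_1,F_2\}_i\circ\Psi$. A flow $\gamma_t=X(\gamma)$ on $\mathcal{M}_n(S^1)$ is the Hamiltonian equation of $F\circ\Psi$ with respect to $\{\,,\}_i^\wedge$ when $d\Psi_\gamma(X(\gamma))=(J_i)_u(\nabla F(u))$ for all $\gamma$, $u=\Psi(\gamma)$ ($X$ is determined up to $\mathrm{Ker}\,d\Psi_\gamma$). $Z_{j,0}$: let $Y(u,\lambda)=e_{1n}\lambda+\sum_{i\le0}Y_{1,i}(u)\lambda^i$ be the unique formal series with smooth $sl(n)$-valued coefficients with $Y_x+[J+u,Y]=0$, $Y^n=\lambda I_n$; write $Y^j=\sum_iY_{j,i}(u)\lambda^i$; $Z_{j,0}(u)=Y_{j,0}(u)-\zeta_j(u)$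 with $\zeta_j(u)$ the unique strictly upper triangular map such that $[\partial_x+b+u,Z_{j,0}(u)]\in V_n$. $H_j$: there is a unique formal series $T=\sum_{i\ge0}T_i\lambda^{-i}$ with $T_0$ upper triangular unipotent, first column of $T$ equal to $e_1$, and $T(\partial_x+J+u)T^{-1}=\partial_x+J+\sum_{i\ge0}f_i(u)J^{-i}$, $f_i(u)\in C^\infty(S^1,\mathbb{R})$; $H_j(u)=n\oint f_j(u)\,dx$.
   Formalization: The Hamiltonian for the first bracket is −Ĥ_{n+j} instead of Ĥ_{n+j}: with the stated conventions the claim fails by a sign, e.g. n=2, j=1, u=q e_12, where the flow gives q_t=q_x but (J_1)_u(∇H_3(u))=−q_x e_12. *)

theory Defs
  imports
    "HOL-Analysis.Derivative"
    "HOL-Analysis.Henstock_Kurzweil_Integration"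
    "HOL-Computational_Algebra.Formal_Laurent_Series"
    "HOL-Number_Theory.Cong"
    "Jordan_Normal_Form.Determinant"
begin

text \<open>
  Matrices and vectors are those of Jordan Normal Form, with the dimension \<open>n\<close> an explicit argument;
  their indices start at \<open>0\<close>, so the usual \<open>e\<^sub>i\<^sub>j\<close> is \<open>elem_mat n (i - 1) (j - 1)\<close>.
  A map on the circle \<open>S\<^sup>1 = \<real>/2\<pi>\<int>\<close> is a \<open>2\<pi>\<close>-periodic map on the real line.
\<close>

no_notation fls_nth (infixl "$$" 75)
no_notation fps_nth (infixl "$" 75)

primrec higher_diff_on ::
  "'a::real_normed_vector set \<Rightarrow> nat \<Rightarrow> ('a \<Rightarrow> 'b::real_normed_vector) \<Rightarrow> bool" where
  "higher_diff_on S 0 f \<longleftrightarrow> continuous_on S f"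
| "higher_diff_on S (Suc k) f \<longleftrightarrow> (\<forall>x\<in>S. f differentiable (at x)) \<and>
     (\<forall>v. higher_diff_on S k (\<lambda>x. frechet_derivative f (at x) v))"

text \<open>Only used for open \<open>S\<close>.\<close>
definition smooth_on ::
  "'a::real_normed_vector set \<Rightarrow> ('a \<Rightarrow> 'b::real_normed_vector) \<Rightarrow> bool" where
  "smooth_on S f \<longleftrightarrow> (\<forall>k. higher_diff_on S k f)"

definition circle_smooth :: "(real \<Rightarrow> real) \<Rightarrow> bool" where
  "circle_smooth f \<longleftrightarrow> smooth_on UNIV f \<and> (\<forall>x. f (x + 2 * pi) = f x)"

text \<open>\<open>C\<^sup>\<infinity>(S\<^sup>1, W)\<close>, for a set \<open>W\<close> of \<open>n \<times> n\<close> matrices.\<close>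
definition smooth_maps :: "nat \<Rightarrow> real mat set \<Rightarrow> (real \<Rightarrow> real mat) set" where
  "smooth_maps n W = {A. (\<forall>x. A x \<in> W) \<and>
     (\<forall>i<n. \<forall>j<n. circle_smooth (\<lambda>x. A x $$ (i, j)))}"

definition mat_deriv :: "nat \<Rightarrow> (real \<Rightarrow> real mat) \<Rightarrow> real \<Rightarrow> real mat" where
  "mat_deriv n A x = mat n n (\<lambda>(i, j). deriv (\<lambda>y. A y $$ (i, j)) x)"

definition elem_mat :: "nat \<Rightarrow> nat \<Rightarrow> nat \<Rightarrow> 'a::{zero,one} mat" where
  "elem_mat n i j = mat n n (\<lambda>(k, l). if k = i \<and> l = j then 1 else 0)"

definition trace_mat :: "'a::comm_monoid_add mat \<Rightarrow> 'a" where
  "trace_mat A = (\<Sum>i<dim_row A. A $$ (i, i))"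

definition commutator :: "'a::ring mat \<Rightarrow> 'a mat \<Rightarrow> 'a mat" where
  "commutator A B = A * B - B * A"

definition inverse_mat :: "nat \<Rightarrow> 'a::semiring_1 mat \<Rightarrow> 'a mat" where
  "inverse_mat n A = (THE B. B \<in> carrier_mat n n \<and> inverts_mat A B \<and> inverts_mat B A)"

definition sl_mats :: "nat \<Rightarrow> real mat set" where
  "sl_mats n = {A \<in> carrier_mat n n. trace_mat A = 0}"

text \<open>\<open>V\<^sub>n = \<Oplus>\<^bsub>i<n\<^esub> \<real> e\<^bsub>in\<^esub>\<close> and \<open>V\<^sub>n\<^sup>t = \<Oplus>\<^bsub>i<n\<^esub> \<real> e\<^bsub>ni\<^esub>\<close>; the entry at \<open>(n, n)\<close> vanishes in both.\<close>
definition V_mats :: "nat \<Rightarrow> real mat set" where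
  "V_mats n = {A \<in> carrier_mat n n.
     \<forall>k<n. \<forall>l<n. \<not> (k < n - 1 \<and> l = n - 1) \<longrightarrow> A $$ (k, l) = 0}"

definition Vt_mats :: "nat \<Rightarrow> real mat set" where
  "Vt_mats n = {A \<in> carrier_mat n n.
     \<forall>k<n. \<forall>l<n. \<not> (k = n - 1 \<and> l < n - 1) \<longrightarrow> A $$ (k, l) = 0}"

definition strictly_upper_mats :: "nat \<Rightarrow> real mat set" where
  "strictly_upper_mats n = {A \<in> carrier_mat n n. \<forall>k<n. \<forall>l\<le>k. A $$ (k, l) = 0}"

definition pi0 :: "nat \<Rightarrow> real mat \<Rightarrow> real mat" where
  "pi0 n A = mat n n (\<lambda>(k, l). if k = n - 1 \<and> l < n - 1 then A $$ (k, l) else 0)"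

definition b_mat :: "nat \<Rightarrow> 'a::{zero,one} mat" where
  "b_mat n = mat n n (\<lambda>(i, j). if i = Suc j then 1 else 0)"

text \<open>\<open>cov_deriv n A B\<close> is \<open>[\<partial>\<^sub>x + A, B] = B\<^sub>x + [A, B]\<close>.\<close>
definition cov_deriv ::
  "nat \<Rightarrow> (real \<Rightarrow> real mat) \<Rightarrow> (real \<Rightarrow> real mat) \<Rightarrow> real \<Rightarrow> real mat" where
  "cov_deriv n A B x = mat_deriv n B x + commutator (A x) (B x)"

definition pairing :: "nat \<Rightarrow> (real \<Rightarrow> real mat) \<Rightarrow> (real \<Rightarrow> real mat) \<Rightarrow> real" where
  "pairing n y z = integral {0..2 * pi} (\<lambda>x. trace_mat (y x * z x))"

definition frame :: "nat \<Rightarrow> (real \<Rightarrow> real vec) \<Rightarrow> real \<Rightarrow> real mat" where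
  "frame n \<gamma> x = mat n n (\<lambda>(i, j). (deriv ^^ j) (\<lambda>y. \<gamma> y $ i) x)"

definition curves :: "nat \<Rightarrow> (real \<Rightarrow> real vec) set" where
  "curves n = {\<gamma>. (\<forall>x. \<gamma> x \<in> carrier_vec n \<and> \<gamma> x \<noteq> 0\<^sub>v n) \<and>
     (\<forall>i<n. circle_smooth (\<lambda>x. \<gamma> x $ i)) \<and> (\<forall>x. det (frame n \<gamma> x) = 1)}"

definition curvature :: "nat \<Rightarrow> (real \<Rightarrow> real vec) \<Rightarrow> real \<Rightarrow> real mat" where
  "curvature n \<gamma> = (THE u. u \<in> smooth_maps n (V_mats n) \<and>
     (\<forall>x. mat_deriv n (frame n \<gamma>) x = frame n \<gamma> x * (b_mat n + u x)))"

text \<open>\<open>c\<close> is a smooth path of curves, defined for times near \<open>0\<close>, with \<open>c 0 = \<gamma>\<close> and velocity \<open>X\<close> at time \<open>0\<close>.\<close>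
definition curve_path ::
  "nat \<Rightarrow> (real \<Rightarrow> real vec) \<Rightarrow> (real \<Rightarrow> real vec) \<Rightarrow> (real \<Rightarrow> real \<Rightarrow> real vec) \<Rightarrow> bool" where
  "curve_path n \<gamma> X c \<longleftrightarrow>
     (\<exists>\<epsilon>>0. (\<forall>t\<in>{-\<epsilon><..<\<epsilon>}. c t \<in> curves n) \<and>
        (\<forall>i<n. smooth_on ({-\<epsilon><..<\<epsilon>} \<times> UNIV) (\<lambda>(t, x). c t x $ i))) \<and>
     c 0 = \<gamma> \<and>
     (\<forall>x. \<forall>i<n. ((\<lambda>t. c t x $ i) has_real_derivative X x $ i) (at 0))"

text \<open>
  \<open>X\<close> is tangent at \<open>\<gamma>\<close> to the space of curves, and \<open>d\<Psi>\<^sub>\<gamma>(X) = w\<close>, with \<open>\<Psi>\<close> the map \<open>curvature\<close>. The space of curves is not an affine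
  space, so the differential is taken along paths.
\<close>
definition has_curvature_differential ::
  "nat \<Rightarrow> (real \<Rightarrow> real vec) \<Rightarrow> (real \<Rightarrow> real vec) \<Rightarrow> (real \<Rightarrow> real mat) \<Rightarrow> bool" where
  "has_curvature_differential n \<gamma> X w \<longleftrightarrow>
     (\<forall>x. X x \<in> carrier_vec n) \<and> w \<in> smooth_maps n (V_mats n) \<and>
     (\<exists>c. curve_path n \<gamma> X c) \<and>
     (\<forall>c. curve_path n \<gamma> X c \<longrightarrow> (\<forall>x. \<forall>i<n. \<forall>j<n.
        ((\<lambda>t. curvature n (c t) x $$ (i, j)) has_real_derivative w x $$ (i, j)) (at 0)))"

definition P_op :: "nat \<Rightarrow> (real \<Rightarrow> real mat) \<Rightarrow> (real \<Rightarrow> real mat) \<Rightarrow> real \<Rightarrow> real mat" where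
  "P_op n u v = (THE C. C \<in> smooth_maps n (sl_mats n) \<and> (\<forall>x. pi0 n (C x) = v x) \<and>
     cov_deriv n (\<lambda>x. b_mat n + u x) C \<in> smooth_maps n (V_mats n))"

definition poisson1 :: "nat \<Rightarrow> (real \<Rightarrow> real mat) \<Rightarrow> (real \<Rightarrow> real mat) \<Rightarrow> real \<Rightarrow> real mat" where
  "poisson1 n u \<xi> = (THE w. w \<in> smooth_maps n (V_mats n) \<and>
     (\<forall>\<eta>\<in>smooth_maps n (Vt_mats n). pairing n w \<eta> =
        pairing n (\<lambda>x. commutator (elem_mat n 0 (n - 1)) (P_op n u \<xi> x)) (P_op n u \<eta>)))"

definition poisson2 :: "nat \<Rightarrow> (real \<Rightarrow> real mat) \<Rightarrow> (real \<Rightarrow> real mat) \<Rightarrow> real \<Rightarrow> real mat" where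
  "poisson2 n u \<xi> = cov_deriv n (\<lambda>x. b_mat n + u x) (P_op n u \<xi>)"

definition has_functional_gradient ::
  "nat \<Rightarrow> ((real \<Rightarrow> real mat) \<Rightarrow> real) \<Rightarrow> (real \<Rightarrow> real mat) \<Rightarrow> (real \<Rightarrow> real mat) \<Rightarrow> bool" where
  "has_functional_gradient n F u \<xi> \<longleftrightarrow> \<xi> \<in> smooth_maps n (Vt_mats n) \<and>
     (\<forall>v\<in>smooth_maps n (V_mats n).
        ((\<lambda>\<epsilon>. F (\<lambda>x. u x + \<epsilon> \<cdot>\<^sub>m v x)) has_real_derivative pairing n \<xi> v) (at 0))"

text \<open>
  \<open>\<gamma>\<^sub>t = X(\<gamma>)\<close> is the Hamiltonian equation of \<open>F \<circ> \<Psi>\<close> with respect to the pull-back along \<open>\<Psi>\<close> of the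
  Poisson structure on \<open>C\<^sup>\<infinity>(S\<^sup>1, V\<^sub>n)\<close> with Poisson operator \<open>K\<close>, that is, of
  \<open>{F\<^sub>1, F\<^sub>2}(u) = \<langle>K\<^sub>u(\<nabla>F\<^sub>1(u)), \<nabla>F\<^sub>2(u)\<rangle>\<close>.
\<close>
definition is_hamiltonian_curve_flow ::
  "nat \<Rightarrow> ((real \<Rightarrow> real mat) \<Rightarrow> (real \<Rightarrow> real mat) \<Rightarrow> real \<Rightarrow> real mat) \<Rightarrow>
    ((real \<Rightarrow> real mat) \<Rightarrow> real) \<Rightarrow> ((real \<Rightarrow> real vec) \<Rightarrow> real \<Rightarrow> real vec) \<Rightarrow> bool" where
  "is_hamiltonian_curve_flow n K F X \<longleftrightarrow> (\<forall>\<gamma>\<in>curves n.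
     \<exists>\<xi>. has_functional_gradient n F (curvature n \<gamma>) \<xi> \<and>
       has_curvature_differential n \<gamma> (X \<gamma>) (K (curvature n \<gamma>) \<xi>))"

text \<open>
  A formal series in \<open>\<lambda>\<close> with finitely many positive powers is a formal Laurent series in \<open>\<lambda>\<^sup>-\<^sup>1\<close>:
  \<open>fls_X\<close> is \<open>\<lambda>\<^sup>-\<^sup>1\<close>, \<open>fls_X_inv\<close> is \<open>\<lambda>\<close>, and the coefficient of \<open>\<lambda>\<^sup>i\<close> is \<open>fls_nth\<close> at \<open>-i\<close>.
\<close>

definition lam_coeff :: "int \<Rightarrow> real fls mat \<Rightarrow> real mat" where
  "lam_coeff i A = map_mat (\<lambda>f. fls_nth f (- i)) A"

text \<open>
  Coefficientwise derivative; it is only applied to series whose powers of \<open>\<lambda>\<close> are bounded above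
  uniformly in \<open>x\<close>, for which \<open>Abs_fls\<close> is given an admissible coefficient function.
\<close>
definition series_deriv :: "nat \<Rightarrow> (real \<Rightarrow> real fls mat) \<Rightarrow> real \<Rightarrow> real fls mat" where
  "series_deriv n A x =
     mat n n (\<lambda>(i, j). Abs_fls (\<lambda>k. deriv (\<lambda>y. fls_nth (A y $$ (i, j)) k) x))"

definition J_mat :: "nat \<Rightarrow> real fls mat" where
  "J_mat n = fls_X_inv \<cdot>\<^sub>m elem_mat n 0 (n - 1) + b_mat n"

definition J_plus :: "nat \<Rightarrow> (real \<Rightarrow> real mat) \<Rightarrow> real \<Rightarrow> real fls mat" where
  "J_plus n u x = J_mat n + map_mat fls_const (u x)"

definition Y_series :: "nat \<Rightarrow> (real \<Rightarrow> real mat) \<Rightarrow> real \<Rightarrow> real fls mat" where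
  "Y_series n u = (THE Y.
     (\<forall>x. Y x \<in> carrier_mat n n) \<and>
     (\<forall>i>1. \<forall>x. lam_coeff i (Y x) = 0\<^sub>m n n) \<and>
     (\<forall>x. lam_coeff 1 (Y x) = elem_mat n 0 (n - 1)) \<and>
     (\<forall>i\<le>0. (\<lambda>x. lam_coeff i (Y x)) \<in> smooth_maps n (sl_mats n)) \<and>
     (\<forall>x. series_deriv n Y x + commutator (J_plus n u x) (Y x) = 0\<^sub>m n n) \<and>
     (\<forall>x. Y x ^\<^sub>m n = fls_X_inv \<cdot>\<^sub>m 1\<^sub>m n))"

definition Y_coeff :: "nat \<Rightarrow> nat \<Rightarrow> int \<Rightarrow> (real \<Rightarrow> real mat) \<Rightarrow> real \<Rightarrow> real mat" where
  "Y_coeff n j i u x = lam_coeff i (Y_series n u x ^\<^sub>m j)"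

definition zeta :: "nat \<Rightarrow> nat \<Rightarrow> (real \<Rightarrow> real mat) \<Rightarrow> real \<Rightarrow> real mat" where
  "zeta n j u = (THE \<zeta>. \<zeta> \<in> smooth_maps n (strictly_upper_mats n) \<and>
     cov_deriv n (\<lambda>x. b_mat n + u x) (\<lambda>x. Y_coeff n j 0 u x - \<zeta> x) \<in> smooth_maps n (V_mats n))"

definition Z0 :: "nat \<Rightarrow> nat \<Rightarrow> (real \<Rightarrow> real mat) \<Rightarrow> real \<Rightarrow> real mat" where
  "Z0 n j u x = Y_coeff n j 0 u x - zeta n j u x"

definition curve_flow :: "nat \<Rightarrow> nat \<Rightarrow> (real \<Rightarrow> real vec) \<Rightarrow> real \<Rightarrow> real vec" where
  "curve_flow n j \<gamma> x = frame n \<gamma> x *\<^sub>v (Z0 n j (curvature n \<gamma>) x *\<^sub>v unit_vec n 0)"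

text \<open>The matrix part of \<open>T (\<partial>\<^sub>x + A) T\<^sup>-\<^sup>1 = \<partial>\<^sub>x + (T A T\<^sup>-\<^sup>1 - T\<^sub>x T\<^sup>-\<^sup>1)\<close>.\<close>
definition gauge ::
  "nat \<Rightarrow> (real \<Rightarrow> real fls mat) \<Rightarrow> (real \<Rightarrow> real fls mat) \<Rightarrow> real \<Rightarrow> real fls mat" where
  "gauge n T A x =
     T x * A x * inverse_mat n (T x) - series_deriv n T x * inverse_mat n (T x)"

text \<open>
  The coefficients \<open>f\<^sub>i(u)\<close>. The series \<open>\<Sum>\<^sub>i f\<^sub>i J\<^sup>-\<^sup>i\<close> converges entrywise in the \<open>\<lambda>\<^sup>-\<^sup>1\<close>-adic metric, which is
  the topology of the type of formal Laurent series.
\<close>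
definition f_coeffs :: "nat \<Rightarrow> (real \<Rightarrow> real mat) \<Rightarrow> nat \<Rightarrow> real \<Rightarrow> real" where
  "f_coeffs n u = (THE f. (\<forall>i. circle_smooth (f i)) \<and>
     (\<exists>T. (\<forall>x. T x \<in> carrier_mat n n) \<and>
        (\<forall>i>0. \<forall>x. lam_coeff i (T x) = 0\<^sub>m n n) \<and>
        (\<forall>i\<le>0. (\<lambda>x. lam_coeff i (T x)) \<in> smooth_maps n (carrier_mat n n)) \<and>
        (\<forall>x. upper_triangular (lam_coeff 0 (T x)) \<and>
             (\<forall>k<n. lam_coeff 0 (T x) $$ (k, k) = 1)) \<and>
        (\<forall>x. col (T x) 0 = unit_vec n 0) \<and>
        (\<forall>x. \<forall>k<n. \<forall>l<n.
           (\<lambda>i. fls_const (f i x) * (inverse_mat n (J_mat n) ^\<^sub>m i) $$ (k, l)) sums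
             ((gauge n T (J_plus n u) x - J_mat n) $$ (k, l)))))"

definition H_functional :: "nat \<Rightarrow> nat \<Rightarrow> (real \<Rightarrow> real mat) \<Rightarrow> real" where
  "H_functional n j u = real n * integral {0..2 * pi} (f_coeffs n u j)"

text \<open>
  Signs. Write \<open>L = \<partial>\<^sub>x + b + u\<close>. With the conventions above, \<open>\<nabla>H\<^sub>j(u) = \<pi>\<^sub>0(Y\<^bsub>j,0\<^esub>(u))\<close>, and the
  coefficient of \<open>\<lambda>\<^sup>0\<close> in \<open>[\<partial>\<^sub>x + J + u, Y\<^sup>j] = 0\<close> is \<open>[L, Y\<^bsub>j,0\<^esub>] + [e\<^bsub>1n\<^esub>, Y\<^bsub>j,-1\<^esub>] = 0\<close>, so that the
  Lenard relation carries a minus sign: \<open>(J\<^sub>2)\<^sub>u(\<nabla>H\<^sub>j(u)) = [L, Z\<^bsub>j,0\<^esub>(u)] = - (J\<^sub>1)\<^sub>u(\<nabla>H\<^bsub>n+j\<^esub>(u))\<close>.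
  For instance, for \<open>n = 2\<close>, \<open>j = 1\<close> and \<open>u = q e\<^sub>1\<^sub>2\<close>, the flow is \<open>q\<^sub>t = q\<^sub>x\<close>, the gradient of \<open>H\<^sub>3\<close> is
  \<open>-(q/2) e\<^sub>2\<^sub>1\<close>, and \<open>(J\<^sub>1)\<^sub>u(v e\<^sub>2\<^sub>1) = 2 v\<^sub>x e\<^sub>1\<^sub>2\<close>. The Hamiltonian of a flow with respect to the first
  structure is therefore \<open>-H\<^bsub>n+j\<^esub>\<close> rather than \<open>H\<^bsub>n+j\<^esub>\<close>.
\<close>

end

theory Submission
  imports Defs
begin

text \<open>
  Series in \<open>z\<^sup>-\<^sup>1\<close> are identified with vectors of series in \<open>\<lambda>\<^sup>-\<^sup>1\<close>, \<open>\<lambda> = z\<^sup>n\<close>, so that multiplication by \<open>z\<close>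
  becomes \<open>J\<close>. A gauge transformation \<open>T\<close> with first column \<open>e\<^sub>1\<close> that takes \<open>\<partial> + J + u\<close> to \<open>\<partial> + h\<close>, where \<open>h\<close> is
  multiplication by a scalar series \<open>z + \<Sum>\<^sub>i f\<^sub>i z\<^sup>-\<^sup>i\<close>, has the columns \<open>(\<partial> + h)\<^sup>k 1\<close>, and the last column gives the
  Riccati equation \<open>(\<partial> + h)\<^sup>n 1 = z\<^sup>n + \<Sum>\<^sub>i u\<^sub>i (\<partial> + h)\<^bsup>i-1\<^esup> 1\<close>, which has a unique solution of this form. Then
  \<open>Y = T\<^sup>-\<^sup>1 J T\<close>. Varying \<open>u\<close> and taking the trace against \<open>J\<^sup>j\<close> gives \<open>\<nabla>H\<^sub>j(u) = \<pi>\<^sub>0(Y\<^bsub>j,0\<^esub>)\<close>.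

  Matrices \<open>C\<close> with \<open>[\<partial> + b + u, C]\<close> in \<open>V\<^sub>n\<close> are determined by their first column, and also by their trace
  and \<open>\<pi>\<^sub>0(C)\<close>. Since \<open>Y\<^bsub>j,0\<^esub>\<close> is traceless for \<open>j\<close> not divisible by \<open>n\<close>, this yields \<open>Z\<^bsub>j,0\<^esub> = P\<^sub>u(\<nabla>H\<^sub>j(u))\<close>. A motion of
  curves with velocity \<open>g Z e\<^sub>1\<close> then has \<open>g\<^sub>t = g Z\<close>, so that \<open>u\<^sub>t = [\<partial> + b + u, Z] = (J\<^sub>2)\<^sub>u(\<nabla>H\<^sub>j(u))\<close>, and the
  Lenard relation turns this into \<open>- (J\<^sub>1)\<^sub>u(\<nabla>H\<^bsub>n+j\<^esub>(u))\<close>.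
\<close>


section \<open>Smooth functions\<close>

text \<open>Two obstacles shape the development. The objects are definite descriptions over smooth
  periodic families of matrices and series, and the gradient asks for a \<open>t\<close>-derivative
  of data that are known only through an infinite recursion. Both are met by passing to differential
  rings. The algebra is done once in \<open>diff_ring\<close>, where only division by positive
  integers is available, and is instantiated for functions of \<open>x\<close> (\<open>cfun\<close>)
  and of \<open>(t, x)\<close> (\<open>sfun\<close>). Over \<open>sfun\<close> the recursion
  produces coefficients that are smooth in \<open>t\<close>, and the \<open>t\<close>-derivative is
  a second derivation that commutes with the first, so the variation formula becomes an identity of
  traces. Uniqueness over the ring turns each definite description into an explicit matrix. The
  factor \<open>n\<close> in \<open>H_functional\<close> comes from the trace: all \<open>n\<close>
  diagonal entries of a multiplication matrix carry the same coefficients. The shift from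
  \<open>j\<close> to \<open>n + j\<close> is the identity \<open>Y^n = lambda\<close>. Curves do
  not form a linear space, so the differential of the curvature needs both an actual path for each
  velocity and a computation that is valid along every such path.\<close>

lemma frechet_derivative_eq:
  "(f has_derivative f') (at x) \<Longrightarrow> frechet_derivative f (at x) v = f' v"
  by (metis frechet_derivative_at)

lemma frechet_derivative_cong_open:
  assumes "open S" "x \<in> S" "\<And>y. y \<in> S \<Longrightarrow> f y = g y"
  shows "f differentiable (at x) \<longleftrightarrow> g differentiable (at x)"
    and "f differentiable (at x) \<Longrightarrow> frechet_derivative f (at x) = frechet_derivative g (at x)"
proof -
  have *: "(f has_derivative D) (at x) \<longleftrightarrow> (g has_derivative D) (at x)" for D
    using has_derivative_transform_within_open[of f D x UNIV S g]
      has_derivative_transform_within_open[of g D x UNIV S f] assms by auto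
  show "f differentiable (at x) \<longleftrightarrow> g differentiable (at x)"
    using * by (auto simp: differentiable_def)
  show "f differentiable (at x) \<Longrightarrow> frechet_derivative f (at x) = frechet_derivative g (at x)"
    using * by (simp add: frechet_derivative_def)
qed

text \<open>On an open set the two functions agree near each point, hence so do their Frechet
  derivatives, and the induction continues with these.\<close>

lemma higher_diff_on_cong:
  assumes S: "open S" and "\<And>x. x \<in> S \<Longrightarrow> f x = g x"
  shows "higher_diff_on S k f = higher_diff_on S k g"
  using assms(2)
proof (induction k arbitrary: f g)
  case 0
  then show ?case by (simp cong: continuous_on_cong)
next
  case (Suc k)
  have d: "(\<forall>x\<in>S. f differentiable (at x)) = (\<forall>x\<in>S. g differentiable (at x))"
    using frechet_derivative_cong_open(1)[OF S] Suc.prems by blast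
  show ?case
  proof (cases "\<forall>x\<in>S. f differentiable (at x)")
    case True
    have "higher_diff_on S k (\<lambda>x. frechet_derivative f (at x) v)
        = higher_diff_on S k (\<lambda>x. frechet_derivative g (at x) v)" for v
      by (intro Suc.IH) (metis True S Suc.prems frechet_derivative_cong_open(2))
    then show ?thesis using d by simp
  qed (use d in auto)
qed

lemma higher_diff_on_SucD: "higher_diff_on S (Suc k) f \<Longrightarrow> higher_diff_on S k f"
proof (induction k arbitrary: f)
  case 0
  then show ?case
    by (auto intro!: continuous_at_imp_continuous_on differentiable_imp_continuous_within)
next
  case (Suc k)
  then show ?case by (metis higher_diff_on.simps(2))
qed

lemma higher_diff_on_const: "higher_diff_on S k (\<lambda>x. c)"
  by (induction k arbitrary: c) (auto simp: frechet_derivative_const)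

lemma higher_diff_on_add:
  assumes "open S"
  shows "higher_diff_on S k f \<Longrightarrow> higher_diff_on S k g \<Longrightarrow> higher_diff_on S k (\<lambda>x. f x + g x)"
proof (induction k arbitrary: f g)
  case 0
  then show ?case by (auto intro: continuous_intros)
next
  case (Suc k)
  have "frechet_derivative (\<lambda>x. f x + g x) (at x) v =
      frechet_derivative f (at x) v + frechet_derivative g (at x) v" if "x \<in> S" for x v
    using Suc.prems that by (intro frechet_derivative_eq has_derivative_add)
      (auto simp: frechet_derivative_works[symmetric])
  then have "higher_diff_on S k (\<lambda>x. frechet_derivative (\<lambda>x. f x + g x) (at x) v)" for v
    using Suc higher_diff_on_cong[OF assms, of "\<lambda>x. frechet_derivative (\<lambda>x. f x + g x) (at x) v"
        "\<lambda>x. frechet_derivative f (at x) v + frechet_derivative g (at x) v"] by auto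
  then show ?case using Suc.prems by auto
qed

text \<open>The product rule brings back \<open>f\<close> and \<open>g\<close> undifferentiated, so
  the induction needs them at order \<open>k\<close> as well; \<open>higher_diff_on_SucD\<close>
  supplies this.\<close>

lemma higher_diff_on_mult:
  fixes f g :: "'a::real_normed_vector \<Rightarrow> real"
  assumes "open S"
  shows "higher_diff_on S k f \<Longrightarrow> higher_diff_on S k g \<Longrightarrow> higher_diff_on S k (\<lambda>x. f x * g x)"
proof (induction k arbitrary: f g)
  case 0
  then show ?case by (auto intro: continuous_intros)
next
  case (Suc k)
  have eq: "frechet_derivative (\<lambda>x. f x * g x) (at x) v =
      f x * frechet_derivative g (at x) v + frechet_derivative f (at x) v * g x" if "x \<in> S" for x v
    using Suc.prems that by (intro frechet_derivative_eq has_derivative_mult)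
      (auto simp: frechet_derivative_works[symmetric])
  have "higher_diff_on S k f" "higher_diff_on S k g"
    using Suc.prems by (auto intro: higher_diff_on_SucD)
  then have "higher_diff_on S k (\<lambda>x. f x * frechet_derivative g (at x) v +
      frechet_derivative f (at x) v * g x)" for v
    using Suc by (intro higher_diff_on_add assms Suc.IH) auto
  then have "higher_diff_on S k (\<lambda>x. frechet_derivative (\<lambda>x. f x * g x) (at x) v)" for v
    using eq higher_diff_on_cong[OF assms, of "\<lambda>x. frechet_derivative (\<lambda>x. f x * g x) (at x) v"
        "\<lambda>x. f x * frechet_derivative g (at x) v + frechet_derivative f (at x) v * g x"] by auto
  then show ?case using Suc.prems by auto
qed

text \<open>\<open>A\<close> has the same derivative \<open>L\<close> at every point. Each
  derivative of the composite is therefore again a composite with \<open>A\<close>, and the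
  induction closes without a higher-order chain rule.\<close>

lemma higher_diff_on_affine:
  assumes S: "open S" and A: "\<And>x. (A has_derivative L) (at x)" and sub: "A ` S \<subseteq> S'"
  shows "higher_diff_on S' k f \<Longrightarrow> higher_diff_on S k (\<lambda>x. f (A x))"
proof (induction k arbitrary: f)
  case 0
  have "continuous_on S A"
    using A by (intro continuous_at_imp_continuous_on) (auto intro: has_derivative_continuous)
  then show ?case using 0 sub by (auto intro: continuous_on_compose2)
next
  case (Suc k)
  have d: "((\<lambda>x. f (A x)) has_derivative (\<lambda>v. frechet_derivative f (at (A x)) (L v))) (at x)"
    if "x \<in> S" for x
  proof -
    have "(f has_derivative frechet_derivative f (at (A x))) (at (A x))"
      using Suc.prems that sub by (auto simp: frechet_derivative_works[symmetric])
    from has_derivative_compose[OF A this] show ?thesis .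
  qed
  have "higher_diff_on S k (\<lambda>x. frechet_derivative (\<lambda>x. f (A x)) (at x) v)" for v
  proof -
    have "higher_diff_on S k (\<lambda>x. frechet_derivative f (at (A x)) (L v))"
      using Suc by auto
    then show ?thesis
      using higher_diff_on_cong[OF S, of "\<lambda>x. frechet_derivative (\<lambda>x. f (A x)) (at x) v"
          "\<lambda>x. frechet_derivative f (at (A x)) (L v)"] frechet_derivative_eq[OF d] by blast
  qed
  then show ?case using d by (auto simp: differentiable_def)
qed

lemma higher_diff_on_bounded_linear:
  assumes "bounded_linear L"
  shows "higher_diff_on S k L"
proof (cases k)
  case 0
  then show ?thesis using assms by (simp add: linear_continuous_on)
next
  case (Suc m)
  have L: "(L has_derivative L) (at x)" for x
    using assms by (rule bounded_linear_imp_has_derivative)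
  then show ?thesis
    using Suc higher_diff_on_const frechet_derivative_eq[OF L]
    by (auto simp: differentiable_def)
qed

text \<open>Differentiation lowers the exponent, hence the induction over all \<open>a\<close>. The
  lemma serves the normalizing factor of \<open>curve_path_exists\<close>.\<close>

lemma higher_diff_on_powr:
  fixes f :: "'a::real_normed_vector \<Rightarrow> real"
  assumes S: "open S" and pos: "\<And>x. x \<in> S \<Longrightarrow> f x > 0"
  shows "higher_diff_on S k f \<Longrightarrow> higher_diff_on S k (\<lambda>x. f x powr a)"
proof (induction k arbitrary: a)
  case 0
  then show ?case using pos by (force intro!: continuous_intros)
next
  case (Suc k)
  have d: "((\<lambda>x. f x powr a) has_derivative
      (\<lambda>v. a * f x powr (a - 1) * frechet_derivative f (at x) v)) (at x)" if "x \<in> S" for x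
  proof -
    have f: "(f has_derivative frechet_derivative f (at x)) (at x)"
      using Suc.prems that by (auto simp: frechet_derivative_works[symmetric])
    have "((\<lambda>y. y powr a) has_derivative (\<lambda>h. a * f x powr (a - 1) * h)) (at (f x))"
      using has_real_derivative_powr[OF pos[OF that], of a]
      by (simp add: has_field_derivative_def)
    from has_derivative_compose[OF f this] show ?thesis .
  qed
  have "higher_diff_on S k (\<lambda>x. a * f x powr (a - 1) * frechet_derivative f (at x) v)" for v
    using Suc.prems higher_diff_on_SucD[OF Suc.prems]
    by (intro higher_diff_on_mult S higher_diff_on_const Suc.IH) auto
  then have "higher_diff_on S k (\<lambda>x. frechet_derivative (\<lambda>x. f x powr a) (at x) v)" for v
    using higher_diff_on_cong[OF S, of "\<lambda>x. frechet_derivative (\<lambda>x. f x powr a) (at x) v"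
        "\<lambda>x. a * f x powr (a - 1) * frechet_derivative f (at x) v"] frechet_derivative_eq[OF d]
    by blast
  then show ?case using d by (auto simp: differentiable_def)
qed

lemma smooth_on_cong: "open S \<Longrightarrow> (\<And>x. x \<in> S \<Longrightarrow> f x = g x) \<Longrightarrow> smooth_on S f = smooth_on S g"
  using higher_diff_on_cong[of S f g] by (simp add: smooth_on_def)

lemma smooth_on_const: "smooth_on S (\<lambda>x. c)"
  by (simp add: smooth_on_def higher_diff_on_const)

lemma smooth_on_add:
  "open S \<Longrightarrow> smooth_on S f \<Longrightarrow> smooth_on S g \<Longrightarrow> smooth_on S (\<lambda>x. f x + g x)"
  by (simp add: smooth_on_def higher_diff_on_add)

lemma smooth_on_mult:
  fixes f g :: "'a::real_normed_vector \<Rightarrow> real"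
  shows "open S \<Longrightarrow> smooth_on S f \<Longrightarrow> smooth_on S g \<Longrightarrow> smooth_on S (\<lambda>x. f x * g x)"
  by (simp add: smooth_on_def higher_diff_on_mult)

lemma smooth_on_affine:
  "open S \<Longrightarrow> (\<And>x. (A has_derivative L) (at x)) \<Longrightarrow> A ` S \<subseteq> S' \<Longrightarrow> smooth_on S' f \<Longrightarrow>
    smooth_on S (\<lambda>x. f (A x))"
  unfolding smooth_on_def using higher_diff_on_affine[of S A L S'] by blast

lemma smooth_on_bounded_linear: "bounded_linear L \<Longrightarrow> smooth_on S L"
  by (simp add: smooth_on_def higher_diff_on_bounded_linear)

lemma smooth_on_powr:
  fixes f :: "'a::real_normed_vector \<Rightarrow> real"
  shows "open S \<Longrightarrow> (\<And>x. x \<in> S \<Longrightarrow> f x > 0) \<Longrightarrow> smooth_on S f \<Longrightarrow> smooth_on S (\<lambda>x. f x powr a)"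
  by (simp add: smooth_on_def higher_diff_on_powr)

lemma smooth_on_frechet_derivative:
  "smooth_on S f \<Longrightarrow> smooth_on S (\<lambda>x. frechet_derivative f (at x) v)"
  unfolding smooth_on_def by (metis higher_diff_on.simps(2))

lemma smooth_on_differentiable: "smooth_on S f \<Longrightarrow> x \<in> S \<Longrightarrow> f differentiable (at x)"
  unfolding smooth_on_def by (metis higher_diff_on.simps(2))

lemma smooth_on_continuous_on: "smooth_on S f \<Longrightarrow> continuous_on S f"
  unfolding smooth_on_def by (metis higher_diff_on.simps(1))

lemma smooth_on_subset: "smooth_on S f \<Longrightarrow> S' \<subseteq> S \<Longrightarrow> smooth_on S' f"
proof -
  have "higher_diff_on S k f \<Longrightarrow> S' \<subseteq> S \<Longrightarrow> higher_diff_on S' k f" for k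
    by (induction k arbitrary: f) (auto intro: continuous_on_subset)
  then show "smooth_on S f \<Longrightarrow> S' \<subseteq> S \<Longrightarrow> smooth_on S' f"
    by (simp add: smooth_on_def)
qed

lemma frechet_derivative_real:
  fixes f :: "real \<Rightarrow> real"
  assumes "f differentiable (at x)"
  shows "frechet_derivative f (at x) v = deriv f x * v"
proof -
  obtain D where "(f has_real_derivative D) (at x)"
    using assms real_differentiableE by blast
  then show ?thesis
    using frechet_derivative_eq[of f "(*) D" x v] DERIV_imp_deriv[of f D x]
    by (simp add: has_field_derivative_def)
qed

lemma smooth_on_has_real_derivative:
  fixes f :: "real \<Rightarrow> real"
  assumes "smooth_on S f" "x \<in> S"
  shows "(f has_real_derivative deriv f x) (at x)"
  using smooth_on_differentiable[OF assms] by (metis real_differentiable_def DERIV_imp_deriv)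

lemma smooth_on_deriv:
  fixes f :: "real \<Rightarrow> real"
  assumes "open S" "smooth_on S f"
  shows "smooth_on S (deriv f)"
proof -
  have "smooth_on S (\<lambda>x. frechet_derivative f (at x) 1)"
    using assms by (intro smooth_on_frechet_derivative)
  then show ?thesis
    using smooth_on_cong[OF assms(1), of "\<lambda>x. frechet_derivative f (at x) 1" "deriv f"]
      frechet_derivative_real smooth_on_differentiable[OF assms(2)] by simp
qed

section \<open>Partial derivatives of functions of two real variables\<close>

abbreviation pd1 :: "(real \<times> real \<Rightarrow> real) \<Rightarrow> real \<times> real \<Rightarrow> real" where
  "pd1 f p \<equiv> frechet_derivative f (at p) (1, 0)"

abbreviation pd2 :: "(real \<times> real \<Rightarrow> real) \<Rightarrow> real \<times> real \<Rightarrow> real" where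
  "pd2 f p \<equiv> frechet_derivative f (at p) (0, 1)"

lemma partial_derivatives:
  fixes f :: "real \<times> real \<Rightarrow> real"
  assumes "f differentiable (at (s, y))"
  shows "((\<lambda>s. f (s, y)) has_real_derivative pd1 f (s, y)) (at s)"
    and "((\<lambda>y. f (s, y)) has_real_derivative pd2 f (s, y)) (at y)"
proof -
  let ?D = "frechet_derivative f (at (s, y))"
  have f: "(f has_derivative ?D) (at (s, y))"
    using assms frechet_derivative_works by blast
  interpret D: bounded_linear ?D
    using f by (rule has_derivative_bounded_linear)
  have h1: "?D (h, 0) = ?D (1, 0) * h" and h2: "?D (0, h) = ?D (0, 1) * h" for h
    using D.scaleR[of h "(1, 0)"] D.scaleR[of h "(0, 1)"] by (simp_all add: mult.commute)
  have "((\<lambda>s. (s, y)) has_derivative (\<lambda>h. (h, 0))) (at s)"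
    by (auto intro!: derivative_eq_intros)
  from has_derivative_compose[OF this f]
  have "((\<lambda>s. f (s, y)) has_derivative (\<lambda>h. ?D (h, 0))) (at s)" .
  moreover have "(\<lambda>h. ?D (h, 0)) = (*) (pd1 f (s, y))" by (rule ext) (rule h1)
  ultimately show "((\<lambda>s. f (s, y)) has_real_derivative pd1 f (s, y)) (at s)"
    by (simp only: has_field_derivative_def)
  have "((\<lambda>y. (s, y)) has_derivative (\<lambda>h. (0, h))) (at y)"
    by (auto intro!: derivative_eq_intros)
  from has_derivative_compose[OF this f]
  have "((\<lambda>y. f (s, y)) has_derivative (\<lambda>h. ?D (0, h))) (at y)" .
  moreover have "(\<lambda>h. ?D (0, h)) = (*) (pd2 f (s, y))" by (rule ext) (rule h2)
  ultimately show "((\<lambda>y. f (s, y)) has_real_derivative pd2 f (s, y)) (at y)"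
    by (simp only: has_field_derivative_def)
qed

text \<open>Near \<open>b\<close>, \<open>f (s, y) - f (s, b - e2)\<close> is the integral of
  \<open>pd2 f (s, _)\<close>. Differentiating under the integral in \<open>s\<close> writes
  \<open>pd1 f (a, y)\<close> as an integral of \<open>pd1 (pd2 f) (a, _)\<close> plus a constant,
  and the fundamental theorem then gives its derivative in \<open>y\<close>.\<close>

lemma partial_derivatives_commute:
  fixes f :: "real \<times> real \<Rightarrow> real"
  assumes S: "open S" and f: "smooth_on S f" and p: "(a, b) \<in> S"
  shows "pd1 (pd2 f) (a, b) = pd2 (pd1 f) (a, b)"
proof -
  obtain A B where AB: "open A" "open B" "a \<in> A" "b \<in> B" "A \<times> B \<subseteq> S"
    using S p by (rule open_prod_elim) blast
  obtain e1 where e1: "e1 > 0" "ball a e1 \<subseteq> A"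
    using AB open_contains_ball by metis
  obtain e2 where e2: "e2 > 0" "cball b e2 \<subseteq> B"
    using AB open_contains_cball by metis
  define U where "U = ball a e1"
  have sub: "U \<times> {b - e2..b + e2} \<subseteq> S"
    using AB(5) e1 e2 by (auto simp: U_def dist_real_def subset_iff)
  have f2: "smooth_on S (pd2 f)" and f1: "smooth_on S (pd1 f)" and f12: "smooth_on S (pd1 (pd2 f))"
    using f by (auto intro: smooth_on_frechet_derivative)
  have cont2: "continuous_on (U \<times> {b - e2..b + e2}) (pd2 f)"
    and cont12: "continuous_on (U \<times> {b - e2..b + e2}) (pd1 (pd2 f))"
    using f2 f12 sub smooth_on_continuous_on continuous_on_subset by blast+
  have int: "((\<lambda>t. pd2 f (s, t)) has_integral f (s, y) - f (s, b - e2)) {b - e2..y}"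
    if "s \<in> U" "y \<in> {b - e2..b + e2}" for s y
  proof (rule fundamental_theorem_of_calculus)
    fix t assume "t \<in> {b - e2..y}"
    then have "(s, t) \<in> S" using that sub by auto
    then have "((\<lambda>t. f (s, t)) has_real_derivative pd2 f (s, t)) (at t)"
      by (intro partial_derivatives(2) smooth_on_differentiable[OF f])
    then show "((\<lambda>t. f (s, t)) has_vector_derivative pd2 f (s, t)) (at t within {b - e2..y})"
      by (auto simp: has_real_derivative_iff_has_vector_derivative intro: has_vector_derivative_at_within)
  qed (use that in auto)
  have diff: "pd1 f (a, y) = integral {b - e2..y} (\<lambda>t. pd1 (pd2 f) (a, t)) + pd1 f (a, b - e2)"
    if y: "y \<in> {b - e2..b + e2}" for y
  proof -
    have "((\<lambda>s. integral (cbox (b - e2) y) (\<lambda>t. pd2 f (s, t))) has_real_derivative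
        integral (cbox (b - e2) y) (\<lambda>t. pd1 (pd2 f) (a, t))) (at a within U)"
    proof (rule leibniz_rule_field_derivative)
      show "((\<lambda>s. pd2 f (s, t)) has_real_derivative pd1 (pd2 f) (s, t)) (at s within U)"
        if "s \<in> U" "t \<in> cbox (b - e2) y" for s t
      proof -
        have "(s, t) \<in> S" using that sub y by auto
        then show ?thesis
          by (rule has_field_derivative_at_within
              [OF partial_derivatives(1)[OF smooth_on_differentiable[OF f2]]])
      qed
      show "(\<lambda>t. pd2 f (s, t)) integrable_on cbox (b - e2) y" if "s \<in> U" for s
        using int[OF that y] by (auto simp: integrable_on_def)
      show "continuous_on (U \<times> cbox (b - e2) y) (\<lambda>(s, t). pd1 (pd2 f) (s, t))"
      proof -
        have "U \<times> cbox (b - e2) y \<subseteq> U \<times> {b - e2..b + e2}" using y by auto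
        from continuous_on_subset[OF cont12 this] show ?thesis by (simp add: split_beta)
      qed
      show "a \<in> U" "convex U" using e1 by (auto simp: U_def)
    qed
    then have "((\<lambda>s. integral (cbox (b - e2) y) (\<lambda>t. pd2 f (s, t))) has_real_derivative
        integral (cbox (b - e2) y) (\<lambda>t. pd1 (pd2 f) (a, t))) (at a)"
      using at_within_open[of a U] e1 by (simp add: U_def)
    moreover have "\<forall>\<^sub>F s in at a. integral (cbox (b - e2) y) (\<lambda>t. pd2 f (s, t)) =
        f (s, y) - f (s, b - e2)"
    proof -
      have "open U" "a \<in> U" using e1 by (auto simp: U_def)
      then have "\<forall>\<^sub>F s in at a. s \<in> U" by (rule eventually_at_in_open')
      then show ?thesis
      proof eventually_elim
        case (elim s)
        show ?case using integral_unique[OF int[OF elim y]] by simp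
      qed
    qed
    moreover have "integral (cbox (b - e2) y) (\<lambda>t. pd2 f (a, t)) = f (a, y) - f (a, b - e2)"
      using integral_unique[OF int[of a y]] y e1 by (simp add: U_def)
    ultimately have "((\<lambda>s. f (s, y) - f (s, b - e2)) has_real_derivative
        integral (cbox (b - e2) y) (\<lambda>t. pd1 (pd2 f) (a, t))) (at a)"
      by (rule has_field_derivative_cong_eventually[THEN iffD1, rotated 2])
    moreover have "((\<lambda>s. f (s, y) - f (s, b - e2)) has_real_derivative
        pd1 f (a, y) - pd1 f (a, b - e2)) (at a)"
    proof -
      have "(a, y) \<in> S" "(a, b - e2) \<in> S" using sub y e1 e2 by (auto simp: U_def)
      then show ?thesis
        by (intro DERIV_diff partial_derivatives(1) smooth_on_differentiable[OF f])
    qed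
    ultimately have "integral (cbox (b - e2) y) (\<lambda>t. pd1 (pd2 f) (a, t))
        = pd1 f (a, y) - pd1 f (a, b - e2)"
      by (rule DERIV_unique)
    then show ?thesis by simp
  qed
  have "((\<lambda>y. integral {b - e2..y} (\<lambda>t. pd1 (pd2 f) (a, t))) has_real_derivative
      pd1 (pd2 f) (a, b)) (at b within {b - e2..b + e2})"
  proof (rule integral_has_real_derivative)
    show "continuous_on {b - e2..b + e2} (\<lambda>t. pd1 (pd2 f) (a, t))"
      using e1 by (intro continuous_on_compose2[OF cont12]) (auto simp: U_def intro!: continuous_intros)
  qed (use e2 in auto)
  then have "((\<lambda>y. integral {b - e2..y} (\<lambda>t. pd1 (pd2 f) (a, t)) + pd1 f (a, b - e2))
      has_real_derivative pd1 (pd2 f) (a, b)) (at b within {b - e2..b + e2})"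
    using DERIV_add[OF _ DERIV_const] by fastforce
  then have "((\<lambda>y. pd1 f (a, y)) has_real_derivative pd1 (pd2 f) (a, b)) (at b within {b - e2..b + e2})"
    by (rule has_field_derivative_transform_within[where d = 1])
      (simp, use e2 in simp, rule diff[symmetric])
  then have "((\<lambda>y. pd1 f (a, y)) has_real_derivative pd1 (pd2 f) (a, b)) (at b)"
    using e2 by (simp add: at_within_Icc_at)
  moreover have "((\<lambda>y. pd1 f (a, y)) has_real_derivative pd2 (pd1 f) (a, b)) (at b)"
    using p by (intro partial_derivatives(2) smooth_on_differentiable[OF f1])
  ultimately show ?thesis by (rule DERIV_unique)
qed

section \<open>Rings of smooth functions\<close>

lemma smooth_on_UNIV_uminus: "smooth_on UNIV f \<Longrightarrow> smooth_on UNIV (\<lambda>x. - f x :: real)"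
  using smooth_on_mult[OF open_UNIV smooth_on_const, of f "- 1"] by simp

lemma smooth_on_UNIV_diff:
  "smooth_on UNIV f \<Longrightarrow> smooth_on UNIV g \<Longrightarrow> smooth_on UNIV (\<lambda>x. f x - g x :: real)"
  using smooth_on_add[OF open_UNIV, of f "\<lambda>x. - g x"] smooth_on_UNIV_uminus[of g] by simp

text \<open>A type of its own makes the smooth functions on the circle an instance of
  \<open>comm_ring_1\<close>, so that the libraries of matrices, determinants and Laurent series
  apply to them.\<close>

typedef cfun = "{f. circle_smooth f}" morphisms cval Abs_cfun
  by (rule exI[of _ "\<lambda>x. 0"]) (simp add: circle_smooth_def smooth_on_const)

setup_lifting type_definition_cfun

lemma cfun_eqI: "(\<And>x. cval f x = cval g x) \<Longrightarrow> f = g"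
  by (metis cval_inject ext)

lemma circle_smooth_cval: "circle_smooth (cval f)"
  using cval by auto

lemma cval_Abs_cfun: "circle_smooth f \<Longrightarrow> cval (Abs_cfun f) = f"
  by (simp add: Abs_cfun_inverse)

text \<open>\<open>deriv\<close> selects from the set of derivatives at a point, and a shift by a
  period does not change that set.\<close>

lemma deriv_periodic:
  fixes f :: "real \<Rightarrow> real"
  assumes "\<And>x. f (x + c) = f x"
  shows "deriv f (x + c) = deriv f x"
proof -
  have "(f has_field_derivative D) (at (x + c)) \<longleftrightarrow> (f has_field_derivative D) (at x)" for D
    using DERIV_at_within_shift[of f D c x UNIV] assms by (simp add: add.commute)
  then show ?thesis by (simp add: deriv_def)
qed

instantiation cfun :: comm_ring_1
begin

lift_definition zero_cfun :: cfun is "\<lambda>x. 0"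
  by (simp add: circle_smooth_def smooth_on_const)
lift_definition one_cfun :: cfun is "\<lambda>x. 1"
  by (simp add: circle_smooth_def smooth_on_const)
lift_definition plus_cfun :: "cfun \<Rightarrow> cfun \<Rightarrow> cfun" is "\<lambda>f g x. f x + g x"
  by (simp add: circle_smooth_def smooth_on_add)
lift_definition minus_cfun :: "cfun \<Rightarrow> cfun \<Rightarrow> cfun" is "\<lambda>f g x. f x - g x"
  by (simp add: circle_smooth_def smooth_on_UNIV_diff)
lift_definition uminus_cfun :: "cfun \<Rightarrow> cfun" is "\<lambda>f x. - f x"
  by (simp add: circle_smooth_def smooth_on_UNIV_uminus)
lift_definition times_cfun :: "cfun \<Rightarrow> cfun \<Rightarrow> cfun" is "\<lambda>f g x. f x * g x"
  by (simp add: circle_smooth_def smooth_on_mult)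

instance
  by standard (transfer; auto simp: algebra_simps dest: fun_cong)+

end

lemma cval_simps [simp]:
  "cval 0 x = 0" "cval 1 x = 1" "cval (f + g) x = cval f x + cval g x"
  "cval (f - g) x = cval f x - cval g x" "cval (- f) x = - cval f x"
  "cval (f * g) x = cval f x * cval g x"
  by (transfer; simp)+

lift_definition cder :: "cfun \<Rightarrow> cfun" is deriv
  by (simp add: circle_smooth_def smooth_on_deriv deriv_periodic)

lift_definition cconst :: "real \<Rightarrow> cfun" is "\<lambda>c x. c"
  by (simp add: circle_smooth_def smooth_on_const)

lemma cval_cconst [simp]: "cval (cconst c) x = c"
  by transfer simp

lemma cval_cder: "cval (cder f) = deriv (cval f)"
  by transfer simp

lemma cval_has_real_derivative: "(cval f has_real_derivative cval (cder f) x) (at x)"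
  using smooth_on_has_real_derivative circle_smooth_cval[of f]
  by (auto simp: cval_cder circle_smooth_def)

lemma cval_of_nat [simp]: "cval (of_nat k) x = of_nat k"
  by (induction k) auto

lemma cval_sum [simp]: "cval (sum f A) x = (\<Sum>i\<in>A. cval (f i) x)"
  by (induction A rule: infinite_finite_induct) auto

text \<open>Families of circle functions that are jointly smooth in a parameter \<open>t\<close>,
  which is not periodic. They hold the variations \<open>u + t v\<close>.\<close>

typedef sfun = "{f :: real \<times> real \<Rightarrow> real. smooth_on UNIV f \<and> (\<forall>t x. f (t, x + 2 * pi) = f (t, x))}"
  morphisms sval Abs_sfun
  by (rule exI[of _ "\<lambda>x. 0"]) (simp add: smooth_on_const)

setup_lifting type_definition_sfun

lemma sfun_eqI: "(\<And>t x. sval f (t, x) = sval g (t, x)) \<Longrightarrow> f = g"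
  by (metis sval_inject ext surj_pair)

instantiation sfun :: comm_ring_1
begin

lift_definition zero_sfun :: sfun is "\<lambda>p. 0"
  by (simp add: smooth_on_const)
lift_definition one_sfun :: sfun is "\<lambda>p. 1"
  by (simp add: smooth_on_const)
lift_definition plus_sfun :: "sfun \<Rightarrow> sfun \<Rightarrow> sfun" is "\<lambda>f g p. f p + g p"
  by (simp add: smooth_on_add)
lift_definition minus_sfun :: "sfun \<Rightarrow> sfun \<Rightarrow> sfun" is "\<lambda>f g p. f p - g p"
  by (simp add: smooth_on_UNIV_diff)
lift_definition uminus_sfun :: "sfun \<Rightarrow> sfun" is "\<lambda>f p. - f p"
  by (simp add: smooth_on_UNIV_uminus)
lift_definition times_sfun :: "sfun \<Rightarrow> sfun \<Rightarrow> sfun" is "\<lambda>f g p. f p * g p"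
  by (simp add: smooth_on_mult)

instance
  by standard (transfer; auto simp: algebra_simps dest: fun_cong)+

end

lemma sval_simps [simp]:
  "sval 0 p = 0" "sval 1 p = 1" "sval (f + g) p = sval f p + sval g p"
  "sval (f - g) p = sval f p - sval g p" "sval (- f) p = - sval f p"
  "sval (f * g) p = sval f p * sval g p"
  by (transfer; simp)+

lemma smooth_on_sval: "smooth_on UNIV (sval f)"
  using sval[of f] by auto

lemma frechet_derivative_shift:
  fixes f :: "'a::real_normed_vector \<Rightarrow> 'b::real_normed_vector"
  assumes f: "\<And>p. f (p + c) = f p" and d: "\<And>p. f differentiable (at p)"
  shows "frechet_derivative f (at (p + c)) = frechet_derivative f (at p)"
proof -
  have "(f has_derivative frechet_derivative f (at (p + c))) (at (p + c))"
    using d frechet_derivative_works by blast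
  moreover have "((\<lambda>p. p + c) has_derivative (\<lambda>h. h)) (at p)"
    by (auto intro!: derivative_eq_intros)
  ultimately have "((\<lambda>p. f (p + c)) has_derivative frechet_derivative f (at (p + c))) (at p)"
    using has_derivative_compose[of "\<lambda>p. p + c" "\<lambda>h. h" p UNIV f] by simp
  then show ?thesis using f frechet_derivative_at by simp
qed

lemma frechet_derivative_periodic:
  fixes f :: "real \<times> real \<Rightarrow> real"
  assumes "smooth_on UNIV f" "\<forall>t x. f (t, x + 2 * pi) = f (t, x)"
  shows "frechet_derivative f (at (t, x + 2 * pi)) = frechet_derivative f (at (t, x))"
proof -
  have "f (p + (0, 2 * pi)) = f p" for p
    using assms(2) by (cases p) auto
  from frechet_derivative_shift[of f, OF this, of "(t, x)"] show ?thesis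
    using smooth_on_differentiable[OF assms(1)] by simp
qed

lift_definition sdt :: "sfun \<Rightarrow> sfun" is pd1
  by (simp add: smooth_on_frechet_derivative frechet_derivative_periodic)

lift_definition sdx :: "sfun \<Rightarrow> sfun" is pd2
  by (simp add: smooth_on_frechet_derivative frechet_derivative_periodic)

lemma sval_sdt: "((\<lambda>t. sval f (t, x)) has_real_derivative sval (sdt f) (t, x)) (at t)"
  using partial_derivatives(1)[OF smooth_on_differentiable[OF smooth_on_sval]]
  by (simp add: sdt.rep_eq)

lemma sval_sdx: "((\<lambda>x. sval f (t, x)) has_real_derivative sval (sdx f) (t, x)) (at x)"
  using partial_derivatives(2)[OF smooth_on_differentiable[OF smooth_on_sval]]
  by (simp add: sdx.rep_eq)

text \<open>This is the commutation hypothesis of \<open>dressing_variation\<close>.\<close>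

lemma sdt_sdx: "sdt (sdx f) = sdx (sdt f)"
  by (rule sfun_eqI)
    (simp add: sdt.rep_eq sdx.rep_eq partial_derivatives_commute[OF open_UNIV smooth_on_sval])

text \<open>Restriction to one value of \<open>t\<close>. As a ring homomorphism that carries
  \<open>sdx\<close> to \<open>cder\<close>, it brings results over \<open>sfun\<close> back to
  \<open>cfun\<close>.\<close>

lift_definition sfreeze :: "real \<Rightarrow> sfun \<Rightarrow> cfun" is "\<lambda>t f x. f (t, x)"
proof -
  fix t :: real and f :: "real \<times> real \<Rightarrow> real"
  assume *: "smooth_on UNIV f \<and> (\<forall>t x. f (t, x + 2 * pi) = f (t, x))"
  have "(Pair t has_derivative (\<lambda>h. (0, h))) (at x)" for x :: real
    by (auto intro!: derivative_eq_intros)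
  from smooth_on_affine[OF open_UNIV this, of UNIV f] show "circle_smooth (\<lambda>x. f (t, x))"
    using * by (simp add: circle_smooth_def)
qed

lemma cval_sfreeze [simp]: "cval (sfreeze t f) x = sval f (t, x)"
  by transfer simp

lemma cder_sfreeze: "cder (sfreeze t f) = sfreeze t (sdx f)"
proof (rule cfun_eqI)
  fix x
  have "cval (sfreeze t f) = (\<lambda>x. sval f (t, x))" by auto
  then show "cval (cder (sfreeze t f)) x = cval (sfreeze t (sdx f)) x"
    using DERIV_imp_deriv[OF sval_sdx[of f t x]] by (simp add: cval_cder)
qed

lift_definition sconst :: "cfun \<Rightarrow> sfun" is "\<lambda>f p. f (snd p)"
proof -
  fix f assume *: "circle_smooth f"
  have "(snd has_derivative snd) (at x)" for x :: "real \<times> real"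
    by (auto intro!: derivative_eq_intros)
  from smooth_on_affine[OF open_UNIV this, of UNIV f]
  show "smooth_on UNIV (\<lambda>p :: real \<times> real. f (snd p)) \<and> (\<forall>t x. f (snd (t :: real, x + 2 * pi)) = f (snd (t, x)))"
    using * by (simp add: circle_smooth_def)
qed

lift_definition stime :: sfun is fst
  by (simp add: smooth_on_bounded_linear bounded_linear_fst)

lemma sval_sconst [simp]: "sval (sconst f) (t, x) = cval f x"
  by transfer simp

lemma sval_stime [simp]: "sval stime (t, x) = t"
  by transfer simp

lemma sval_of_nat [simp]: "sval (of_nat k) p = of_nat k"
  by (induction k) auto

lemma sdt_sconst: "sdt (sconst f) = 0"
proof (rule sfun_eqI)
  fix t x
  show "sval (sdt (sconst f)) (t, x) = sval 0 (t, x)"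
    using DERIV_unique[OF sval_sdt[of "sconst f" x t]] by simp
qed

lemma sdt_stime: "sdt stime = 1"
proof (rule sfun_eqI)
  fix t x
  show "sval (sdt stime) (t, x) = sval 1 (t, x)"
    using DERIV_unique[OF sval_sdt[of stime x t]] by simp
qed

text \<open>By periodicity. This is what removes the total derivatives from the gradient and from
  the Lenard relation.\<close>

lemma integral_cder: "integral {0..2 * pi} (cval (cder f)) = 0"
proof -
  have "(cval (cder f) has_integral cval f (2 * pi) - cval f 0) {0..2 * pi}"
    using cval_has_real_derivative
    by (intro fundamental_theorem_of_calculus)
      (auto simp: has_real_derivative_iff_has_vector_derivative intro: has_vector_derivative_at_within)
  moreover have "cval f (2 * pi) = cval f 0"
    using circle_smooth_cval[of f] by (metis add_0 circle_smooth_def)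
  ultimately show ?thesis by (simp add: integral_unique)
qed

lemma cval_continuous_on: "continuous_on S (cval f)"
  using circle_smooth_cval[of f] smooth_on_continuous_on continuous_on_subset
  unfolding circle_smooth_def by blast

lemma cval_integrable: "cval f integrable_on {0..2 * pi}"
  by (intro integrable_continuous_real cval_continuous_on)

text \<open>Differentiation under the integral; the joint continuity of \<open>sdt f\<close>
  justifies it.\<close>

lemma integral_sfun_has_derivative:
  "((\<lambda>t. integral {0..2 * pi} (cval (sfreeze t f))) has_real_derivative
     integral {0..2 * pi} (cval (sfreeze t (sdt f)))) (at t)"
proof -
  have "((\<lambda>t. integral (cbox 0 (2 * pi)) (cval (sfreeze t f))) has_real_derivative
     integral (cbox 0 (2 * pi)) (cval (sfreeze t (sdt f)))) (at t within UNIV)"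
  proof (rule leibniz_rule_field_derivative)
    show "continuous_on (UNIV \<times> cbox 0 (2 * pi)) (\<lambda>(t, x). cval (sfreeze t (sdt f)) x)"
      using smooth_on_continuous_on[OF smooth_on_sval[of "sdt f"]] continuous_on_subset
      by (auto simp: split_beta)
    show "cval (sfreeze t f) integrable_on cbox 0 (2 * pi)" for t
      using cval_integrable by simp
  qed (use sval_sdt in auto)
  then show ?thesis by simp
qed

section \<open>Derivations\<close>

text \<open>The same locale covers \<open>cder\<close>, \<open>sdx\<close>, \<open>sdt\<close> and
  their coefficientwise extensions to Laurent series.\<close>

locale derivation =
  fixes d :: "'a::comm_ring_1 \<Rightarrow> 'a"
  assumes add: "d (a + b) = d a + d b"
    and mult: "d (a * b) = d a * b + a * d b"
begin

lemma zero [simp]: "d 0 = 0"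
  using add[of 0 0] by simp

lemma one [simp]: "d 1 = 0"
  using mult[of 1 1] by simp

lemma uminus: "d (- a) = - d a"
  using add[of a "- a"] by (simp add: eq_neg_iff_add_eq_0 add.commute)

lemma diff: "d (a - b) = d a - d b"
  using add[of a "- b"] by (simp add: uminus)

lemma sum: "d (sum f A) = (\<Sum>i\<in>A. d (f i))"
  by (induction A rule: infinite_finite_induct) (simp_all add: add)

lemma of_nat [simp]: "d (of_nat k) = 0"
  by (induction k) (simp_all add: add)

lemma signof [simp]: "d (signof p) = 0"
  by (auto simp: sign_def uminus)

lemma prod:
  "finite A \<Longrightarrow> d (prod f A) = (\<Sum>i\<in>A. \<Prod>j\<in>A. if j = i then d (f i) else f j)"
proof (induction A rule: finite_induct)
  case (insert x A)
  have "(\<Prod>j\<in>insert x A. if j = i then d (f i) else f j)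
      = f x * (\<Prod>j\<in>A. if j = i then d (f i) else f j)" if "i \<in> A" for i
    using insert that by (subst prod.insert) auto
  moreover have "(\<Prod>j\<in>A. if j = x then d (f x) else f j) = prod f A"
    using insert by (intro prod.cong) auto
  ultimately show ?case
    using insert by (simp add: mult sum_distrib_left)
qed simp

lemma mat_mult:
  assumes "A \<in> carrier_mat n m" "B \<in> carrier_mat m k"
  shows "map_mat d (A * B) = map_mat d A * B + A * map_mat d B"
  by (rule eq_matI) (use assms in \<open>auto simp: scalar_prod_def sum mult sum.distrib\<close>)

lemma mat_add:
  assumes "A \<in> carrier_mat n m" "B \<in> carrier_mat n m"
  shows "map_mat d (A + B) = map_mat d A + map_mat d B"
  by (rule eq_matI) (use assms in \<open>auto simp: add\<close>)

lemma mat_diff: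
  assumes "A \<in> carrier_mat n m" "B \<in> carrier_mat n m"
  shows "map_mat d (A - B) = map_mat d A - map_mat d B"
  by (rule eq_matI) (use assms in \<open>auto simp: diff\<close>)

lemma trace: "A \<in> carrier_mat n n \<Longrightarrow> d (trace_mat A) = trace_mat (map_mat d A)"
  by (simp add: trace_mat_def sum)

text \<open>Differentiating the Leibniz expansion gives one determinant for each row, with that row
  differentiated (\<open>B i\<close>). Expansion along this row meets only cofactors of
  \<open>A\<close>, because they do not see row \<open>i\<close>.\<close>

lemma jacobi_formula:
  assumes A: "A \<in> carrier_mat n n"
  shows "d (det A) = trace_mat (adj_mat A * map_mat d A)"
proof -
  define P where "P = {p. p permutes {0..<n}}"
  define B where "B i = mat n n (\<lambda>(k, l). if k = i then d (A $$ (k, l)) else A $$ (k, l))" for i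
  have B: "B i \<in> carrier_mat n n" for i by (simp add: B_def)
  have "d (det A) = (\<Sum>p\<in>P. signof p * (\<Sum>i<n. \<Prod>j = 0..<n. if j = i then d (A $$ (i, p i)) else A $$ (j, p j)))"
    unfolding det_def'[OF A] P_def[symmetric]
    by (simp add: sum mult prod lessThan_atLeast0)
  also have "\<dots> = (\<Sum>p\<in>P. \<Sum>i<n. signof p * (\<Prod>j = 0..<n. B i $$ (j, p j)))"
    unfolding sum_distrib_left
  proof (intro sum.cong refl arg_cong2[where f = "(*)"] prod.cong)
    fix p i j assume "p \<in> P" "j \<in> {0..<n}"
    then have "p j < n" using permutes_in_image[of p "{0..<n}" j] by (auto simp: P_def)
    then show "(if j = i then d (A $$ (i, p i)) else A $$ (j, p j)) = B i $$ (j, p j)"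
      using \<open>j \<in> {0..<n}\<close> by (simp add: B_def)
  qed
  also have "\<dots> = (\<Sum>i<n. det (B i))"
    by (subst sum.swap) (simp add: det_def'[OF B] P_def)
  also have "\<dots> = (\<Sum>i<n. \<Sum>j<n. d (A $$ (i, j)) * cofactor A i j)"
  proof (intro sum.cong refl)
    fix i assume i: "i \<in> {..<n}"
    have "cofactor (B i) i j = cofactor A i j" for j
      unfolding cofactor_def mat_delete_def using A i
      by (intro arg_cong2[where f = "(*)"] arg_cong[where f = det] refl eq_matI) (auto simp: B_def)
    then show "det (B i) = (\<Sum>j<n. d (A $$ (i, j)) * cofactor A i j)"
      using i by (subst laplace_expansion_row[OF B, of i]) (auto simp: B_def)
  qed
  also have "\<dots> = (\<Sum>j<n. \<Sum>i<n. cofactor A i j * d (A $$ (i, j)))"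
    by (subst sum.swap) (simp add: mult.commute)
  also have "\<dots> = trace_mat (adj_mat A * map_mat d A)"
    using A adj_mat(1)[OF A]
    by (auto simp: trace_mat_def adj_mat_def scalar_prod_def lessThan_atLeast0 intro!: sum.cong)
  finally show ?thesis .
qed

end

section \<open>Formal Laurent series\<close>

text \<open>The library's convolution ranges over bounds given by the exact subdegrees, which change
  under coefficientwise maps. Any finite superset of the range serves equally well, so several
  products can share one index set.\<close>

lemma fls_mult_nth_superset:
  fixes f g :: "'a::comm_ring_1 fls"
  assumes f: "\<And>k. k < a \<Longrightarrow> fls_nth f k = 0" and g: "\<And>k. k < b \<Longrightarrow> fls_nth g k = 0"
    and A: "finite A" "{b..k - a} \<subseteq> A"
  shows "fls_nth (f * g) k = (\<Sum>i\<in>A. fls_nth f (k - i) * fls_nth g i)"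
proof (cases "f = 0 \<or> g = 0")
  case False
  then have a: "a \<le> fls_subdegree f" and b: "b \<le> fls_subdegree g"
    using f g by (auto intro: fls_subdegree_geI)
  have "fls_nth (g * f) k = (\<Sum>i\<in>{fls_subdegree g..k - fls_subdegree f}. fls_nth g i * fls_nth f (k - i))"
    by (rule fls_times_nth(2))
  also have "\<dots> = (\<Sum>i\<in>A. fls_nth g i * fls_nth f (k - i))"
  proof (rule sum.mono_neutral_left)
    show "{fls_subdegree g..k - fls_subdegree f} \<subseteq> A" using a b A by auto
    show "\<forall>i\<in>A - {fls_subdegree g..k - fls_subdegree f}. fls_nth g i * fls_nth f (k - i) = 0"
    proof
      fix i assume "i \<in> A - {fls_subdegree g..k - fls_subdegree f}"
      then have "i < fls_subdegree g \<or> k - i < fls_subdegree f" by auto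
      then show "fls_nth g i * fls_nth f (k - i) = 0" by auto
    qed
  qed (use A in auto)
  finally show ?thesis by (simp add: mult.commute)
qed auto

text \<open>The coefficient function is admissible for \<open>Abs_fls\<close> when
  \<open>h 0 = 0\<close>, since zero coefficients then stay zero.\<close>

definition fls_map :: "('a::zero \<Rightarrow> 'b::zero) \<Rightarrow> 'a fls \<Rightarrow> 'b fls" where
  "fls_map h f = Abs_fls (\<lambda>k. h (fls_nth f k))"

lemma fls_map_nth: "h 0 = 0 \<Longrightarrow> fls_nth (fls_map h f) k = h (fls_nth f k)"
  unfolding fls_map_def
  by (subst nth_Abs_fls_lower_bound[of "fls_subdegree f"]) auto

text \<open>\<open>f'\<close> and \<open>g'\<close> may have larger subdegrees than \<open>f\<close>
  and \<open>g\<close>, for instance after differentiation; the index set of \<open>f * g\<close>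
  still covers their product.\<close>

lemma fls_mult_map_nth:
  fixes f g :: "'a::comm_ring_1 fls" and h :: "'b::zero \<Rightarrow> 'a"
  assumes "\<And>k. fls_nth f k = 0 \<Longrightarrow> fls_nth f' k = 0" and "\<And>k. fls_nth g k = 0 \<Longrightarrow> fls_nth g' k = 0"
  shows "fls_nth (f' * g' :: 'c::comm_ring_1 fls) k =
    (\<Sum>i\<in>{fls_subdegree g..k - fls_subdegree f}. fls_nth f' (k - i) * fls_nth g' i)"
  by (rule fls_mult_nth_superset[of "fls_subdegree f" _ "fls_subdegree g"]) (auto simp: assms)

lemma comm_ring_hom_fls_map:
  fixes h :: "'a::comm_ring_1 \<Rightarrow> 'b::comm_ring_1"
  assumes "comm_ring_hom h"
  shows "comm_ring_hom (fls_map h)"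
proof -
  interpret comm_ring_hom h by fact
  have m: "fls_map h (f * g) = fls_map h f * fls_map h g" for f g
  proof (rule fls_eqI)
    fix k
    have "fls_nth (f * g) k = (\<Sum>i\<in>{fls_subdegree g..k - fls_subdegree f}. fls_nth f (k - i) * fls_nth g i)"
      by (rule fls_mult_map_nth) auto
    moreover have "fls_nth (fls_map h f * fls_map h g) k =
        (\<Sum>i\<in>{fls_subdegree g..k - fls_subdegree f}. fls_nth (fls_map h f) (k - i) * fls_nth (fls_map h g) i)"
      by (rule fls_mult_map_nth) (auto simp: fls_map_nth)
    ultimately show "fls_nth (fls_map h (f * g)) k = fls_nth (fls_map h f * fls_map h g) k"
      by (simp add: fls_map_nth hom_distribs)
  qed
  show ?thesis
    by standard (auto intro!: fls_eqI simp: fls_map_nth m hom_distribs)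
qed

lemma (in derivation) fls_map: "derivation (fls_map d)"
proof
  fix f g :: "'a fls"
  show "fls_map d (f + g) = fls_map d f + fls_map d g"
    by (rule fls_eqI) (simp add: fls_map_nth add)
  show "fls_map d (f * g) = fls_map d f * g + f * fls_map d g"
  proof (rule fls_eqI)
    fix k
    let ?I = "{fls_subdegree g..k - fls_subdegree f}"
    have "fls_nth (f * g) k = (\<Sum>i\<in>?I. fls_nth f (k - i) * fls_nth g i)"
      by (rule fls_mult_map_nth) auto
    moreover have "fls_nth (fls_map d f * g) k = (\<Sum>i\<in>?I. fls_nth (fls_map d f) (k - i) * fls_nth g i)"
      by (rule fls_mult_map_nth) (auto simp: fls_map_nth)
    moreover have "fls_nth (f * fls_map d g) k = (\<Sum>i\<in>?I. fls_nth f (k - i) * fls_nth (fls_map d g) i)"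
      by (rule fls_mult_map_nth) (auto simp: fls_map_nth)
    ultimately show "fls_nth (fls_map d (f * g)) k = fls_nth (fls_map d f * g + f * fls_map d g) k"
      by (simp add: fls_map_nth sum mult sum.distrib)
  qed
qed

abbreviation Z :: "'a::comm_ring_1 fls" where
  "Z \<equiv> fls_X_inv"

text \<open>The degree in \<open>Z\<close>, the inverse of the variable of the type of Laurent series.\<close>
definition deg_le :: "int \<Rightarrow> 'a::comm_ring_1 fls \<Rightarrow> bool" where
  "deg_le m f \<longleftrightarrow> (\<forall>k. k < - m \<longrightarrow> fls_nth f k = 0)"

lemma deg_leD: "deg_le m f \<Longrightarrow> k < - m \<Longrightarrow> fls_nth f k = 0"
  by (simp add: deg_le_def)

lemma deg_le_mono: "deg_le m f \<Longrightarrow> m \<le> m' \<Longrightarrow> deg_le m' f"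
  by (simp add: deg_le_def)

lemma deg_le_0 [simp]: "deg_le m 0"
  by (simp add: deg_le_def)

lemma deg_le_add: "deg_le m f \<Longrightarrow> deg_le m g \<Longrightarrow> deg_le m (f + g)"
  by (simp add: deg_le_def)

lemma deg_le_diff: "deg_le m f \<Longrightarrow> deg_le m g \<Longrightarrow> deg_le m (f - g)"
  by (simp add: deg_le_def)

lemma deg_le_sum: "(\<And>i. i \<in> A \<Longrightarrow> deg_le m (f i)) \<Longrightarrow> deg_le m (sum f A)"
  by (simp add: deg_le_def fls_nth_sum)

lemma deg_le_const [simp]: "deg_le 0 (fls_const c)"
  by (simp add: deg_le_def)

lemma deg_le_Z_power [simp]: "deg_le (int k) (Z ^ k)"
  by (simp add: deg_le_def)

lemma deg_le_map: "h 0 = 0 \<Longrightarrow> deg_le m f \<Longrightarrow> deg_le m (fls_map h f)"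
  by (simp add: deg_le_def fls_map_nth)

lemma deg_le_mult:
  assumes "deg_le a f" "deg_le b g" "a + b \<le> c"
  shows "deg_le c (f * g)"
  unfolding deg_le_def
proof (intro allI impI)
  fix k assume "k < - c"
  moreover have "fls_nth (f * g) k = (\<Sum>i\<in>{- b..k + a}. fls_nth f (k - i) * fls_nth g i)"
    by (rule fls_mult_nth_superset[of "- a" _ "- b"]) (use assms in \<open>auto simp: deg_leD\<close>)
  ultimately show "fls_nth (f * g) k = 0" using assms(3) by simp
qed

lemma deg_le_mult_nth:
  assumes "deg_le a f" "deg_le b g"
  shows "fls_nth (f * g) (- (a + b)) = fls_nth f (- a) * fls_nth g (- b)"
proof -
  have "fls_nth (f * g) (- (a + b)) = (\<Sum>i\<in>{- b..- b}. fls_nth f (- (a + b) - i) * fls_nth g i)"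
    by (rule fls_mult_nth_superset[of "- a" _ "- b"]) (use assms in \<open>auto simp: deg_leD\<close>)
  then show ?thesis by simp
qed

lemma deg_le_fls_subdegree: "deg_le (- fls_subdegree f) f"
  by (simp add: deg_le_def)

lemma deg_le_decrease: "deg_le m f \<Longrightarrow> fls_nth f (- m) = 0 \<Longrightarrow> deg_le (m - 1) f"
  unfolding deg_le_def by (metis add.inverse_inverse diff_minus_eq_add minus_diff_eq zless_imp_add1_zle
      linorder_less_linear not_less add.commute uminus_add_conv_diff)

text \<open>The filtration by degree is separated; this ends the successive approximation in
  \<open>riccati_exists\<close>.\<close>

lemma eq_0_if_deg_le_all:
  assumes "\<And>N :: nat. deg_le (c - int N) f"
  shows "f = 0"
proof (rule fls_eqI)
  fix k
  have "k < - (c - int (nat (\<bar>c\<bar> + \<bar>k\<bar> + 1)))" by auto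
  then show "fls_nth f k = fls_nth 0 k"
    using assms deg_leD by fastforce
qed

subsection \<open>Series in \<open>Z\<close> as vectors of series in \<open>Z\<^sup>n\<close>\<close>

text \<open>
  The series in \<open>z\<close> form a free module with basis \<open>1, z, \<dots>, z\<^bsup>n-1\<^esup>\<close> over the series in \<open>\<lambda> = z\<^sup>n\<close>:
  \<open>section_coord n r h\<close> is the coordinate of \<open>h\<close> at \<open>z\<^sup>r\<close>, and \<open>mult_mat n h\<close> is the matrix of
  multiplication by \<open>h\<close>, so that \<open>J\<close> is the matrix of multiplication by \<open>z\<close>.
\<close>
definition section_coord :: "nat \<Rightarrow> nat \<Rightarrow> 'a::comm_ring_1 fls \<Rightarrow> 'a fls" where
  "section_coord n r h = Abs_fls (\<lambda>k. fls_nth h (int n * k - int r))"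

definition mult_mat :: "nat \<Rightarrow> 'a::comm_ring_1 fls \<Rightarrow> 'a fls mat" where
  "mult_mat n h = mat n n (\<lambda>(r, s). section_coord n r (fls_shift (int s) h))"

lemma mult_mat_carrier [simp]: "mult_mat n h \<in> carrier_mat n n"
  "dim_row (mult_mat n h) = n" "dim_col (mult_mat n h) = n"
  by (auto simp: mult_mat_def)

lemma section_coord_nth:
  assumes "n > 0"
  shows "fls_nth (section_coord n r h) k = fls_nth h (int n * k - int r)"
  unfolding section_coord_def
proof (rule nth_Abs_fls_lower_bound)
  show "\<forall>k<min 0 (fls_subdegree h). fls_nth h (int n * k - int r) = 0"
  proof (intro allI impI)
    fix k assume k: "k < min 0 (fls_subdegree h)"
    then have "int n * k \<le> 1 * k" using assms by (intro mult_right_mono_neg) auto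
    then have "int n * k - int r < fls_subdegree h" using k by linarith
    then show "fls_nth h (int n * k - int r) = 0" by simp
  qed
qed

lemma mult_mat_nth:
  "r < n \<Longrightarrow> s < n \<Longrightarrow> fls_nth (mult_mat n h $$ (r, s)) k = fls_nth h (int n * k - int r + int s)"
  by (simp add: mult_mat_def section_coord_nth)

text \<open>Every degree is \<open>n l - s\<close> for exactly one \<open>s < n\<close> and one
  \<open>l\<close>. Splitting the convolution along these pairs turns it into a matrix
  product.\<close>

lemma section_coord_mult:
  fixes h g :: "'a::comm_ring_1 fls"
  assumes r: "r < n"
  shows "section_coord n r (h * g) = (\<Sum>s<n. mult_mat n h $$ (r, s) * section_coord n s g)"
proof (rule fls_eqI)
  fix k
  have n: "n > 0" using r by simp
  define a where "a = fls_subdegree h"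
  define b where "b = fls_subdegree g"
  \<comment> \<open>Lower bounds for the supports of the coordinates. The estimate
    \<open>int n * l \<le> l\<close> needs \<open>l \<le> 0\<close>, hence the minimum with
    \<open>0\<close>; the \<open>- int n\<close> absorbs the shift by \<open>s\<close>.\<close>
  define a' where "a' = min 0 (a - int n)"
  define b' where "b' = min 0 b"
  have le: "int n * l \<le> l" if "l \<le> 0" for l
    using mult_right_mono_neg[of 1 "int n" l] n that by simp
  define A where "A = {b'..k - a'}"
  define B where "B = (\<lambda>(s, l). int n * l - int s) ` ({..<n} \<times> A)"
  have inj: "inj_on (\<lambda>(s, l). int n * l - int s) ({..<n} \<times> A)"
  proof (rule inj_onI, clarsimp)
    fix s s' :: nat and l l' :: int
    assume ss: "s < n" "s' < n" and eq: "int n * l - int s = int n * l' - int s'"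
    then have "int n * (l - l') = int s - int s'" by (simp add: algebra_simps)
    moreover have "\<bar>int s - int s'\<bar> < int n" using ss by auto
    ultimately have "l - l' = 0" using n
      by (metis abs_mult abs_of_nat dvd_triv_left zdvd_not_zless abs_dvd_iff dvd_abs_iff
          mult_eq_0_iff of_nat_0_less_iff abs_0_eq less_irrefl zero_less_abs_iff)
    then show "s = s' \<and> l = l'" using eq by simp
  qed
  \<comment> \<open>The pair belonging to \<open>j\<close> is \<open>s = (- j) mod n\<close> and
    \<open>l = (j + s) div n\<close>.\<close>
  have B: "{b..int n * k - int r - a} \<subseteq> B"
  proof
    fix j assume j: "j \<in> {b..int n * k - int r - a}"
    define s where "s = nat ((- j) mod int n)"
    define l where "l = (j + int s) div int n"
    have s: "s < n" "int s = (- j) mod int n" using n by (auto simp: s_def nat_less_iff)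
    have "int n dvd j + int s"
      by (metis add.commute add.left_neutral add_uminus_conv_diff diff_self mod_0 mod_add_right_eq
          mod_diff_left_eq mod_eq_0_iff_dvd mod_mod_trivial s(2))
    then have jl: "j = int n * l - int s" by (simp add: l_def)
    have "b' \<le> l"
    proof (rule ccontr)
      assume "\<not> b' \<le> l"
      then have "l < 0" "l < b" by (auto simp: b'_def)
      moreover from this have "int n * l \<le> l" by (intro le) simp
      ultimately show False using jl j unfolding atLeastAtMost_iff by linarith
    qed
    moreover have "l \<le> k - a'"
    proof (rule ccontr)
      assume "\<not> l \<le> k - a'"
      then have "int n * (k - a' + 1) \<le> int n * l" using n by (intro mult_left_mono) auto
      then have "int n * k + int n \<le> int n * a' + int n * l" by (simp add: algebra_simps)
      also have "\<dots> \<le> (a - int n) + int n * l" using le[of a'] by (auto simp: a'_def)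
      finally show False using jl j s by auto
    qed
    ultimately show "j \<in> B" using s jl by (force simp: B_def A_def)
  qed
  have "fls_nth (section_coord n r (h * g)) k =
      (\<Sum>j\<in>B. fls_nth h (int n * k - int r - j) * fls_nth g j)"
    unfolding section_coord_nth[OF n]
    by (rule fls_mult_nth_superset[of a _ b]) (use B in \<open>auto simp: a_def b_def B_def A_def\<close>)
  also have "\<dots> = (\<Sum>(s, l)\<in>{..<n} \<times> A. fls_nth h (int n * k - int r - (int n * l - int s)) * fls_nth g (int n * l - int s))"
    unfolding B_def by (subst sum.reindex[OF inj]) (simp add: o_def split_beta)
  also have "\<dots> = (\<Sum>s<n. \<Sum>l\<in>A. fls_nth h (int n * k - int r - (int n * l - int s)) * fls_nth g (int n * l - int s))"
    by (rule sum.cartesian_product[symmetric])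
  also have "\<dots> = (\<Sum>s<n. fls_nth (mult_mat n h $$ (r, s) * section_coord n s g) k)"
  proof (rule sum.cong[OF refl])
    fix s assume s: "s \<in> {..<n}"
    have "fls_nth (mult_mat n h $$ (r, s) * section_coord n s g) k =
        (\<Sum>l\<in>A. fls_nth (mult_mat n h $$ (r, s)) (k - l) * fls_nth (section_coord n s g) l)"
    proof (rule fls_mult_nth_superset[of a' _ b'])
      fix l assume "l < a'"
      then have "l < 0" "l < a - int n" by (auto simp: a'_def)
      moreover from this have "int n * l \<le> l" by (intro le) simp
      moreover have "int s < int n" using s by simp
      ultimately have "int n * l - int r + int s < a" by linarith
      then show "fls_nth (mult_mat n h $$ (r, s)) l = 0"
        using r s by (simp add: mult_mat_nth a_def)
    next
      fix l assume "l < b'"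
      then have "l < 0" "l < b" by (auto simp: b'_def)
      moreover from this have "int n * l \<le> l" by (intro le) simp
      ultimately have "int n * l - int s < b" by linarith
      then show "fls_nth (section_coord n s g) l = 0"
        by (simp add: section_coord_nth n b_def)
    qed (auto simp: A_def)
    then show "(\<Sum>l\<in>A. fls_nth h (int n * k - int r - (int n * l - int s)) * fls_nth g (int n * l - int s)) =
        fls_nth (mult_mat n h $$ (r, s) * section_coord n s g) k"
      using r s by (simp add: mult_mat_nth section_coord_nth n algebra_simps)
  qed
  also have "\<dots> = fls_nth (\<Sum>s<n. mult_mat n h $$ (r, s) * section_coord n s g) k"
    by (simp add: fls_nth_sum)
  finally show "fls_nth (section_coord n r (h * g)) k =
      fls_nth (\<Sum>s<n. mult_mat n h $$ (r, s) * section_coord n s g) k" .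
qed

lemma section_coord_add: "n > 0 \<Longrightarrow> section_coord n r (f + g) = section_coord n r f + section_coord n r g"
  by (rule fls_eqI) (simp add: section_coord_nth)

lemma section_coord_0 [simp]: "n > 0 \<Longrightarrow> section_coord n r 0 = 0"
  by (rule fls_eqI) (simp add: section_coord_nth)

lemma section_coord_sum:
  "n > 0 \<Longrightarrow> section_coord n r (sum f A) = (\<Sum>i\<in>A. section_coord n r (f i))"
  by (induction A rule: infinite_finite_induct) (simp_all add: section_coord_add)

lemma section_coord_const: "n > 0 \<Longrightarrow> section_coord n r (fls_const c * f) = fls_const c * section_coord n r f"
  by (rule fls_eqI) (simp add: section_coord_nth)

lemma section_coord_map:
  "n > 0 \<Longrightarrow> h 0 = 0 \<Longrightarrow> section_coord n r (fls_map h f) = fls_map h (section_coord n r f)"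
  by (rule fls_eqI) (simp add: section_coord_nth fls_map_nth)

lemma section_coord_Z_power_mult:
  fixes f :: "'a::comm_ring_1 fls"
  assumes "n > 0"
  shows "section_coord n r (Z ^ n * f) = Z * section_coord n r f"
proof (rule fls_eqI)
  fix k
  have "Z ^ n * f = fls_shift (int n) f" by (simp add: fls_X_inv_power_times_conv_shift)
  moreover have "Z * section_coord n r f = fls_shift 1 (section_coord n r f)"
    by (simp add: fls_X_inv_times_conv_shift)
  ultimately show "fls_nth (section_coord n r (Z ^ n * f)) k = fls_nth (Z * section_coord n r f) k"
    using assms by (simp add: section_coord_nth algebra_simps)
qed

lemma section_coord_1:
  assumes "r < n"
  shows "section_coord n r (1 :: 'a::comm_ring_1 fls) = (if r = 0 then 1 else 0)"
proof (rule fls_eqI)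
  fix k
  have "int n * k = int r \<longleftrightarrow> k = 0 \<and> r = 0"
    using assms by (metis mult_eq_0_iff nat_dvd_not_less neq0_conv of_nat_0_eq_iff dvd_triv_left
        of_nat_dvd_iff mult.commute less_nat_zero_code of_nat_0)
  then show "fls_nth (section_coord n r (1 :: 'a fls)) k = fls_nth (if r = 0 then 1 else 0) k"
    using assms by (simp add: section_coord_nth)
qed

lemma section_coord_inject:
  assumes "n > 0" "\<And>r. r < n \<Longrightarrow> section_coord n r f = section_coord n r g"
  shows "f = g"
proof (rule fls_eqI)
  fix j
  define r where "r = nat ((- j) mod int n)"
  have r: "r < n" "int r = (- j) mod int n" using assms(1) by (auto simp: r_def nat_less_iff)
  have "int n dvd j + int r"
    by (metis add.commute add.left_neutral add_uminus_conv_diff diff_self mod_0 mod_add_right_eq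
        mod_diff_left_eq mod_eq_0_iff_dvd mod_mod_trivial r(2))
  then obtain l where "j = int n * l - int r" by (metis add_diff_cancel_right' dvdE)
  then show "fls_nth f j = fls_nth g j"
    using assms(2)[OF r(1)] section_coord_nth[OF assms(1)] by metis
qed

text \<open>The coefficients of the \<open>v r\<close> are interleaved. The subdegrees of these
  finitely many series have a common lower bound, which makes the result a Laurent series.\<close>

lemma ex_section_coord:
  fixes v :: "nat \<Rightarrow> 'a::comm_ring_1 fls"
  assumes n: "n > 0"
  shows "\<exists>h. \<forall>r<n. section_coord n r h = v r"
proof -
  define c where "c j = fls_nth (v (nat ((- j) mod int n))) ((j + (- j) mod int n) div int n)" for j
  define b where "b = Min ((\<lambda>r. fls_subdegree (v r)) ` {..<n})"
  have b: "fls_nth (v r) k = 0" if "k < b" "r < n" for k r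
  proof -
    have "b \<le> fls_subdegree (v r)" using that(2) by (auto simp: b_def intro!: Min_le)
    then show ?thesis using that(1) by simp
  qed
  have "c j = 0" if "j < int n * b - int n" for j
  proof -
    have "0 \<le> (- j) mod int n" "(- j) mod int n < int n" using n by auto
    then have "j + (- j) mod int n < int n * b" using that by linarith
    moreover have "int n * ((j + (- j) mod int n) div int n) \<le> j + (- j) mod int n"
      using mult_div_mod_eq[of "int n" "j + (- j) mod int n"]
        pos_mod_sign[of "int n" "j + (- j) mod int n"] n by linarith
    ultimately have "int n * ((j + (- j) mod int n) div int n) < int n * b" by linarith
    then have "(j + (- j) mod int n) div int n < b" using n by simp
    then show ?thesis unfolding c_def using n by (intro b) (auto simp: nat_less_iff)
  qed
  then have c: "fls_nth (Abs_fls c) j = c j" for j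
    by (intro nth_Abs_fls_lower_bound) blast
  have "section_coord n r (Abs_fls c) = v r" if r: "r < n" for r
  proof (rule fls_eqI)
    fix k
    have "- (int n * k - int r) = int r + int n * (- k)" by (simp add: algebra_simps)
    then have "(- (int n * k - int r)) mod int n = int r"
      using r by (simp only: mod_mult_self2) simp
    then show "fls_nth (section_coord n r (Abs_fls c)) k = fls_nth (v r) k"
      using n by (simp add: section_coord_nth c c_def)
  qed
  then show ?thesis by blast
qed

lemma mult_mat_col:
  assumes "r < n" "s < n"
  shows "mult_mat n h $$ (r, s) = section_coord n r (h * Z ^ s)"
  using assms by (simp add: mult_mat_def fls_X_inv_power_times_conv_shift mult.commute[of h])

lemma mult_mat_mult: "mult_mat n (f * g) = mult_mat n f * mult_mat n g"
proof (rule eq_matI)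
  fix r s assume rs: "r < dim_row (mult_mat n f * mult_mat n g)" "s < dim_col (mult_mat n f * mult_mat n g)"
  then have "mult_mat n (f * g) $$ (r, s) = section_coord n r (f * (g * Z ^ s))"
    by (simp add: mult_mat_col mult.assoc)
  also have "\<dots> = (\<Sum>i<n. mult_mat n f $$ (r, i) * mult_mat n g $$ (i, s))"
    using rs by (simp add: section_coord_mult mult_mat_col)
  finally show "mult_mat n (f * g) $$ (r, s) = (mult_mat n f * mult_mat n g) $$ (r, s)"
    using rs by (simp add: scalar_prod_def lessThan_atLeast0)
qed auto

lemma mult_mat_add: "mult_mat n (f + g) = mult_mat n f + mult_mat n g"
  by (rule eq_matI) (auto intro!: fls_eqI simp: mult_mat_nth)

lemma mult_mat_diff: "mult_mat n (f - g) = mult_mat n f - mult_mat n g"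
  by (rule eq_matI) (auto intro!: fls_eqI simp: mult_mat_nth)

lemma mult_mat_map: "h 0 = 0 \<Longrightarrow> mult_mat n (fls_map h f) = map_mat (fls_map h) (mult_mat n f)"
  by (rule eq_matI) (auto intro!: fls_eqI simp: mult_mat_nth fls_map_nth)

lemma int_mult_eq_diff:
  assumes "n > 0" "r < n" "s < n"
  shows "int n * k = int r - int s \<longleftrightarrow> k = 0 \<and> r = s"
proof
  assume eq: "int n * k = int r - int s"
  moreover have "\<bar>int r - int s\<bar> < int n" using assms by auto
  ultimately have "k = 0" using assms
    by (metis abs_mult abs_of_nat dvd_triv_left zdvd_not_zless abs_dvd_iff dvd_abs_iff
        mult_eq_0_iff of_nat_0_less_iff abs_0_eq less_irrefl zero_less_abs_iff)
  then show "k = 0 \<and> r = s" using eq by simp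
qed simp

lemma mult_mat_1: "mult_mat n (1 :: 'a::comm_ring_1 fls) = 1\<^sub>m n"
proof (rule eq_matI)
  fix r s assume rs: "r < dim_row (1\<^sub>m n :: 'a fls mat)" "s < dim_col (1\<^sub>m n :: 'a fls mat)"
  show "mult_mat n 1 $$ (r, s) = (1\<^sub>m n :: 'a fls mat) $$ (r, s)"
  proof (rule fls_eqI)
    fix k
    have "(int n * k - int r + int s = 0) = (k = 0 \<and> r = s)"
      using int_mult_eq_diff[of n r s k] rs by auto
    then show "fls_nth (mult_mat n 1 $$ (r, s)) k = fls_nth ((1\<^sub>m n :: 'a fls mat) $$ (r, s)) k"
      using rs by (auto simp: mult_mat_nth)
  qed
qed auto

lemma mult_mat_power: "mult_mat n (f ^ k) = mult_mat n f ^\<^sub>m k"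
  by (induction k) (simp_all add: mult_mat_1 mult_mat_mult power_Suc2 del: power_Suc)

lemma mult_mat_inject: "n > 0 \<Longrightarrow> mult_mat n f = mult_mat n g \<Longrightarrow> f = g"
  using section_coord_inject[of n f g] mult_mat_col[of _ n 0] by (metis mult.right_neutral power_0)

lemma mult_mat_Z_power_n: "mult_mat n (Z ^ n) = Z \<cdot>\<^sub>m (1\<^sub>m n :: 'a::comm_ring_1 fls mat)"
proof (rule eq_matI)
  fix r s assume "r < dim_row (Z \<cdot>\<^sub>m (1\<^sub>m n :: 'a fls mat))" "s < dim_col (Z \<cdot>\<^sub>m (1\<^sub>m n :: 'a fls mat))"
  then show "mult_mat n (Z ^ n) $$ (r, s) = (Z \<cdot>\<^sub>m (1\<^sub>m n :: 'a fls mat)) $$ (r, s)"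
    using arg_cong[OF mult_mat_1[of n], of "\<lambda>A :: 'a fls mat. A $$ (r, s)"]
    by (simp add: mult_mat_col section_coord_Z_power_mult)
qed auto

text \<open>\<open>z\<close> sends each basis element \<open>z^s\<close> to the next one, which
  gives \<open>b_mat\<close>, and sends the last one to \<open>z^n = lambda\<close> times
  \<open>1\<close>, which gives the corner entry.\<close>

lemma mult_mat_Z:
  fixes n :: nat
  assumes n: "n \<ge> 2"
  shows "mult_mat n (Z :: 'a::comm_ring_1 fls) = Z \<cdot>\<^sub>m elem_mat n 0 (n - 1) + b_mat n"
proof (rule eq_matI)
  fix r s
  assume "r < dim_row (Z \<cdot>\<^sub>m elem_mat n 0 (n - 1) + b_mat n :: 'a fls mat)"
    "s < dim_col (Z \<cdot>\<^sub>m elem_mat n 0 (n - 1) + b_mat n :: 'a fls mat)"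
  then have rs: "r < n" "s < n" by (simp_all add: b_mat_def)
  show "mult_mat n (Z :: 'a fls) $$ (r, s) = (Z \<cdot>\<^sub>m elem_mat n 0 (n - 1) + b_mat n) $$ (r, s)"
  proof (rule fls_eqI)
    fix k
    have "int n * k - int r + int s = - 1 \<longleftrightarrow> (k = 0 \<and> r = Suc s) \<or> (k = - 1 \<and> r = 0 \<and> s = n - 1)"
    proof
      assume eq: "int n * k - int r + int s = - 1"
      show "(k = 0 \<and> r = Suc s) \<or> (k = - 1 \<and> r = 0 \<and> s = n - 1)"
      proof (cases "s = n - 1")
        case True
        then have "int n * (k + 1) = int r - int 0" using eq n by (simp add: algebra_simps of_nat_diff)
        then show ?thesis using int_mult_eq_diff[of n r 0 "k + 1"] rs n True by auto
      next
        case False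
        then have "int n * k = int r - int (Suc s)" "Suc s < n" using eq rs by auto
        then show ?thesis using int_mult_eq_diff[of n r "Suc s" k] rs by auto
      qed
    qed (use n in auto)
    then show "fls_nth (mult_mat n (Z :: 'a fls) $$ (r, s)) k =
        fls_nth ((Z \<cdot>\<^sub>m elem_mat n 0 (n - 1) + b_mat n) $$ (r, s)) k"
      using rs n by (auto simp: mult_mat_nth elem_mat_def b_mat_def)
  qed
qed (auto simp: b_mat_def)

text \<open>On the diagonal the two shifts by the row and the column cancel, so all \<open>n\<close>
  entries agree. The trace sees only the powers of \<open>z\<close> divisible by
  \<open>n\<close>.\<close>

lemma trace_mult_mat_nth: "fls_nth (trace_mat (mult_mat n h)) k = of_nat n * fls_nth h (int n * k)"
  by (simp add: trace_mat_def fls_nth_sum mult_mat_nth)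

section \<open>The Riccati equation\<close>

lemma deg_le_multD:
  assumes "deg_le a f" "deg_le b g" "deg_le (a + b - 1) (f * g)"
  shows "fls_nth f (- a) * fls_nth g (- b) = 0"
  using deg_le_mult_nth[OF assms(1,2)] deg_leD[OF assms(3), of "- (a + b)"] by simp

lemma deg_le_of_nat [simp]: "deg_le 0 (of_nat k)"
  by (simp add: deg_le_def fls_of_nat_nth)

lemma deg_le_uminus [simp]: "deg_le m (- f) = deg_le m f"
  by (simp add: deg_le_def)

lemma deg_le_1 [simp]: "deg_le 0 1"
  by (simp add: deg_le_def)

lemma deg_le_Z [simp]: "deg_le 1 Z"
  by (simp add: deg_le_def)

text \<open>The leading coefficient of the linearized Riccati equation is \<open>n\<close>, and
  trace normalizations divide by \<open>n\<close>; this is the reason for requiring positive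
  integers to be units.\<close>

locale diff_ring = derivation d for d :: "'a::comm_ring_1 \<Rightarrow> 'a" +
  assumes nat_unit: "k > 0 \<Longrightarrow> \<exists>y. of_nat k * y = (1 :: 'a)"
begin

interpretation D: derivation "fls_map d"
  by (rule fls_map)

lemma of_nat_mult_eq_0: "k > 0 \<Longrightarrow> of_nat k * x = 0 \<Longrightarrow> x = (0 :: 'a)"
  using nat_unit[of k] by (metis mult.assoc mult.commute mult_1 mult_zero_left)

lemma map_Z_power: "fls_map d (Z ^ k) = 0"
  by (rule fls_eqI) (simp add: fls_map_nth)

lemma deg_le_map_d: "deg_le m f \<Longrightarrow> deg_le m (fls_map d f)"
  by (rule deg_le_map) simp

text \<open>If \<open>g\<close> had exact degree \<open>m\<close>, then \<open>f * g\<close> would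
  have the coefficient \<open>n\<close> times the leading one of \<open>g\<close> in degree
  \<open>c + m\<close>. The ring has zero divisors, so it matters that the leading coefficient of
  \<open>f\<close> is the unit \<open>n\<close>.\<close>

lemma eq_0_if_mult_lowers_degree:
  assumes f: "deg_le c f" "fls_nth f (- c) = of_nat n" "n > 0"
    and g: "deg_le M g" "\<And>m. m \<le> M \<Longrightarrow> deg_le m g \<Longrightarrow> deg_le (c + m - 1) (f * g)"
  shows "g = (0 :: 'a fls)"
proof (rule ccontr)
  assume "g \<noteq> 0"
  define m where "m = - fls_subdegree g"
  have "- M \<le> fls_subdegree g"
    using \<open>g \<noteq> 0\<close> g(1) by (intro fls_subdegree_geI) (auto simp: deg_leD)
  then have "deg_le m g" "m \<le> M" by (auto simp: m_def deg_le_fls_subdegree)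
  from deg_le_multD[OF f(1) this(1) g(2)[OF this(2,1)]]
  have "of_nat n * fls_nth g (- m) = 0" using f by simp
  then have "fls_nth g (fls_subdegree g) = 0" using of_nat_mult_eq_0[OF f(3)] by (simp add: m_def)
  then show False using \<open>g \<noteq> 0\<close> by simp
qed

text \<open>This is \<open>(d + h)^k\<close> applied to \<open>w\<close>.\<close>

primrec nabla :: "'a fls \<Rightarrow> 'a fls \<Rightarrow> nat \<Rightarrow> 'a fls" where
  "nabla h w 0 = w"
| "nabla h w (Suc k) = fls_map d (nabla h w k) + h * nabla h w k"

text \<open>With \<open>w = 1\<close> its vanishing is the Riccati equation for \<open>h\<close>. A
  general \<open>w\<close> is kept because \<open>dressed_Z_unique\<close> needs the solutions
  \<open>w\<close> for a fixed \<open>h\<close>.\<close>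

definition riccati :: "nat \<Rightarrow> (nat \<Rightarrow> 'a) \<Rightarrow> 'a fls \<Rightarrow> 'a fls \<Rightarrow> 'a fls" where
  "riccati n u h w = nabla h w n - (\<Sum>i<n - 1. fls_const (u i) * nabla h w i) - Z ^ n * w"

lemma nabla_minus_power:
  assumes h: "deg_le 0 (h - Z)"
  shows "deg_le (int k - 1) (nabla h 1 k - Z ^ k)"
proof (induction k)
  case (Suc k)
  have P: "deg_le (int k) (nabla h 1 k)"
    using deg_le_add[OF deg_le_mono[OF Suc, of "int k"] deg_le_Z_power] by simp
  have "nabla h 1 (Suc k) - Z ^ Suc k
      = fls_map d (nabla h 1 k) + (h - Z) * nabla h 1 k + Z * (nabla h 1 k - Z ^ k)"
    by (simp add: algebra_simps)
  moreover have "deg_le (int k) (fls_map d (nabla h 1 k))" by (rule deg_le_map_d[OF P])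
  moreover have "deg_le (int k) ((h - Z) * nabla h 1 k)" by (rule deg_le_mult[OF h P]) simp
  moreover have "deg_le (int k) (Z * (nabla h 1 k - Z ^ k))" by (rule deg_le_mult[OF deg_le_Z Suc]) simp
  ultimately have "deg_le (int k) (nabla h 1 (Suc k) - Z ^ Suc k)" by (simp only: deg_le_add)
  then show ?case by simp
qed simp

lemma nabla_deg_le: "deg_le 0 (h - Z) \<Longrightarrow> deg_le (int k) (nabla h 1 k)"
  using deg_le_add[OF deg_le_mono[OF nabla_minus_power, of h k "int k"] deg_le_Z_power[of k]] by simp

text \<open>The derivative of \<open>z^k\<close> in \<open>z\<close>: the leading part of the
  linearization of \<open>h \<mapsto> (d + h)^k 1\<close>. For \<open>k = 0\<close> the factor
  \<open>of_nat 0\<close> makes it vanish.\<close>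

definition dpow :: "nat \<Rightarrow> 'a fls" where
  "dpow k = of_nat k * Z ^ (k - 1)"

lemma dpow_deg_le: "deg_le (int k - 1) (dpow k)"
proof (cases k)
  case (Suc m)
  have "deg_le (int m) (of_nat k * Z ^ m)" by (rule deg_le_mult[OF deg_le_of_nat deg_le_Z_power]) simp
  then show ?thesis by (simp add: Suc dpow_def)
qed (simp add: dpow_def)

lemma dpow_nth: "fls_nth (dpow k) (- (int k - 1)) = of_nat k"
  by (cases k) (simp_all add: dpow_def fls_X_inv_power_times_conv_shift fls_of_nat_nth mult.commute[of "of_nat _"])

lemma map_dpow: "fls_map d (dpow k) = 0"
  by (simp add: dpow_def D.mult map_Z_power)

lemma Z_dpow: "Z * dpow k = of_nat k * Z ^ k"
  by (cases k) (simp_all add: dpow_def algebra_simps)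

text \<open>To leading order, changing \<open>h\<close> by \<open>a\<close> changes
  \<open>(d + h)^k 1\<close> by \<open>dpow k * a\<close>; derivatives of \<open>a\<close> and the
  lower terms of \<open>h\<close> cost at least one degree. The terms quadratic in \<open>a\<close>
  are small enough because \<open>m \<ge> 0\<close>.\<close>

lemma nabla_perturb:
  assumes h: "deg_le 0 (h - Z)" and a: "deg_le (- m) a" and m: "m \<ge> 0"
  shows "deg_le (int k - 2 - m) (nabla (h + a) 1 k - nabla h 1 k - dpow k * a)"
proof (induction k)
  case 0
  then show ?case by (simp add: dpow_def)
next
  case (Suc k)
  define P where "P = nabla h 1 k"
  define e where "e = nabla (h + a) 1 k - P - dpow k * a"
  have e: "deg_le (int k - 2 - m) e" using Suc by (simp add: e_def P_def)
  have P': "nabla (h + a) 1 k = P + dpow k * a + e" by (simp add: e_def)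
  have dP: "dpow (Suc k) = Z * dpow k + Z ^ k" unfolding Z_dpow by (simp add: dpow_def algebra_simps)
  have "nabla (h + a) 1 (Suc k) - nabla h 1 (Suc k) - dpow (Suc k) * a
     = dpow k * fls_map d a + fls_map d e + (h - Z) * (dpow k * a) + (h - Z) * e + Z * e
       + a * (P - Z ^ k) + a * (a * dpow k) + a * e"
    unfolding nabla.simps P' dP P_def[symmetric]
    by (simp add: D.add D.mult map_dpow algebra_simps)
  moreover have "deg_le (int k - 1 - m) (dpow k * fls_map d a)"
    by (rule deg_le_mult[OF dpow_deg_le deg_le_map_d[OF a]]) simp
  moreover have "deg_le (int k - 1 - m) (fls_map d e)"
    by (rule deg_le_mono[OF deg_le_map_d[OF e]]) simp
  moreover have "deg_le (int k - 1 - m) ((h - Z) * (dpow k * a))"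
    by (rule deg_le_mult[OF h deg_le_mult[OF dpow_deg_le a order_refl]]) simp
  moreover have "deg_le (int k - 1 - m) ((h - Z) * e)" by (rule deg_le_mult[OF h e]) simp
  moreover have "deg_le (int k - 1 - m) (Z * e)" by (rule deg_le_mult[OF deg_le_Z e]) simp
  moreover have "deg_le (int k - 1 - m) (a * (P - Z ^ k))"
    unfolding P_def by (rule deg_le_mult[OF a nabla_minus_power[OF h]]) simp
  moreover have "deg_le (int k - 1 - m) (a * (a * dpow k))"
    by (rule deg_le_mult[OF a deg_le_mult[OF a dpow_deg_le order_refl]]) (use m in simp)
  moreover have "deg_le (int k - 1 - m) (a * e)" by (rule deg_le_mult[OF a e]) (use m in simp)
  ultimately show ?case by (simp add: deg_le_add)
qed

text \<open>Leibniz' rule to first order: moving \<open>w\<close> out of \<open>(d + h)^k\<close>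
  leaves \<open>dpow k\<close> times \<open>w'\<close> plus terms of lower degree. The error is
  measured by the degree of \<open>w'\<close> alone, as every correction contains a derivative of
  \<open>w\<close>.\<close>

lemma nabla_twist:
  assumes h: "deg_le 0 (h - Z)" and w: "deg_le m (fls_map d w)"
  shows "deg_le (m + int k - 2) (nabla h w k - w * nabla h 1 k - dpow k * fls_map d w)"
proof (induction k)
  case 0
  then show ?case by (simp add: dpow_def)
next
  case (Suc k)
  define P where "P = nabla h 1 k"
  define w' where "w' = fls_map d w"
  define e where "e = nabla h w k - w * P - dpow k * w'"
  have e: "deg_le (m + int k - 2) e" using Suc by (simp add: e_def P_def w'_def)
  have w': "deg_le m w'" using w by (simp add: w'_def)
  have P': "nabla h w k = w * P + dpow k * w' + e" by (simp add: e_def)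
  have dP: "dpow (Suc k) = Z * dpow k + Z ^ k" unfolding Z_dpow by (simp add: dpow_def algebra_simps)
  have "nabla h w (Suc k) - w * nabla h 1 (Suc k) - dpow (Suc k) * w'
     = w' * (P - Z ^ k) + dpow k * fls_map d w' + fls_map d e + (h - Z) * (dpow k * w') + (h - Z) * e + Z * e"
    unfolding nabla.simps P' dP P_def[symmetric]
    by (simp add: D.add D.mult map_dpow algebra_simps w'_def[symmetric])
  moreover have "deg_le (m + int k - 1) (w' * (P - Z ^ k))"
    unfolding P_def by (rule deg_le_mult[OF w' nabla_minus_power[OF h]]) simp
  moreover have "deg_le (m + int k - 1) (dpow k * fls_map d w')"
    by (rule deg_le_mult[OF dpow_deg_le deg_le_map_d[OF w']]) simp
  moreover have "deg_le (m + int k - 1) (fls_map d e)"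
    by (rule deg_le_mono[OF deg_le_map_d[OF e]]) simp
  moreover have "deg_le (m + int k - 1) ((h - Z) * (dpow k * w'))"
    by (rule deg_le_mult[OF h deg_le_mult[OF dpow_deg_le w' order_refl]]) simp
  moreover have "deg_le (m + int k - 1) ((h - Z) * e)" by (rule deg_le_mult[OF h e]) simp
  moreover have "deg_le (m + int k - 1) (Z * e)" by (rule deg_le_mult[OF deg_le_Z e]) simp
  ultimately show ?case by (simp add: deg_le_add w'_def)
qed

text \<open>The potentials multiply at most the power \<open>n - 2\<close> of \<open>d + h\<close>,
  so the top power alone contributes the leading term.\<close>

lemma riccati_perturb:
  assumes h: "deg_le 0 (h - Z)" and a: "deg_le (- m) a" and m: "m \<ge> 0"
  shows "deg_le (int n - 2 - m) (riccati n u (h + a) 1 - riccati n u h 1 - dpow n * a)"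
proof -
  have eq: "riccati n u (h + a) 1 - riccati n u h 1 - dpow n * a
    = (nabla (h + a) 1 n - nabla h 1 n - dpow n * a)
      - (\<Sum>i<n - 1. fls_const (u i) * (nabla (h + a) 1 i - nabla h 1 i))"
    by (simp add: riccati_def right_diff_distrib sum_subtractf)
  have "deg_le (int n - 2 - m) (fls_const (u i) * (nabla (h + a) 1 i - nabla h 1 i))"
    if i: "i \<in> {..<n - 1}" for i
  proof (rule deg_le_mult[OF deg_le_const])
    have "deg_le (int i - 1 - m) (dpow i * a)" by (rule deg_le_mult[OF dpow_deg_le a]) simp
    then have "deg_le (int i - 1 - m) ((nabla (h + a) 1 i - nabla h 1 i - dpow i * a) + dpow i * a)"
      by (intro deg_le_add deg_le_mono[OF nabla_perturb[OF h a m]]) auto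
    then show "deg_le (int i - 1 - m) (nabla (h + a) 1 i - nabla h 1 i)" by simp
    show "0 + (int i - 1 - m) \<le> int n - 2 - m" using i by auto
  qed
  then show ?thesis
    unfolding eq by (intro deg_le_diff deg_le_sum nabla_perturb[OF h a m])
qed

text \<open>For the difference \<open>a\<close> of two solutions, \<open>riccati_perturb\<close>
  says that \<open>dpow n * a\<close> has a degree smaller than its leading coefficient would
  allow.\<close>

lemma riccati_unique:
  assumes n: "n > 0" and h: "deg_le 0 (h - Z)" "riccati n u h 1 = 0"
    and h': "deg_le 0 (h' - Z)" "riccati n u h' 1 = 0"
  shows "h' = h"
proof -
  define a where "a = h' - h"
  have ha: "h' = h + a" by (simp add: a_def)
  have "a = 0"
  proof (rule eq_0_if_mult_lowers_degree[OF dpow_deg_le dpow_nth n])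
    show "deg_le 0 a" using deg_le_diff[OF h'(1) h(1)] by (simp add: a_def)
    fix m :: int assume "m \<le> 0" "deg_le m a"
    then have "deg_le (int n - 2 + m) (riccati n u (h + a) 1 - riccati n u h 1 - dpow n * a)"
      using riccati_perturb[OF h(1), of "- m" a n u] by simp
    then have "deg_le (int n - 2 + m) (0 - (0 - dpow n * a))"
      using h h' ha by (intro deg_le_diff) auto
    then show "deg_le (int n - 1 + m - 1) (dpow n * a)" by (simp add: algebra_simps)
  qed
  then show ?thesis using ha by simp
qed

text \<open>Successive approximation from \<open>Z\<close>: step \<open>N\<close> removes one
  further coefficient of the residual, by a correction of degree \<open>- N\<close> that leaves the
  earlier ones untouched.\<close>

lemma riccati_exists:
  assumes n: "n > 0"
  shows "\<exists>h. deg_le 0 (h - Z) \<and> riccati n u h 1 = 0"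
proof -
  obtain iv :: 'a where iv: "of_nat n * iv = 1" using nat_unit[OF n] by blast
  \<comment> \<open>The coefficient of \<open>z^(n-1-N)\<close> in the residual is divided by
    \<open>n\<close>, the leading coefficient of \<open>dpow n\<close>, and attached with opposite
    sign to \<open>z^-N\<close>.\<close>
  define corr where "corr N h = - fls_const (iv * fls_nth (riccati n u h 1) (- (int n - 1 - int N))) * fls_X ^ N"
    for N h
  define hs where "hs = rec_nat Z (\<lambda>N h. h + corr N h)"
  have hs: "hs 0 = Z" "hs (Suc N) = hs N + corr N (hs N)" for N by (simp_all add: hs_def)
  have X: "deg_le (- int N) (fls_X ^ N :: 'a fls)" for N by (simp add: deg_le_def)
  have corr: "deg_le (- int N) (corr N h)" for N h
    unfolding corr_def
    by (rule deg_le_mult[OF _ X, of 0]) (simp_all add: deg_le_def)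
  have corr_nth: "fls_nth (corr N h) (int N) = - (iv * fls_nth (riccati n u h 1) (- (int n - 1 - int N)))" for N h
    using deg_le_mult_nth[OF deg_le_const X, of "- (iv * fls_nth (riccati n u h 1) (- (int n - 1 - int N)))" N]
    by (simp add: corr_def)
  have mono: "fls_nth (hs (N + M)) k = fls_nth (hs N) k" if "k < int N" for N M k
    using that by (induction M) (auto simp: hs deg_leD[OF corr])
  have hs_Z: "deg_le 0 (hs N - Z)" for N
    unfolding deg_le_def using mono[of _ 0 N] by (auto simp: hs)
  have ric: "deg_le (int n - 1 - int N) (riccati n u (hs N) 1)" for N
  proof (induction N)
    case 0
    have "nabla Z 1 k = Z ^ k" for k by (induction k) (simp_all add: map_Z_power)
    then have "riccati n u (hs 0) 1 = - (\<Sum>i<n - 1. fls_const (u i) * Z ^ i)"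
      by (simp add: riccati_def hs)
    moreover have "deg_le (int n - 1) (fls_const (u i) * Z ^ i)" if "i \<in> {..<n - 1}" for i
      by (rule deg_le_mult[OF deg_le_const deg_le_Z_power]) (use that in auto)
    ultimately show ?case
      using deg_le_sum[of "{..<n - 1}" "int n - 1" "\<lambda>i. fls_const (u i) * Z ^ i"] by simp
  next
    case (Suc N)
    define c where "c = corr N (hs N)"
    have c: "deg_le (- int N) c" unfolding c_def by (rule corr)
    define e where "e = riccati n u (hs N + c) 1 - riccati n u (hs N) 1 - dpow n * c"
    have e: "deg_le (int n - 2 - int N) e"
      unfolding e_def using riccati_perturb[OF hs_Z c] by simp
    have eq: "riccati n u (hs (Suc N)) 1 = riccati n u (hs N) 1 + dpow n * c + e"
      by (simp add: e_def hs c_def)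
    have dc: "deg_le (int n - 1 - int N) (dpow n * c)"
      by (rule deg_le_mult[OF dpow_deg_le c]) simp
    have "fls_nth (dpow n * c) (- (int n - 1 + - int N)) = of_nat n * fls_nth c (int N)"
      using deg_le_mult_nth[OF dpow_deg_le c] dpow_nth by simp
    also have "\<dots> = - fls_nth (riccati n u (hs N) 1) (- (int n - 1 - int N))"
      by (simp add: c_def corr_nth mult.assoc[symmetric] iv)
    finally have "fls_nth (riccati n u (hs (Suc N)) 1) (- (int n - 1 - int N)) = 0"
      using deg_leD[OF e, of "- (int n - 1 - int N)"] by (simp add: eq)
    moreover have "deg_le (int n - 1 - int N) (riccati n u (hs (Suc N)) 1)"
      unfolding eq by (intro deg_le_add Suc dc deg_le_mono[OF e]) simp
    ultimately show ?case using deg_le_decrease by (metis diff_diff_eq of_nat_Suc add.commute)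
  qed
  \<comment> \<open>By \<open>mono\<close> the coefficient at \<open>k\<close> no longer changes
    from stage \<open>k + 1\<close> on. For negative \<open>k\<close> the value \<open>nat k\<close>
    is \<open>0\<close>, and stage \<open>1\<close> is final.\<close>
  define h where "h = Abs_fls (\<lambda>k. fls_nth (hs (nat k + 1)) k)"
  have "\<forall>k< - 1. fls_nth (hs (nat k + 1)) k = 0"
  proof (intro allI impI)
    fix k :: int assume k: "k < - 1"
    then have "fls_nth (hs (0 + 1)) k = fls_nth (hs 0) k" by (intro mono) simp
    then show "fls_nth (hs (nat k + 1)) k = 0" using k by (simp add: hs)
  qed
  then have h_nth: "fls_nth h k = fls_nth (hs (nat k + 1)) k" for k
    unfolding h_def by (rule nth_Abs_fls_lower_bound)
  have h_hs: "deg_le (- int N) (h - hs N)" for N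
    unfolding deg_le_def
  proof (intro allI impI)
    fix k assume k: "k < - (- int N)"
    have "fls_nth (hs (nat k + 1 + N)) k = fls_nth (hs (nat k + 1)) k" by (rule mono) simp
    moreover have "fls_nth (hs (N + (nat k + 1))) k = fls_nth (hs N) k" by (rule mono) (use k in simp)
    ultimately show "fls_nth (h - hs N) k = 0" by (simp add: h_nth add.commute add.left_commute)
  qed
  have "deg_le (int n - 1 - int N) (riccati n u h 1)" for N
  proof -
    define a where "a = h - hs N"
    have a: "deg_le (- int N) a" unfolding a_def by (rule h_hs)
    have "deg_le (int n - 2 - int N) (riccati n u (hs N + a) 1 - riccati n u (hs N) 1 - dpow n * a)"
      using riccati_perturb[OF hs_Z a] by simp
    moreover have "deg_le (int n - 1 - int N) (dpow n * a)"
      by (rule deg_le_mult[OF dpow_deg_le a]) simp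
    ultimately have "deg_le (int n - 1 - int N)
      ((riccati n u (hs N + a) 1 - riccati n u (hs N) 1 - dpow n * a) + dpow n * a + riccati n u (hs N) 1)"
      by (intro deg_le_add ric) (auto intro: deg_le_mono)
    then show ?thesis by (simp add: a_def)
  qed
  then have "riccati n u h 1 = 0" by (rule eq_0_if_deg_le_all)
  moreover have "deg_le 0 (h - Z)" using h_hs[of 0] by (simp add: hs)
  ultimately show ?thesis by blast
qed

text \<open>Subtracting \<open>w\<close> times the equation for \<open>1\<close> leaves
  \<open>dpow n * w'\<close> plus terms of lower degree, which forces \<open>w' = 0\<close>.\<close>

lemma riccati_solution_constant:
  assumes n: "n > 0" and h: "deg_le 0 (h - Z)" "riccati n u h 1 = 0" and w: "riccati n u h w = 0"
  shows "fls_map d w = 0"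
proof (rule eq_0_if_mult_lowers_degree[OF dpow_deg_le dpow_nth n])
  show "deg_le (- fls_subdegree (fls_map d w)) (fls_map d w)" by (rule deg_le_fls_subdegree)
  fix m :: int assume m: "deg_le m (fls_map d w)"
  let ?w' = "fls_map d w"
  have eq: "riccati n u h w - w * riccati n u h 1 - dpow n * ?w'
    = (nabla h w n - w * nabla h 1 n - dpow n * ?w')
      - (\<Sum>i<n - 1. fls_const (u i) * (nabla h w i - w * nabla h 1 i))"
    by (simp add: riccati_def algebra_simps sum_subtractf sum_distrib_left)
  have "deg_le (m + int n - 2) (fls_const (u i) * (nabla h w i - w * nabla h 1 i))"
    if i: "i \<in> {..<n - 1}" for i
  proof (rule deg_le_mult[OF deg_le_const])
    have "deg_le (m + int i - 1) (dpow i * ?w')" by (rule deg_le_mult[OF dpow_deg_le m]) simp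
    then have "deg_le (m + int i - 1) ((nabla h w i - w * nabla h 1 i - dpow i * ?w') + dpow i * ?w')"
      by (intro deg_le_add deg_le_mono[OF nabla_twist[OF h(1) m]]) auto
    then show "deg_le (m + int i - 1) (nabla h w i - w * nabla h 1 i)" by simp
    show "0 + (m + int i - 1) \<le> m + int n - 2" using i by auto
  qed
  then have "deg_le (m + int n - 2) (riccati n u h w - w * riccati n u h 1 - dpow n * ?w')"
    unfolding eq by (intro deg_le_diff deg_le_sum nabla_twist[OF h(1) m])
  then have "deg_le (m + int n - 2) (0 - (0 - dpow n * ?w'))"
    using h w by (intro deg_le_diff) auto
  then show "deg_le (int n - 1 + m - 1) (dpow n * ?w')" by (simp add: add.commute)
qed

lemma nabla_constant: "fls_map d w = 0 \<Longrightarrow> nabla h w k = w * nabla h 1 k"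
  by (induction k) (simp_all add: D.mult algebra_simps)

text \<open>\<open>w^n - z^n\<close> factors as \<open>(w - z) * s\<close>, and \<open>s\<close> has
  the leading term \<open>n z^(n-1)\<close>, so it cannot annihilate a nonzero series.\<close>

lemma root_unique:
  assumes n: "n > 0" and w: "deg_le 0 (w - Z)" "w ^ n = (Z :: 'a fls) ^ n"
  shows "w = Z"
proof -
  have pow: "deg_le (int k - 1) (w ^ k - Z ^ k)" for k
  proof (induction k)
    case (Suc k)
    have wk: "deg_le (int k) (w ^ k)"
      using deg_le_add[OF deg_le_mono[OF Suc, of "int k"] deg_le_Z_power[of k]] by simp
    have "w ^ Suc k - Z ^ Suc k = (w - Z) * w ^ k + Z * (w ^ k - Z ^ k)"
      by (simp add: algebra_simps)
    moreover have "deg_le (int k) ((w - Z) * w ^ k)" by (rule deg_le_mult[OF w(1) wk]) simp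
    moreover have "deg_le (int k) (Z * (w ^ k - Z ^ k))" by (rule deg_le_mult[OF deg_le_Z Suc]) simp
    ultimately show ?case by (simp add: deg_le_add)
  qed simp
  define s where "s = (\<Sum>i<n. Z ^ (n - Suc i) * w ^ i)"
  define e where "e = (\<Sum>i<n. Z ^ (n - Suc i) * (w ^ i - Z ^ i))"
  have "(\<Sum>i<n. Z ^ (n - Suc i) * Z ^ i) = (dpow n :: 'a fls)"
  proof -
    have "Z ^ (n - Suc i) * Z ^ i = (Z ^ (n - 1) :: 'a fls)" if "i \<in> {..<n}" for i
    proof -
      have "n - Suc i + i = n - 1" using that by auto
      then show ?thesis by (metis power_add)
    qed
    then show ?thesis by (simp add: dpow_def)
  qed
  then have s: "s = dpow n + e"
    by (simp add: s_def e_def right_diff_distrib sum_subtractf)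
  have e: "deg_le (int n - 2) e"
    unfolding e_def
  proof (rule deg_le_sum)
    fix i assume "i \<in> {..<n}"
    then show "deg_le (int n - 2) (Z ^ (n - Suc i) * (w ^ i - Z ^ i))"
      by (intro deg_le_mult[OF deg_le_Z_power pow]) auto
  qed
  have "w - Z = 0"
  proof (rule eq_0_if_mult_lowers_degree[of "int n - 1" s])
    show "deg_le (int n - 1) s"
      unfolding s by (intro deg_le_add dpow_deg_le deg_le_mono[OF e]) simp
    show "fls_nth s (- (int n - 1)) = of_nat n"
      unfolding s using dpow_nth[of n] deg_leD[OF e, of "- (int n - 1)"] by simp
    have "s * (w - Z) = 0"
      using power_diff_sumr2[of w n Z] w(2) by (simp add: s_def mult.commute)
    then show "deg_le (int n - 1 + m - 1) (s * (w - Z))" for m by simp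
  qed (use n w in auto)
  then show ?thesis by simp
qed

section \<open>The dressing matrix\<close>

definition V_shape :: "nat \<Rightarrow> 'a mat \<Rightarrow> bool" where
  "V_shape n U \<longleftrightarrow> U \<in> carrier_mat n n \<and> (\<forall>k<n. \<forall>l<n. \<not> (k < n - 1 \<and> l = n - 1) \<longrightarrow> U $$ (k, l) = 0)"

definition JU :: "nat \<Rightarrow> 'a mat \<Rightarrow> 'a fls mat" where
  "JU n U = mult_mat n Z + map_mat fls_const U"

text \<open>For \<open>w = 1\<close> this is the dressing matrix \<open>T\<close>: its columns are
  the coordinates of \<open>(d + h)^s 1\<close>, beginning with \<open>e_1\<close>.\<close>

definition cols :: "nat \<Rightarrow> 'a fls \<Rightarrow> 'a fls \<Rightarrow> 'a fls mat" where
  "cols n h w = mat n n (\<lambda>(r, s). section_coord n r (nabla h w s))"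

lemma JU_carrier [simp]: "V_shape n U \<Longrightarrow> JU n U \<in> carrier_mat n n"
  by (simp add: JU_def V_shape_def)

lemma cols_carrier [simp]: "cols n h w \<in> carrier_mat n n"
  by (simp add: cols_def)

text \<open>\<open>J + U\<close> is a companion matrix: from the right it shifts columns to the left
  and combines columns \<open>0\<close> to \<open>n - 2\<close> into a new last one.\<close>

lemma mult_JU:
  assumes n: "n \<ge> 2" and U: "V_shape n U" and X: "X \<in> carrier_mat n n" and rs: "r < n" "s < n"
  shows "(X * JU n U) $$ (r, s) = (if s < n - 1 then X $$ (r, Suc s) else
    Z * X $$ (r, 0) + (\<Sum>i<n - 1. fls_const (U $$ (i, n - 1)) * X $$ (r, i)))"
proof -
  have U': "U \<in> carrier_mat n n" using U by (simp add: V_shape_def)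
  have JU: "JU n U $$ (i, s) = (if i = 0 then if s = n - 1 then Z else 0 else 0) + (if i = Suc s then 1 else 0)
      + fls_const (U $$ (i, s))" if "i < n" for i
    unfolding JU_def mult_mat_Z[OF n] using that rs U' n by (auto simp: elem_mat_def b_mat_def)
  have "(X * JU n U) $$ (r, s) = (\<Sum>i<n. X $$ (r, i) * JU n U $$ (i, s))"
    using X rs JU_carrier[OF U] by (auto simp: scalar_prod_def lessThan_atLeast0 intro!: sum.cong)
  also have "\<dots> = (\<Sum>i<n. if i = 0 then if s = n - 1 then X $$ (r, i) * Z else 0 else 0)
      + (\<Sum>i<n. if i = Suc s then X $$ (r, i) else 0) + (\<Sum>i<n. X $$ (r, i) * fls_const (U $$ (i, s)))"
    unfolding sum.distrib[symmetric] by (intro sum.cong) (auto simp: JU algebra_simps)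
  also have "(\<Sum>i<n. if i = 0 then if s = n - 1 then X $$ (r, i) * Z else 0 else 0)
      = (if s = n - 1 then X $$ (r, 0) * Z else 0)"
    using n by (subst sum.delta) auto
  also have "(\<Sum>i<n. if i = Suc s then X $$ (r, i) else 0) = (if s < n - 1 then X $$ (r, Suc s) else 0)"
    using n rs by (subst sum.delta) auto
  also have "(\<Sum>i<n. X $$ (r, i) * fls_const (U $$ (i, s)))
      = (if s < n - 1 then 0 else \<Sum>i<n - 1. fls_const (U $$ (i, n - 1)) * X $$ (r, i))"
  proof (cases "s < n - 1")
    case True
    then show ?thesis using U rs by (auto simp: V_shape_def intro!: sum.neutral)
  next
    case False
    then have "s = n - 1" using rs by simp
    moreover have "U $$ (n - 1, n - 1) = 0" using U n by (simp add: V_shape_def)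
    moreover have "{..<n} = insert (n - 1) {..<n - 1}" using n by auto
    ultimately show ?thesis by (simp add: mult.commute)
  qed
  finally show ?thesis using rs by (auto simp: mult.commute)
qed

lemma mult_mat_cols:
  assumes "r < n" "s < n"
  shows "(mult_mat n f * cols n h w) $$ (r, s) = section_coord n r (f * nabla h w s)"
  using assms by (simp add: section_coord_mult cols_def scalar_prod_def lessThan_atLeast0)

text \<open>All columns but the last hold by the recursion of \<open>nabla\<close>; the last column
  is exactly the vanishing of \<open>riccati\<close>.\<close>

lemma cols_ode:
  assumes n: "n \<ge> 2" and U: "V_shape n U" and w: "riccati n (\<lambda>i. U $$ (i, n - 1)) h w = 0"
  shows "map_mat (fls_map d) (cols n h w) = cols n h w * JU n U - mult_mat n h * cols n h w"
proof (rule eq_matI)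
  fix r s
  assume "r < dim_row (cols n h w * JU n U - mult_mat n h * cols n h w)"
    "s < dim_col (cols n h w * JU n U - mult_mat n h * cols n h w)"
  then have rs: "r < n" "s < n" using U by (simp_all add: cols_def)
  have n0: "n > 0" using n by simp
  have "(cols n h w * JU n U) $$ (r, s) = section_coord n r (nabla h w (Suc s))"
  proof (cases "s < n - 1")
    case True
    then show ?thesis using rs by (subst mult_JU[OF n U]) (auto simp: cols_def)
  next
    case False
    then have s: "Suc s = n" using rs by simp
    have "(cols n h w * JU n U) $$ (r, s) = section_coord n r (Z ^ n * w + (\<Sum>i<n - 1. fls_const (U $$ (i, n - 1)) * nabla h w i))"
      using rs False n0 by (subst mult_JU[OF n U])
        (auto simp: cols_def section_coord_add section_coord_sum section_coord_const section_coord_Z_power_mult)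
    also have "Z ^ n * w + (\<Sum>i<n - 1. fls_const (U $$ (i, n - 1)) * nabla h w i) = nabla h w (Suc s)"
      unfolding s using w by (simp add: riccati_def algebra_simps)
    finally show ?thesis .
  qed
  then show "map_mat (fls_map d) (cols n h w) $$ (r, s) = (cols n h w * JU n U - mult_mat n h * cols n h w) $$ (r, s)"
    using rs U n0 mult_mat_cols[OF rs, of h h w] JU_carrier[OF U]
    by (simp add: cols_def section_coord_add section_coord_map del: index_mult_mat(1))
qed (use U JU_carrier[OF U] in \<open>auto simp: cols_def\<close>)

text \<open>Converse of \<open>cols_ode\<close>: read column by column, the equation computes each
  column from the previous one, and the last column leaves the Riccati condition.\<close>

lemma ode_cols:
  assumes n: "n \<ge> 2" and U: "V_shape n U" and X: "X \<in> carrier_mat n n"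
    and ode: "map_mat (fls_map d) X = X * JU n U - mult_mat n h * X"
    and w: "\<And>r. r < n \<Longrightarrow> X $$ (r, 0) = section_coord n r w"
  shows "X = cols n h w" and "riccati n (\<lambda>i. U $$ (i, n - 1)) h w = 0"
proof -
  have n0: "n > 0" using n by simp
  have step: "(X * JU n U) $$ (r, s) = section_coord n r (nabla h w (Suc s))"
    if col: "\<And>r. r < n \<Longrightarrow> X $$ (r, s) = section_coord n r (nabla h w s)" and rs: "r < n" "s < n" for r s
  proof -
    have "(mult_mat n h * X) $$ (r, s) = (\<Sum>i<n. mult_mat n h $$ (r, i) * X $$ (i, s))"
      using X rs by (simp add: scalar_prod_def lessThan_atLeast0)
    also have "\<dots> = section_coord n r (h * nabla h w s)"
      using col rs by (simp add: section_coord_mult)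
    finally have "(mult_mat n h * X) $$ (r, s) = section_coord n r (h * nabla h w s)" .
    moreover have "map_mat (fls_map d) X $$ (r, s) = (X * JU n U) $$ (r, s) - (mult_mat n h * X) $$ (r, s)"
      unfolding ode using rs X by (simp del: index_mult_mat(1))
    moreover have "map_mat (fls_map d) X $$ (r, s) = fls_map d (section_coord n r (nabla h w s))"
      using col rs X by simp
    ultimately show ?thesis
      using n0 by (simp add: section_coord_add section_coord_map)
  qed
  have col: "s < n \<Longrightarrow> r < n \<Longrightarrow> X $$ (r, s) = section_coord n r (nabla h w s)" for r s
  proof (induction s arbitrary: r)
    case 0
    then show ?case using w by simp
  next
    case (Suc s)
    have "(X * JU n U) $$ (r, s) = section_coord n r (nabla h w (Suc s))"
      using Suc by (intro step) auto
    moreover have "(X * JU n U) $$ (r, s) = X $$ (r, Suc s)"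
      using Suc.prems by (subst mult_JU[OF n U X]) auto
    ultimately show ?case by simp
  qed
  show "X = cols n h w" by (rule eq_matI) (use X col in \<open>auto simp: cols_def\<close>)
  have "nabla h w n = Z ^ n * w + (\<Sum>i<n - 1. fls_const (U $$ (i, n - 1)) * nabla h w i)"
  proof (rule section_coord_inject[OF n0])
    fix r assume r: "r < n"
    have "section_coord n r (nabla h w n) = (X * JU n U) $$ (r, n - 1)"
      using step[of "n - 1" r] col r n0 by simp
    also have "\<dots> = Z * X $$ (r, 0) + (\<Sum>i<n - 1. fls_const (U $$ (i, n - 1)) * X $$ (r, i))"
      using r n0 by (subst mult_JU[OF n U X]) auto
    also have "\<dots> = section_coord n r (Z ^ n * w + (\<Sum>i<n - 1. fls_const (U $$ (i, n - 1)) * nabla h w i))"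
      using r n0 by (simp add: col section_coord_add section_coord_sum section_coord_const section_coord_Z_power_mult)
    finally show "section_coord n r (nabla h w n) = \<dots>" .
  qed
  then show "riccati n (\<lambda>i. U $$ (i, n - 1)) h w = 0"
    by (simp add: riccati_def)
qed

end

section \<open>Algebra of square matrices, and inversion of unipotent series\<close>

lemma sq_mult_closed [simp]:
  "A \<in> carrier_mat n n \<Longrightarrow> B \<in> carrier_mat n n \<Longrightarrow> A * B \<in> carrier_mat n n"
  by auto

declare minus_carrier_mat [simp]

lemma sq_mult_entry:
  fixes A B :: "'a::comm_ring_1 mat"
  assumes "A \<in> carrier_mat n n" "B \<in> carrier_mat n n" "r < n" "s < n"
  shows "(A * B) $$ (r, s) = (\<Sum>i<n. A $$ (r, i) * B $$ (i, s))"
  using assms by (simp add: scalar_prod_def lessThan_atLeast0)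

lemma sq_simps:
  fixes A B C :: "'a::comm_ring_1 mat"
  assumes "A \<in> carrier_mat n n" "B \<in> carrier_mat n n"
  shows "C \<in> carrier_mat n n \<Longrightarrow> (A * B) * C = A * (B * C)"
    and "C \<in> carrier_mat n n \<Longrightarrow> (A + B) * C = A * C + B * C"
    and "C \<in> carrier_mat n n \<Longrightarrow> C * (A + B) = C * A + C * B"
    and "C \<in> carrier_mat n n \<Longrightarrow> (A - B) * C = A * C - B * C"
    and "C \<in> carrier_mat n n \<Longrightarrow> C * (A - B) = C * A - C * B"
    and "(k \<cdot>\<^sub>m A) * B = k \<cdot>\<^sub>m (A * B)"
    and "A * (k \<cdot>\<^sub>m B) = k \<cdot>\<^sub>m (A * B)"
  using assms by (simp_all add: assoc_mult_mat[of _ n n _ n _ n] add_mult_distrib_mat[of _ n n]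
      mult_add_distrib_mat[of _ n n _ n] minus_mult_distrib_mat[of _ n n] mult_minus_distrib_mat[of _ n n _ n]
      mult_smult_assoc_mat[of _ n n] mult_smult_distrib[of _ n n])

lemma sq_units:
  fixes A :: "'a::comm_ring_1 mat"
  assumes "A \<in> carrier_mat n n"
  shows "1\<^sub>m n * A = A" "A * 1\<^sub>m n = A" "0\<^sub>m n n * A = 0\<^sub>m n n" "A * 0\<^sub>m n n = 0\<^sub>m n n"
    "0\<^sub>m n n + A = A" "A + 0\<^sub>m n n = A"
  using assms by auto

lemma trace_sq:
  fixes A B :: "'a::comm_ring_1 mat"
  assumes "A \<in> carrier_mat n n" "B \<in> carrier_mat n n"
  shows "trace_mat (A + B) = trace_mat A + trace_mat B" "trace_mat (A - B) = trace_mat A - trace_mat B"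
  using assms by (simp_all add: trace_mat_def sum.distrib sum_subtractf)

lemma trace_mult_commute:
  fixes A B :: "'a::comm_ring_1 mat"
  assumes "A \<in> carrier_mat n m" "B \<in> carrier_mat m n"
  shows "trace_mat (A * B) = trace_mat (B * A)"
proof -
  have "trace_mat (A * B) = (\<Sum>i<n. \<Sum>j<m. A $$ (i, j) * B $$ (j, i))"
    using assms by (simp add: trace_mat_def scalar_prod_def lessThan_atLeast0)
  also have "\<dots> = (\<Sum>j<m. \<Sum>i<n. B $$ (j, i) * A $$ (i, j))"
    by (subst sum.swap) (simp add: mult.commute)
  also have "\<dots> = trace_mat (B * A)"
    using assms by (simp add: trace_mat_def scalar_prod_def lessThan_atLeast0)
  finally show ?thesis .
qed

lemma comm_ring_hom_fps_to_fls: "comm_ring_hom (fps_to_fls :: 'a::comm_ring_1 fps \<Rightarrow> 'a fls)"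
proof
  show "fps_to_fls (x * y) = fps_to_fls x * fps_to_fls y" for x y :: "'a fps"
    by (simp add: fls_times_fps_to_fls)
qed (auto intro!: fls_eqI)

lemma comm_ring_hom_fps_nth_0: "comm_ring_hom (\<lambda>f :: 'a::comm_ring_1 fps. fps_nth f 0)"
  by standard auto

text \<open>\<open>T\<close> is a matrix of power series in \<open>lambda^-1\<close> with unipotent
  constant term, so its determinant has constant term \<open>1\<close> and is a unit. The adjugate
  divided by it is again a matrix of power series.\<close>

lemma ex_inverse_unipotent_series:
  fixes T :: "'a::comm_ring_1 fls mat"
  assumes T: "T \<in> carrier_mat n n"
    and deg: "\<And>r s. r < n \<Longrightarrow> s < n \<Longrightarrow> deg_le 0 (T $$ (r, s))"
    and diag: "\<And>r. r < n \<Longrightarrow> fls_nth (T $$ (r, r)) 0 = 1"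
    and upper: "\<And>r s. s < r \<Longrightarrow> r < n \<Longrightarrow> fls_nth (T $$ (r, s)) 0 = 0"
  obtains S where "S \<in> carrier_mat n n" "S * T = 1\<^sub>m n" "T * S = 1\<^sub>m n"
    "\<And>r s. r < n \<Longrightarrow> s < n \<Longrightarrow> deg_le 0 (S $$ (r, s))"
proof -
  interpret i: comm_ring_hom "fps_to_fls :: 'a fps \<Rightarrow> 'a fls" by (rule comm_ring_hom_fps_to_fls)
  interpret c: comm_ring_hom "\<lambda>f :: 'a fps. fps_nth f 0" by (rule comm_ring_hom_fps_nth_0)
  define T' where "T' = map_mat fls_regpart T"
  have T': "T' \<in> carrier_mat n n" using T by (simp add: T'_def)
  have TT': "T = map_mat fps_to_fls T'"
    by (rule eq_matI) (use T deg in \<open>auto intro!: fls_eqI simp: T'_def deg_le_def\<close>)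
  have "fps_nth (det T') 0 = det (map_mat (\<lambda>f. fps_nth f 0) T')"
    by simp
  also have "\<dots> = prod_list (diag_mat (map_mat (\<lambda>f. fps_nth f 0) T'))"
    by (rule det_upper_triangular[of _ n])
      (use T upper in \<open>auto simp: T'_def upper_triangular_def\<close>)
  also have "diag_mat (map_mat (\<lambda>f. fps_nth f 0) T') = replicate n 1"
    by (rule nth_equalityI) (use T diag in \<open>auto simp: T'_def diag_mat_def\<close>)
  finally have "fps_nth (det T') 0 * 1 = 1" by simp
  then obtain e where e: "det T' * e = 1" using fps_right_inverse by blast
  define S' where "S' = e \<cdot>\<^sub>m adj_mat T'"
  have S': "S' \<in> carrier_mat n n" using adj_mat(1)[OF T'] by (simp add: S'_def)
  have "S' * T' = 1\<^sub>m n" "T' * S' = 1\<^sub>m n"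
    using adj_mat[OF T'] T' e unfolding S'_def
    by (auto simp: sq_simps(6,7)[of _ n] mult.commute intro!: eq_matI)
  then have "map_mat fps_to_fls S' * T = 1\<^sub>m n" "T * map_mat fps_to_fls S' = 1\<^sub>m n"
    unfolding TT' i.mat_hom_mult[OF S' T', symmetric] i.mat_hom_mult[OF T' S', symmetric]
    by (simp_all add: i.mat_hom_one)
  then show ?thesis
    using S' by (intro that[of "map_mat fps_to_fls S'"]) (auto simp: deg_le_def)
qed

lemma (in derivation) map_mat_one: "map_mat d (1\<^sub>m n) = 0\<^sub>m n n"
  by (rule eq_matI) auto

section \<open>Gauge transformation to a scalar operator, and conjugates of multiplication
  matrices\<close>

context diff_ring
begin

interpretation D: derivation "fls_map d"
  by (rule fls_map)

text \<open>
  \<open>T (\<partial> + J + U) T\<^sup>-\<^sup>1 = \<partial> + mult_mat n h\<close>, and \<open>S\<close> is the inverse of \<open>T\<close>.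
\<close>
definition dressing :: "nat \<Rightarrow> 'a mat \<Rightarrow> 'a fls \<Rightarrow> 'a fls mat \<Rightarrow> 'a fls mat \<Rightarrow> bool" where
  "dressing n U h T S \<longleftrightarrow> V_shape n U \<and> deg_le 0 (h - Z) \<and> T \<in> carrier_mat n n \<and> S \<in> carrier_mat n n \<and>
     T * S = 1\<^sub>m n \<and> S * T = 1\<^sub>m n \<and>
     map_mat (fls_map d) T = T * JU n U - mult_mat n h * T \<and>
     (\<forall>r<n. \<forall>s<n. deg_le 0 (T $$ (r, s)) \<and> deg_le 0 (S $$ (r, s))) \<and>
     (\<forall>r<n. fls_nth (T $$ (r, r)) 0 = 1) \<and> (\<forall>r<n. \<forall>s<r. fls_nth (T $$ (r, s)) 0 = 0) \<and>
     (\<forall>r<n. T $$ (r, 0) = (if r = 0 then 1 else 0))"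

text \<open>Column \<open>s\<close> of \<open>T\<close> holds \<open>(d + h)^s 1\<close>, whose
  leading term is \<open>z^s\<close>. Hence the part of \<open>T\<close> at \<open>lambda^0\<close>
  is upper triangular with ones on the diagonal, and positive powers of \<open>lambda\<close> are
  absent.\<close>

lemma dressing_exists:
  assumes n: "n \<ge> 2" and U: "V_shape n U"
  shows "\<exists>h T S. dressing n U h T S"
proof -
  obtain h where h: "deg_le 0 (h - Z)" "riccati n (\<lambda>i. U $$ (i, n - 1)) h 1 = 0"
    using riccati_exists[of n] n by auto
  define T where "T = cols n h 1"
  have nth: "fls_nth (T $$ (r, s)) k = fls_nth (nabla h 1 s) (int n * k - int r)" if "r < n" "s < n" for r s k
    using that by (simp add: T_def cols_def section_coord_nth)
  \<comment> \<open>In degree \<open>s\<close> and above, \<open>(d + h)^s 1\<close> coincides with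
    \<open>z^s\<close>.\<close>
  have low: "fls_nth (nabla h 1 s) k = (if k = - int s then 1 else 0)" if "k \<le> - int s" for s k
    using deg_leD[OF nabla_deg_le[OF h(1), of s], of k]
      deg_leD[OF nabla_minus_power[OF h(1), of s], of "- int s"] that
    by (cases "k = - int s") auto
  have T: "T \<in> carrier_mat n n" by (simp add: T_def)
  have deg: "deg_le 0 (T $$ (r, s))" if rs: "r < n" "s < n" for r s
    unfolding deg_le_def
  proof (intro allI impI)
    fix k :: int assume "k < - 0"
    then have "int n * k \<le> int n * (- 1)" using n by (intro mult_left_mono) auto
    then have "int n * k - int r < - int s" using rs by simp
    then show "fls_nth (T $$ (r, s)) k = 0" using low nth[OF rs] by simp
  qed
  have diag: "fls_nth (T $$ (r, r)) 0 = 1" if "r < n" for r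
    using that by (simp add: nth low)
  have upper: "fls_nth (T $$ (r, s)) 0 = 0" if "s < r" "r < n" for r s
    using that by (simp add: nth low)
  obtain S where "S \<in> carrier_mat n n" "S * T = 1\<^sub>m n" "T * S = 1\<^sub>m n"
    "\<And>r s. r < n \<Longrightarrow> s < n \<Longrightarrow> deg_le 0 (S $$ (r, s))"
    using ex_inverse_unipotent_series[OF T deg diag upper] by blast
  moreover have "map_mat (fls_map d) T = T * JU n U - mult_mat n h * T"
    unfolding T_def by (rule cols_ode[OF n U h(2)])
  moreover have "T $$ (r, 0) = (if r = 0 then 1 else 0)" if "r < n" for r
    using that by (simp add: T_def cols_def section_coord_1)
  ultimately have "dressing n U h T S"
    using U h T deg diag upper by (auto simp: dressing_def)
  then show ?thesis by blast
qed

lemma riccati_of_gauge: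
  assumes n: "n \<ge> 2" and U: "V_shape n U" and T: "T \<in> carrier_mat n n"
    and ode: "map_mat (fls_map d) T = T * JU n U - mult_mat n h * T"
    and col: "\<And>r. r < n \<Longrightarrow> T $$ (r, 0) = (if r = 0 then 1 else 0)"
  shows "T = cols n h 1" "riccati n (\<lambda>i. U $$ (i, n - 1)) h 1 = 0"
  using ode_cols[OF n U T ode, of 1] col by (simp_all add: section_coord_1)

text \<open>A first column \<open>e_1\<close> represents the function \<open>1\<close>, so
  \<open>ode_cols\<close> makes both \<open>h\<close> and \<open>h'\<close> solutions of the same
  Riccati equation.\<close>

lemma gauge_unique:
  assumes n: "n \<ge> 2" and U: "V_shape n U"
    and T: "T \<in> carrier_mat n n" "map_mat (fls_map d) T = T * JU n U - mult_mat n h * T"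
      "\<And>r. r < n \<Longrightarrow> T $$ (r, 0) = (if r = 0 then 1 else 0)" "deg_le 0 (h - Z)"
    and T': "T' \<in> carrier_mat n n" "map_mat (fls_map d) T' = T' * JU n U - mult_mat n h' * T'"
      "\<And>r. r < n \<Longrightarrow> T' $$ (r, 0) = (if r = 0 then 1 else 0)" "deg_le 0 (h' - Z)"
  shows "h' = h"
  by (rule riccati_unique[OF _ T(4) riccati_of_gauge(2)[OF n U T(1,2,3)]
        T'(4) riccati_of_gauge(2)[OF n U T'(1,2,3)]]) (use n in simp_all)

lemma dressing_sq:
  assumes "dressing n U h T S"
  shows "T \<in> carrier_mat n n" "S \<in> carrier_mat n n" "JU n U \<in> carrier_mat n n"
    "X \<in> carrier_mat n n \<Longrightarrow> T * (S * X) = X" "X \<in> carrier_mat n n \<Longrightarrow> S * (T * X) = X"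
    "T * S = 1\<^sub>m n" "S * T = 1\<^sub>m n"
proof -
  show TS: "T \<in> carrier_mat n n" "S \<in> carrier_mat n n" "JU n U \<in> carrier_mat n n"
    "T * S = 1\<^sub>m n" "S * T = 1\<^sub>m n"
    using assms by (auto simp: dressing_def)
  show "T * (S * X) = X" "S * (T * X) = X" if "X \<in> carrier_mat n n"
    using that TS by (simp_all add: sq_simps(1)[of _ n, symmetric])
qed

lemma dressing_inverse_col:
  assumes "dressing n U h T S" "n > 0" "r < n"
  shows "S $$ (r, 0) = (if r = 0 then 1 else 0)"
proof -
  have TS: "T \<in> carrier_mat n n" "S \<in> carrier_mat n n" "S * T = 1\<^sub>m n"
    "\<And>r. r < n \<Longrightarrow> T $$ (r, 0) = (if r = 0 then 1 else 0)"
    using assms(1) by (auto simp: dressing_def)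
  have "(S * T) $$ (r, 0) = (\<Sum>i<n. S $$ (r, i) * T $$ (i, 0))"
    using TS(1,2) assms(2,3) by (simp add: scalar_prod_def lessThan_atLeast0)
  also have "\<dots> = (\<Sum>i<n. if i = 0 then S $$ (r, i) else 0)"
    by (intro sum.cong) (auto simp: TS(4))
  also have "\<dots> = S $$ (r, 0)" using assms(2) by (subst sum.delta) auto
  finally show ?thesis using assms(2,3) by (simp add: TS(3))
qed

text \<open>For constant \<open>w\<close> these are solutions of \<open>[d + J + U, Y] = 0\<close>.
  The map is multiplicative in \<open>w\<close>; \<open>w = Z\<close> gives the series
  \<open>Y\<close>, and \<open>w = Z ^ j\<close> its powers.\<close>

definition dressed :: "nat \<Rightarrow> 'a fls mat \<Rightarrow> 'a fls mat \<Rightarrow> 'a fls \<Rightarrow> 'a fls mat" where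
  "dressed n T S w = S * mult_mat n w * T"

lemma dressed_carrier:
  "dressing n U h T S \<Longrightarrow> dressed n T S w \<in> carrier_mat n n"
  by (auto simp: dressing_def dressed_def intro!: mult_carrier_mat)

lemma dressed_mult:
  assumes "dressing n U h T S"
  shows "dressed n T S (v * w) = dressed n T S v * dressed n T S w"
  unfolding dressed_def mult_mat_mult using dressing_sq[OF assms] by (simp add: sq_simps[of _ n])

lemma dressed_1:
  assumes "dressing n U h T S"
  shows "dressed n T S 1 = 1\<^sub>m n"
  unfolding dressed_def mult_mat_1 using dressing_sq[OF assms] by (simp add: sq_units[of _ n])

lemma dressed_power:
  assumes "dressing n U h T S"
  shows "dressed n T S w ^\<^sub>m k = dressed n T S (w ^ k)"
proof (induction k)
  case 0
  have "dim_row (dressed n T S w) = n" using dressed_carrier[OF assms, of w] by auto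
  then show ?case by (simp add: dressed_1[OF assms])
next
  case (Suc k)
  then show ?case by (simp add: dressed_mult[OF assms] power_Suc2 del: power_Suc)
qed

lemma dressed_Z_power_n:
  assumes "dressing n U h T S"
  shows "dressed n T S (Z ^ n * w) = Z \<cdot>\<^sub>m dressed n T S w"
  unfolding dressed_def mult_mat_mult mult_mat_Z_power_n using dressing_sq[OF assms]
  by (simp add: sq_simps[of _ n] sq_units[of _ n])

lemma mult_mat_dressed:
  assumes "dressing n U h T S"
  shows "T * (dressed n T S w * S) = mult_mat n w"
  unfolding dressed_def using dressing_sq[OF assms] by (simp add: sq_simps[of _ n] sq_units[of _ n])

lemma trace_dressed:
  assumes "dressing n U h T S"
  shows "trace_mat (dressed n T S w) = trace_mat (mult_mat n w)"
proof -
  note TS = dressing_sq[OF assms]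
  have "trace_mat (S * (mult_mat n w * T)) = trace_mat (mult_mat n w * T * S)"
    using TS by (intro trace_mult_commute[of _ n n]) auto
  then show ?thesis
    unfolding dressed_def using TS by (simp add: sq_simps[of _ n] sq_units[of _ n])
qed

text \<open>Obtained by differentiating \<open>S * T = 1\<close>.\<close>

lemma dressing_inverse_ode:
  assumes "dressing n U h T S"
  shows "map_mat (fls_map d) S = S * mult_mat n h - JU n U * S"
proof -
  note TS = dressing_sq[OF assms]
  have ode: "map_mat (fls_map d) T = T * JU n U - mult_mat n h * T"
    using assms by (auto simp: dressing_def)
  let ?d = "map_mat (fls_map d)"
  have dS: "?d S \<in> carrier_mat n n" using TS by simp
  have "?d (S * T) * S = 0\<^sub>m n n" by (simp add: TS D.map_mat_one sq_units[OF TS(2)])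
  moreover have "?d (S * T) * S = ?d S + (JU n U * S - S * mult_mat n h)"
    unfolding D.mat_mult[OF TS(2,1)] ode using TS dS
    by (simp add: sq_simps[of _ n] sq_units[of _ n])
  ultimately have *: "?d S + (JU n U * S - S * mult_mat n h) = 0\<^sub>m n n" by simp
  show ?thesis
  proof (rule eq_matI)
    fix r s assume "r < dim_row (S * mult_mat n h - JU n U * S)" "s < dim_col (S * mult_mat n h - JU n U * S)"
    then have rs: "r < n" "s < n" using TS by auto
    have "(?d S + (JU n U * S - S * mult_mat n h)) $$ (r, s) = 0"
      unfolding * using rs by simp
    moreover have "(?d S + (JU n U * S - S * mult_mat n h)) $$ (r, s)
        = ?d S $$ (r, s) + ((JU n U * S) $$ (r, s) - (S * mult_mat n h) $$ (r, s))"
      using rs TS dS by (auto simp del: index_mult_mat(1) index_map_mat(1))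
    moreover have "(S * mult_mat n h - JU n U * S) $$ (r, s) = (S * mult_mat n h) $$ (r, s) - (JU n U * S) $$ (r, s)"
      using rs TS by (auto simp del: index_mult_mat(1))
    moreover have "x = b - a" if "x + (a - b) = 0" for x a b :: "'a fls"
      using arg_cong[OF that, of "\<lambda>y. y - (a - b)"] by simp
    ultimately show "?d S $$ (r, s) = (S * mult_mat n h - JU n U * S) $$ (r, s)" by metis
  qed (use TS in auto)
qed

lemma map_mult_mat_constant:
  "fls_map e w = 0 \<Longrightarrow> e 0 = 0 \<Longrightarrow> map_mat (fls_map e) (mult_mat n w) = (0\<^sub>m n n :: 'b::comm_ring_1 fls mat)"
  unfolding mult_mat_map[symmetric] by (auto intro!: eq_matI fls_eqI simp: mult_mat_nth)

text \<open>In the derivative of \<open>S w T\<close> the two terms with \<open>h\<close> cancel,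
  because multiplication matrices commute and \<open>w\<close> has derivative zero.\<close>

lemma dressed_ode:
  assumes dr: "dressing n U h T S" and w: "fls_map d w = 0"
  shows "map_mat (fls_map d) (dressed n T S w) = dressed n T S w * JU n U - JU n U * dressed n T S w"
proof -
  note TS = dressing_sq[OF dr]
  have ode: "map_mat (fls_map d) T = T * JU n U - mult_mat n h * T"
    using dr by (auto simp: dressing_def)
  let ?d = "map_mat (fls_map d)"
  let ?M = "mult_mat n w"
  let ?H = "mult_mat n h"
  have c: "?H * (?M * X) = ?M * (?H * X)" if "X \<in> carrier_mat n n" for X
    using that by (simp add: sq_simps(1)[of _ n, symmetric] mult_mat_mult[symmetric] mult.commute)
  have "?d (S * ?M) = ?d S * ?M"
    using TS D.mat_mult[of S n n ?M n] map_mult_mat_constant[OF w]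
    by (simp add: sq_units[of _ n])
  then have "?d (dressed n T S w) = ?d S * (?M * T) + S * (?M * ?d T)"
    unfolding dressed_def using TS by (subst D.mat_mult[of _ n n _ n]) (auto simp: sq_simps[of _ n])
  also have "\<dots> = dressed n T S w * JU n U - JU n U * dressed n T S w"
    unfolding dressing_inverse_ode[OF dr] ode dressed_def using TS
    by (simp add: sq_simps[of _ n] c) (auto intro!: eq_matI simp del: index_mult_mat(1))
  finally show ?thesis .
qed

text \<open>The corner matrix is an outer product of unit vectors, so only the first column of
  \<open>A\<close> and the last row of \<open>B\<close> survive.\<close>

lemma mult_mat_elem_col_row:
  fixes A B :: "'b::comm_ring_1 mat"
  assumes A: "A \<in> carrier_mat n n" and B: "B \<in> carrier_mat n n" and rs: "r < n" "s < n"
  shows "(A * elem_mat n 0 (n - 1) * B) $$ (r, s) = A $$ (r, 0) * B $$ (n - 1, s)"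
proof -
  let ?E = "elem_mat n 0 (n - 1) :: 'b mat"
  have "(A * ?E) $$ (r, i) = (if i = n - 1 then A $$ (r, 0) else 0)" if "i < n" for i
  proof -
    have "(A * ?E) $$ (r, i) = (\<Sum>l<n. A $$ (r, l) * ?E $$ (l, i))"
      using A rs that by (simp add: elem_mat_def scalar_prod_def lessThan_atLeast0)
    also have "\<dots> = (\<Sum>l<n. if l = 0 then if i = n - 1 then A $$ (r, l) else 0 else 0)"
      using that by (intro sum.cong) (auto simp: elem_mat_def)
    also have "\<dots> = (if i = n - 1 then A $$ (r, 0) else 0)" using that by (subst sum.delta) auto
    finally show ?thesis .
  qed
  note AE = this
  have E: "?E \<in> carrier_mat n n" by (simp add: elem_mat_def)
  have "(A * ?E * B) $$ (r, s) = (\<Sum>i<n. (A * ?E) $$ (r, i) * B $$ (i, s))"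
    by (rule sq_mult_entry[OF sq_mult_closed[OF A E] B rs])
  also have "\<dots> = (\<Sum>i<n. if i = n - 1 then A $$ (r, 0) * B $$ (i, s) else 0)"
  proof (intro sum.cong refl)
    fix i assume "i \<in> {..<n}"
    then have "i < n" by simp
    show "(A * ?E) $$ (r, i) * B $$ (i, s) = (if i = n - 1 then A $$ (r, 0) * B $$ (i, s) else 0)"
      unfolding AE[OF \<open>i < n\<close>] by simp
  qed
  finally have "(A * ?E * B) $$ (r, s) = (\<Sum>i<n. if i = n - 1 then A $$ (r, 0) * B $$ (i, s) else 0)" .
  also have "\<dots> = A $$ (r, 0) * B $$ (n - 1, s)" using rs by (subst sum.delta) auto
  finally show ?thesis .
qed

lemma deg_le_mult_mats:
  assumes "A \<in> carrier_mat n n" "B \<in> carrier_mat n n"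
    and "\<And>r s. r < n \<Longrightarrow> s < n \<Longrightarrow> deg_le a (A $$ (r, s))" "\<And>r s. r < n \<Longrightarrow> s < n \<Longrightarrow> deg_le b (B $$ (r, s))"
    and "r < n" "s < n" "a + b \<le> c"
  shows "deg_le c ((A * B) $$ (r, s))"
proof -
  have "(A * B) $$ (r, s) = (\<Sum>i<n. A $$ (r, i) * B $$ (i, s))"
    using assms by (simp add: scalar_prod_def lessThan_atLeast0)
  also have "deg_le c \<dots>" using assms by (intro deg_le_sum deg_le_mult) auto
  finally show ?thesis .
qed

text \<open>The part with a positive power of \<open>lambda\<close> can only come from
  \<open>lambda S e_1n T\<close>. The first column of \<open>S\<close> is exactly
  \<open>e_1\<close>, and the last row of \<open>T\<close> is that of the identity up to
  \<open>lambda^-1\<close>.\<close>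

lemma dressed_Z_leading:
  assumes n: "n \<ge> 2" and dr: "dressing n U h T S" and rs: "r < n" "s < n"
  shows "deg_le 0 (dressed n T S Z $$ (r, s) - (if r = 0 \<and> s = n - 1 then Z else 0))"
proof -
  have TS: "T \<in> carrier_mat n n" "S \<in> carrier_mat n n"
    and deg: "\<And>r s. r < n \<Longrightarrow> s < n \<Longrightarrow> deg_le 0 (T $$ (r, s))"
      "\<And>r s. r < n \<Longrightarrow> s < n \<Longrightarrow> deg_le 0 (S $$ (r, s))"
    and T0: "\<And>s. s < n \<Longrightarrow> fls_nth (T $$ (n - 1, s)) 0 = (if s = n - 1 then 1 else 0)"
    using dr n by (auto simp: dressing_def)
  let ?E = "elem_mat n 0 (n - 1) :: 'a fls mat"
  have E: "?E \<in> carrier_mat n n" "(b_mat n :: 'a fls mat) \<in> carrier_mat n n" by (simp_all add: elem_mat_def b_mat_def)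
  have "dressed n T S Z = Z \<cdot>\<^sub>m (S * ?E * T) + S * b_mat n * T"
    unfolding dressed_def mult_mat_Z[OF n] using TS E by (simp add: sq_simps[of _ n])
  then have "dressed n T S Z $$ (r, s) = Z * (S $$ (r, 0) * T $$ (n - 1, s)) + (S * b_mat n * T) $$ (r, s)"
    using rs TS E mult_mat_elem_col_row[OF TS(2,1) rs] by (auto simp del: index_mult_mat(1))
  moreover have "deg_le 0 ((S * b_mat n * T) $$ (r, s))"
  proof (rule deg_le_mult_mats[of _ n _ 0 0])
    show "deg_le 0 ((S * b_mat n) $$ (r, s))" if "r < n" "s < n" for r s
      by (rule deg_le_mult_mats[of _ n _ 0 0]) (use TS E deg that in \<open>auto simp: b_mat_def[of n]\<close>)
  qed (use TS E deg rs in auto)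
  moreover have "deg_le 0 (Z * (S $$ (r, 0) * T $$ (n - 1, s)) - (if r = 0 \<and> s = n - 1 then Z else 0))"
  proof (cases "r = 0")
    case True
    have "deg_le (- 1) (T $$ (n - 1, s) - (if s = n - 1 then 1 else 0))"
      unfolding deg_le_def
    proof (intro allI impI)
      fix k :: int assume "k < - (- 1)"
      then have "k < 0 \<or> k = 0" by auto
      then show "fls_nth (T $$ (n - 1, s) - (if s = n - 1 then 1 else 0)) k = 0"
        using deg_leD[OF deg(1)[of "n - 1" s], of k] T0[OF rs(2)] n rs by auto
    qed
    then have "deg_le 0 (Z * (T $$ (n - 1, s) - (if s = n - 1 then 1 else 0)))"
      by (rule deg_le_mult[OF deg_le_Z]) simp
    then show ?thesis
      using True dressing_inverse_col[OF dr, of r] n by (auto simp: algebra_simps split: if_splits)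
  next
    case False
    then show ?thesis using dressing_inverse_col[OF dr, of r] n rs by simp
  qed
  ultimately show ?thesis using deg_le_add by (metis (no_types, lifting) diff_add_eq)
qed

text \<open>
  \<open>T Y'\<close> solves the same linear equation as \<open>T\<close>, so its columns are governed by a solution \<open>w\<close>
  of the Riccati operator, which has to be constant.
\<close>
lemma dressed_Z_unique:
  assumes n: "n \<ge> 2" and dr: "dressing n U h T S" and Y: "Y \<in> carrier_mat n n"
    and ode: "map_mat (fls_map d) Y = Y * JU n U - JU n U * Y"
    and root: "Y ^\<^sub>m n = Z \<cdot>\<^sub>m 1\<^sub>m n"
    and lead: "\<And>r s. r < n \<Longrightarrow> s < n \<Longrightarrow> deg_le 0 (Y $$ (r, s) - (if r = 0 \<and> s = n - 1 then Z else 0))"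
  shows "Y = dressed n T S Z"
proof -
  have TS: "T \<in> carrier_mat n n" "S \<in> carrier_mat n n" "T * S = 1\<^sub>m n" "S * T = 1\<^sub>m n"
    and deg: "\<And>r s. r < n \<Longrightarrow> s < n \<Longrightarrow> deg_le 0 (T $$ (r, s))"
      "\<And>r s. r < n \<Longrightarrow> s < n \<Longrightarrow> deg_le 0 (S $$ (r, s))"
    and T: "map_mat (fls_map d) T = T * JU n U - mult_mat n h * T" and U: "V_shape n U"
    and h: "deg_le 0 (h - Z)" and col: "\<And>r. r < n \<Longrightarrow> T $$ (r, 0) = (if r = 0 then 1 else 0)"
    using dr by (auto simp: dressing_def)
  have n0: "n > 0" using n by simp
  note J = JU_carrier[OF U]
  have TY: "T * Y \<in> carrier_mat n n" using TS Y by auto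
  have "map_mat (fls_map d) (T * Y) = (T * JU n U - mult_mat n h * T) * Y + T * (Y * JU n U - JU n U * Y)"
    unfolding D.mat_mult[OF TS(1) Y] T ode ..
  also have "\<dots> = T * Y * JU n U - mult_mat n h * (T * Y)"
    using TS Y J by (simp add: sq_simps[of _ n]) (auto intro!: eq_matI simp del: index_mult_mat(1))
  finally have TY_ode: "map_mat (fls_map d) (T * Y) = T * Y * JU n U - mult_mat n h * (T * Y)" .
  obtain w where w: "\<And>r. r < n \<Longrightarrow> section_coord n r w = (T * Y) $$ (r, 0)"
    using ex_section_coord[OF n0, of "\<lambda>r. (T * Y) $$ (r, 0)"] by blast
  have TY_cols: "T * Y = cols n h w" and ric: "riccati n (\<lambda>i. U $$ (i, n - 1)) h w = 0"
    using ode_cols[OF n U TY TY_ode, of w] w by auto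
  have T_cols: "T = cols n h 1" and ric1: "riccati n (\<lambda>i. U $$ (i, n - 1)) h 1 = 0"
    using riccati_of_gauge[OF n U TS(1) T col] by auto
  have "fls_map d w = 0" by (rule riccati_solution_constant[OF n0 h ric1 ric])
  have "cols n h w = mult_mat n w * cols n h 1"
  proof (rule eq_matI)
    fix r s assume "r < dim_row (mult_mat n w * cols n h 1)" "s < dim_col (mult_mat n w * cols n h 1)"
    then have rs: "r < n" "s < n" by (auto simp: cols_def)
    show "cols n h w $$ (r, s) = (mult_mat n w * cols n h 1) $$ (r, s)"
      unfolding mult_mat_cols[OF rs] using rs \<open>fls_map d w = 0\<close>
      by (simp add: nabla_constant[of w h] cols_def)
  qed (auto simp: cols_def)
  then have TYw: "T * Y = mult_mat n w * T" using TY_cols T_cols by simp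
  have Yw: "Y = dressed n T S w"
  proof -
    have "Y = S * (T * Y)" using Y dressing_sq(5)[OF dr] by simp
    then show ?thesis unfolding TYw dressed_def using TS Y by (simp add: sq_simps[of _ n])
  qed
  \<comment> \<open>\<open>T\<close> and \<open>S\<close> have degree at most \<open>0\<close>, so
    conjugating with them keeps the degree bound on the difference of the two solutions.\<close>
  have "mult_mat n (w - Z) = T * (Y - dressed n T S Z) * S"
    using TS(1,2) Y dressed_carrier[OF dr] mult_mat_dressed[OF dr]
    by (simp add: Yw sq_simps[of _ n] mult_mat_diff)
  moreover have "deg_le 0 ((T * (Y - dressed n T S Z) * S) $$ (r, s))" if rs: "r < n" "s < n" for r s
  proof -
    note c = TS(1,2) Y dressed_carrier[OF dr, of Z]
    have 1: "deg_le 0 ((Y - dressed n T S Z) $$ (r, s))" if rs: "r < n" "s < n" for r s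
    proof -
      have "deg_le 0 ((Y $$ (r, s) - (if r = 0 \<and> s = n - 1 then Z else 0))
          - (dressed n T S Z $$ (r, s) - (if r = 0 \<and> s = n - 1 then Z else 0)))"
        by (intro deg_le_diff lead dressed_Z_leading[OF n dr] rs)
      then show ?thesis using rs c by simp
    qed
    have 2: "deg_le 0 ((T * (Y - dressed n T S Z)) $$ (r, s))" if "r < n" "s < n" for r s
      using that c by (intro deg_le_mult_mats[OF _ _ deg(1) 1]) simp_all
    show ?thesis
      using rs c by (intro deg_le_mult_mats[OF _ _ 2 deg(2)]) simp_all
  qed
  ultimately have deg_w: "deg_le 0 (mult_mat n (w - Z) $$ (r, s))" if "r < n" "s < n" for r s
    using that by simp
  \<comment> \<open>The first row is enough: its entry at \<open>s\<close> collects the coefficients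
    of \<open>w - z\<close> whose index is congruent to \<open>s\<close> modulo
    \<open>n\<close>.\<close>
  have "deg_le 0 (w - Z)"
    unfolding deg_le_def
  proof (intro allI impI)
    fix j :: int assume "j < - 0"
    then have "j div int n < 0" using n0 by (simp add: div_neg_pos_less0)
    moreover have "nat (j mod int n) < n" using n0 by (simp add: nat_less_iff)
    ultimately have "fls_nth (mult_mat n (w - Z) $$ (0, nat (j mod int n))) (j div int n) = 0"
      using deg_leD[OF deg_w] n0 by simp
    moreover have "int n * (j div int n) - int 0 + int (nat (j mod int n)) = j"
      using n0 by simp
    ultimately show "fls_nth (w - Z) j = 0"
      using mult_mat_nth[OF n0 \<open>nat (j mod int n) < n\<close>] by metis
  qed
  moreover have "w ^ n = Z ^ n"
  proof (rule mult_mat_inject[OF n0])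
    have one: "dressed n T S (Z ^ n) = Z \<cdot>\<^sub>m 1\<^sub>m n"
      using dressed_Z_power_n[OF dr, of 1] dressed_1[OF dr] by simp
    have "dressed n T S (w ^ n) = dressed n T S (Z ^ n)"
      unfolding one root[symmetric] Yw dressed_power[OF dr] ..
    then show "mult_mat n (w ^ n) = mult_mat n (Z ^ n)"
      using mult_mat_dressed[OF dr] by metis
  qed
  ultimately have "w = Z" by (rule root_unique[OF n0])
  then show ?thesis using Yw by simp
qed

end

text \<open>
  The terms that contain the variation of \<open>T\<close> add up to a total derivative, because multiplications
  by \<open>w\<close> and by \<open>h\<close> commute.
\<close>
lemma (in diff_ring) dressing_variation:
  assumes e: "derivation e" and comm: "\<And>a. e (d a) = d (e a)"
    and dr: "dressing n U h T S" and w: "fls_map d w = 0"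
  shows "\<exists>g. trace_mat (dressed n T S w * map_mat fls_const (map_mat e U))
      - trace_mat (mult_mat n (w * fls_map e h)) = fls_map d g"
proof -
  interpret D: derivation "fls_map d" by (rule fls_map)
  interpret e: derivation e by fact
  interpret E: derivation "fls_map e" by (rule e.fls_map)
  note TS = dressing_sq[OF dr]
  have ode: "map_mat (fls_map d) T = T * JU n U - mult_mat n h * T" and U: "V_shape n U"
    using dr by (auto simp: dressing_def)
  have Uc: "U \<in> carrier_mat n n" using U by (simp add: V_shape_def)
  let ?d = "map_mat (fls_map d)"
  let ?e = "map_mat (fls_map e)"
  let ?J = "JU n U"
  let ?M = "mult_mat n w"
  let ?H = "mult_mat n h"
  let ?V = "map_mat fls_const (map_mat e U) :: 'a fls mat"
  have V: "?V \<in> carrier_mat n n" using Uc by simp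
  have eT: "?e T \<in> carrier_mat n n" using TS by simp
  have eJ: "?e ?J = ?V"
  proof -
    have "fls_map e (fls_const a) = fls_const (e a)" for a
      by (rule fls_eqI) (simp add: fls_map_nth)
    moreover have "map_mat (fls_map e) (mult_mat n Z) = 0\<^sub>m n n"
      by (rule eq_matI) (auto intro!: fls_eqI simp: fls_map_nth mult_mat_nth)
    ultimately show ?thesis
      unfolding JU_def using Uc by (subst E.mat_add[of _ n n]) (auto intro!: eq_matI)
  qed
  have "?d (?e T) = ?e (?d T)"
    by (rule eq_matI) (auto intro!: fls_eqI simp: fls_map_nth comm)
  also have "\<dots> = (?e T * ?J + T * ?V) - (mult_mat n (fls_map e h) * T + ?H * ?e T)"
    unfolding ode using TS
    by (subst E.mat_diff[of _ n n]) (auto simp: E.mat_mult[of _ n n _ n] eJ mult_mat_map[of e])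
  finally have deT: "?d (?e T) = (?e T * ?J + T * ?V) - (mult_mat n (fls_map e h) * T + ?H * ?e T)" .
  \<comment> \<open>\<open>w (e T) T^-1\<close>; its trace is the potential \<open>g\<close> of the
    total derivative.\<close>
  let ?X = "?M * ?e T * S"
  have X: "?X \<in> carrier_mat n n" using TS eT by simp
  have dMe: "?d (?M * ?e T) = ?M * ?d (?e T)"
    using D.mat_mult[of ?M n n "?e T" n] map_mult_mat_constant[OF w] eT by (simp add: sq_units[of _ n])
  have c: "?H * (?M * Y) = ?M * (?H * Y)" if "Y \<in> carrier_mat n n" for Y
    using that by (simp add: sq_simps(1)[of _ n, symmetric] mult_mat_mult[symmetric] mult.commute)
  have "fls_map d (trace_mat ?X) = trace_mat (?d ?X)" by (rule D.trace[OF X])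
  also have "?d ?X = ?M * ?d (?e T) * S + ?M * ?e T * ?d S"
    using D.mat_mult[of "?M * ?e T" n n S n] TS eT dMe by simp
  also have "\<dots> = (?M * (?e T * (?J * S)) + ?M * (T * (?V * S))
      - (?M * mult_mat n (fls_map e h) + ?M * (?H * (?e T * S))))
      + (?M * (?e T * (S * ?H)) - ?M * (?e T * (?J * S)))"
    unfolding deT dressing_inverse_ode[OF dr] using TS V eT
    by (simp add: sq_simps[of _ n] sq_units[of _ n])
  also have "trace_mat \<dots> = trace_mat (?M * (T * (?V * S))) - trace_mat (?M * mult_mat n (fls_map e h))
      - trace_mat (?M * (?H * (?e T * S))) + trace_mat (?M * (?e T * (S * ?H)))"
    using TS V eT by (simp add: trace_sq[of _ n])
  also have "trace_mat (?M * (?e T * (S * ?H))) = trace_mat ((?M * (?e T * S)) * ?H)"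
    using TS eT by (simp add: sq_simps[of _ n])
  also have "\<dots> = trace_mat (?H * (?M * (?e T * S)))"
    using TS eT by (intro trace_mult_commute[of _ n n]) auto
  \<comment> \<open>Here \<open>h\<close> and \<open>w\<close> are interchanged; the two traces that
    still contain \<open>e T\<close> cancel afterwards.\<close>
  also have "?H * (?M * (?e T * S)) = ?M * (?H * (?e T * S))" using TS eT by (intro c) auto
  also have "trace_mat (?M * (T * (?V * S))) = trace_mat ((?M * (T * ?V)) * S)"
    using TS V by (simp add: sq_simps[of _ n])
  also have "\<dots> = trace_mat (S * (?M * (T * ?V)))"
    using TS V by (intro trace_mult_commute[of _ n n]) auto
  also have "S * (?M * (T * ?V)) = dressed n T S w * ?V"
    unfolding dressed_def using TS V by (simp add: sq_simps[of _ n])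
  finally show ?thesis by (intro exI[of _ "trace_mat ?X"]) (simp add: mult_mat_mult)
qed

section \<open>The operator \<open>[\<partial> + b + u, \<cdot>]\<close>\<close>

lemma b_mat_carrier [simp]: "b_mat n \<in> carrier_mat n n" "dim_row (b_mat n) = n" "dim_col (b_mat n) = n"
  by (simp_all add: b_mat_def)

lemma elem_mat_carrier [simp]:
  "elem_mat n i j \<in> carrier_mat n n" "dim_row (elem_mat n i j) = n" "dim_col (elem_mat n i j) = n"
  by (simp_all add: elem_mat_def)

lemma commutator_carrier [simp]:
  "A \<in> carrier_mat n n \<Longrightarrow> B \<in> carrier_mat n n \<Longrightarrow> commutator A B \<in> carrier_mat n n"
  by (simp add: commutator_def)

lemma trace_commutator:
  fixes A B :: "'a::comm_ring_1 mat"
  shows "A \<in> carrier_mat n n \<Longrightarrow> B \<in> carrier_mat n n \<Longrightarrow> trace_mat (commutator A B) = 0"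
  using trace_mult_commute[of A n n B] by (simp add: commutator_def trace_sq[of _ n])

lemma sq_eq_diff_if_add_eq_0:
  fixes A B C :: "'a::comm_ring_1 mat"
  assumes "A \<in> carrier_mat n n" "B \<in> carrier_mat n n" "C \<in> carrier_mat n n" "A + (B - C) = 0\<^sub>m n n"
  shows "A = C - B"
proof (rule eq_matI)
  fix i j assume "i < dim_row (C - B)" "j < dim_col (C - B)"
  then have ij: "i < n" "j < n" using assms by auto
  then have "(A + (B - C)) $$ (i, j) = 0" using assms(4) by simp
  then have "A $$ (i, j) + (B $$ (i, j) - C $$ (i, j)) = 0" using ij assms(1-3) by simp
  moreover have "x = b - a" if "x + (a - b) = 0" for x a b :: 'a
    using arg_cong[OF that, of "\<lambda>y. y - (a - b)"] by simp
  ultimately show "A $$ (i, j) = (C - B) $$ (i, j)" using ij assms(1-3) by simp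
qed (use assms in auto)

lemma sq_eq_diff_if_diff_eq:
  fixes A B C :: "'a::comm_ring_1 mat"
  assumes "A \<in> carrier_mat n n" "B \<in> carrier_mat n n" "C \<in> carrier_mat n n" "B - A = C"
  shows "A = B - C"
  unfolding assms(4)[symmetric] by (rule eq_matI) (use assms(1-3) in auto)

context diff_ring
begin

definition cov :: "nat \<Rightarrow> 'a mat \<Rightarrow> 'a mat \<Rightarrow> 'a mat" where
  "cov n U C = map_mat d C + commutator (b_mat n + U) C"

lemma V_shape_carrier: "V_shape n U \<Longrightarrow> U \<in> carrier_mat n n"
  by (simp add: V_shape_def)

lemma cov_carrier [simp]: "U \<in> carrier_mat n n \<Longrightarrow> C \<in> carrier_mat n n \<Longrightarrow> cov n U C \<in> carrier_mat n n"
  by (simp add: cov_def)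

lemma cov_diff:
  assumes "U \<in> carrier_mat n n" "A \<in> carrier_mat n n" "B \<in> carrier_mat n n"
  shows "cov n U (A - B) = cov n U A - cov n U B"
proof -
  have bU: "b_mat n + U \<in> carrier_mat n n" using assms by simp
  show ?thesis
    unfolding cov_def commutator_def mat_diff[OF assms(2,3)]
    using assms bU by (auto simp: sq_simps(4,5)[of _ n] simp del: index_mult_mat(1) intro!: eq_matI)
qed

lemma b_U_mult_entry:
  assumes "V_shape n U" "C \<in> carrier_mat n n" "r < n" "s < n"
  shows "((b_mat n + U) * C) $$ (r, s) = (if r = 0 then 0 else C $$ (r - 1, s)) + U $$ (r, n - 1) * C $$ (n - 1, s)"
proof -
  have U: "U \<in> carrier_mat n n" using assms(1) by (rule V_shape_carrier)
  have "((b_mat n + U) * C) $$ (r, s) = (\<Sum>i<n. (b_mat n + U) $$ (r, i) * C $$ (i, s))"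
    using assms U by (intro sq_mult_entry) auto
  also have "\<dots> = (\<Sum>i<n. if i = r - 1 then if r = 0 then 0 else C $$ (i, s) else 0)
      + (\<Sum>i<n. if i = n - 1 then U $$ (r, i) * C $$ (i, s) else 0)"
    unfolding sum.distrib[symmetric]
  proof (rule sum.cong[OF refl])
    fix i assume "i \<in> {..<n}"
    then have i: "i < n" by simp
    have "U $$ (r, i) = 0" if "i \<noteq> n - 1" using assms(1,3) i that by (simp add: V_shape_def)
    then show "(b_mat n + U) $$ (r, i) * C $$ (i, s) = (if i = r - 1 then if r = 0 then 0 else C $$ (i, s) else 0)
        + (if i = n - 1 then U $$ (r, i) * C $$ (i, s) else 0)"
      using assms(3) i U by (auto simp: b_mat_def algebra_simps)
  qed
  also have "\<dots> = (if r = 0 then 0 else C $$ (r - 1, s)) + U $$ (r, n - 1) * C $$ (n - 1, s)"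
    using assms(3) by (subst sum.delta, simp)+ auto
  finally show ?thesis .
qed

lemma mult_b_U_entry:
  assumes "V_shape n U" "C \<in> carrier_mat n n" "r < n" "s < n - 1"
  shows "(C * (b_mat n + U)) $$ (r, s) = C $$ (r, Suc s)"
proof -
  have U: "U \<in> carrier_mat n n" using assms(1) by (rule V_shape_carrier)
  have "(C * (b_mat n + U)) $$ (r, s) = (\<Sum>i<n. C $$ (r, i) * (b_mat n + U) $$ (i, s))"
    using assms U by (intro sq_mult_entry) auto
  also have "\<dots> = (\<Sum>i<n. if i = Suc s then C $$ (r, i) else 0)"
  proof (rule sum.cong[OF refl])
    fix i assume "i \<in> {..<n}"
    then have "U $$ (i, s) = 0" using assms by (simp add: V_shape_def)
    then show "C $$ (r, i) * (b_mat n + U) $$ (i, s) = (if i = Suc s then C $$ (r, i) else 0)"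
      using assms \<open>i \<in> {..<n}\<close> U by (auto simp: b_mat_def)
  qed
  also have "\<dots> = C $$ (r, Suc s)" using assms by (subst sum.delta) auto
  finally show ?thesis .
qed

text \<open>Where this entry vanishes, column \<open>s + 1\<close> of \<open>C\<close> is determined
  by column \<open>s\<close>. This is the recursion of \<open>pcol\<close>.\<close>

lemma cov_entry:
  assumes "V_shape n U" "C \<in> carrier_mat n n" "r < n" "s < n - 1"
  shows "cov n U C $$ (r, s) = d (C $$ (r, s)) + (if r = 0 then 0 else C $$ (r - 1, s))
    + U $$ (r, n - 1) * C $$ (n - 1, s) - C $$ (r, Suc s)"
proof -
  have U: "U \<in> carrier_mat n n" using assms(1) by (rule V_shape_carrier)
  have "cov n U C $$ (r, s) = d (C $$ (r, s)) + (((b_mat n + U) * C) $$ (r, s) - (C * (b_mat n + U)) $$ (r, s))"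
    unfolding cov_def commutator_def using assms U by (auto simp del: index_mult_mat(1))
  then show ?thesis
    using assms by (simp add: b_U_mult_entry mult_b_U_entry del: index_mult_mat(1))
qed

lemma trace_cov:
  assumes "U \<in> carrier_mat n n" "C \<in> carrier_mat n n"
  shows "trace_mat (cov n U C) = d (trace_mat C)"
  unfolding cov_def using assms by (simp add: trace_sq[of _ n] trace_commutator[of _ n] trace[of _ n])

text \<open>The first \<open>n - 1\<close> columns being zero, the corner entry equals the trace of
  \<open>cov n U C\<close>, which is the derivative of \<open>trace_mat C\<close>.\<close>

lemma V_shape_cov_iff:
  assumes n: "n > 0" and U: "V_shape n U" and C: "C \<in> carrier_mat n n" and tr: "trace_mat C = 0"
  shows "V_shape n (cov n U C) \<longleftrightarrow> (\<forall>r<n. \<forall>s<n - 1. cov n U C $$ (r, s) = 0)"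
proof
  assume *: "\<forall>r<n. \<forall>s<n - 1. cov n U C $$ (r, s) = 0"
  have c: "cov n U C \<in> carrier_mat n n" using V_shape_carrier[OF U] C by simp
  have "0 = trace_mat (cov n U C)" using V_shape_carrier[OF U] C tr by (simp add: trace_cov)
  also have "\<dots> = (\<Sum>i<n. if i = n - 1 then cov n U C $$ (i, i) else 0)"
    unfolding trace_mat_def using c * by (intro sum.cong) auto
  also have "\<dots> = cov n U C $$ (n - 1, n - 1)" using n by (subst sum.delta) auto
  finally have "cov n U C $$ (n - 1, n - 1) = 0" by simp
  then show "V_shape n (cov n U C)"
    unfolding V_shape_def using c * by (metis diff_Suc_1 less_Suc_eq less_imp_diff_less n not_less_eq Suc_pred)
qed (auto simp: V_shape_def)

text \<open>Column \<open>k\<close> of the matrix that has first column \<open>c\<close> and whose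
  \<open>cov\<close> vanishes outside the last column; \<open>u\<close> is the last column of
  \<open>U\<close>.\<close>

primrec pcol :: "nat \<Rightarrow> (nat \<Rightarrow> 'a) \<Rightarrow> (nat \<Rightarrow> 'a) \<Rightarrow> nat \<Rightarrow> nat \<Rightarrow> 'a" where
  "pcol n u c 0 = c"
| "pcol n u c (Suc k) = (\<lambda>m. d (pcol n u c k m) + (if m = 0 then 0 else pcol n u c k (m - 1)) + u m * pcol n u c k (n - 1))"

lemma pcol_add: "pcol n u (\<lambda>m. c m + c' m) k m = pcol n u c k m + pcol n u c' k m"
  by (induction k arbitrary: m) (simp_all add: add algebra_simps)

text \<open>Each step moves the support down by at most one row. The feedback through row
  \<open>n - 1\<close> starts only once the support has arrived there.\<close>

lemma pcol_support:
  assumes "\<And>m. m > q \<Longrightarrow> c m = 0"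
  shows "m > q + k \<Longrightarrow> m \<le> n - 1 \<Longrightarrow> pcol n u c k m = 0"
  using assms by (induction k arbitrary: m) auto

lemma pcol_top:
  assumes "\<And>m. m > q \<Longrightarrow> c m = 0"
  shows "q + k \<le> n - 1 \<Longrightarrow> pcol n u c k (q + k) = c q"
  by (induction k) (auto simp: pcol_support[of q, OF assms])

text \<open>A triangular system: the entry of the first column in row \<open>n - 1 - p\<close>
  reaches the bottom row for the first time in column \<open>p\<close>, and with coefficient
  \<open>1\<close>.\<close>

lemma pcol_solve:
  "p \<le> n - 1 \<Longrightarrow> \<exists>c. \<forall>k<p. pcol n u c k (n - 1) = v k"
proof (induction p)
  case (Suc p)
  then obtain c where c: "\<And>k. k < p \<Longrightarrow> pcol n u c k (n - 1) = v k" by auto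
  \<comment> \<open>The row from which the bottom is reached in exactly \<open>p\<close> steps, so
    the correction there leaves the columns before \<open>p\<close> intact.\<close>
  define q where "q = n - 1 - p"
  define c' where "c' m = (if m = q then v p - pcol n u c p (n - 1) else 0)" for m
  have c': "\<And>m. m > q \<Longrightarrow> c' m = 0" by (simp add: c'_def)
  have "pcol n u (\<lambda>m. c m + c' m) k (n - 1) = v k" if "k < Suc p" for k
  proof (cases "k = p")
    case True
    have "pcol n u c' p (q + p) = c' q" using Suc.prems by (intro pcol_top c') (auto simp: q_def)
    moreover have "q + p = n - 1" using Suc.prems by (simp add: q_def)
    moreover have "c' q = v p - pcol n u c p (n - 1)" by (simp add: c'_def)
    ultimately show ?thesis by (simp add: True pcol_add)
  next
    case False
    then have "pcol n u c' k (n - 1) = 0"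
      using that Suc.prems by (intro pcol_support[of q] c') (auto simp: q_def)
    then show ?thesis using False that c by (simp add: pcol_add)
  qed
  then show ?case by blast
qed simp

text \<open>The last row fixes the entries \<open>1\<close> to \<open>n - 1\<close> of the first
  column through \<open>pcol_solve\<close>. The remaining top entry is free and adjusts the
  trace.\<close>

lemma P_exists:
  assumes n: "n \<ge> 2" and U: "V_shape n U"
  shows "\<exists>C. C \<in> carrier_mat n n \<and> trace_mat C = 0 \<and> (\<forall>k<n - 1. C $$ (n - 1, k) = v k) \<and> V_shape n (cov n U C)"
proof -
  define u where "u m = U $$ (m, n - 1)" for m
  obtain c where c: "\<And>k. k < n - 1 \<Longrightarrow> pcol n u c k (n - 1) = v k"
    using pcol_solve[of "n - 1" n u v] by auto
  obtain iv :: 'a where iv: "of_nat n * iv = 1" using nat_unit[of n] n by auto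
  define t where "t = (\<Sum>i<n. pcol n u c i i)"
  \<comment> \<open>A change of the top entry adds itself to all \<open>n\<close> diagonal entries
    and does not reach the bottom row before the corner. So it is minus the trace \<open>t\<close>
    divided by \<open>n\<close>.\<close>
  define c' where "c' m = (if m = 0 then - (iv * t) else 0)" for m :: nat
  have c': "\<And>m. m > 0 \<Longrightarrow> c' m = 0" by (simp add: c'_def)
  define C where "C = mat n n (\<lambda>(r, s). pcol n u (\<lambda>m. c m + c' m) s r)"
  have C: "C \<in> carrier_mat n n" by (simp add: C_def)
  have "pcol n u c' i i = - (iv * t)" if "i < n" for i
    using pcol_top[of 0 c' i n u, OF c'] that by (simp add: c'_def)
  then have "(\<Sum>i<n. pcol n u c' i i) = of_nat n * - (iv * t)" by simp
  moreover have "trace_mat C = t + (\<Sum>i<n. pcol n u c' i i)"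
    by (simp add: trace_mat_def C_def pcol_add sum.distrib t_def)
  ultimately have "trace_mat C = t + of_nat n * - (iv * t)" by simp
  also have "\<dots> = t - (of_nat n * iv) * t" by (simp add: algebra_simps)
  finally have tr: "trace_mat C = 0" by (simp add: iv)
  moreover have "C $$ (n - 1, k) = v k" if "k < n - 1" for k
    using that c pcol_support[of 0 c' k "n - 1" n u, OF c'] n by (simp add: C_def pcol_add)
  moreover have "V_shape n (cov n U C)"
  proof -
    have "n > 0" using n by simp
    show ?thesis
      unfolding V_shape_cov_iff[OF \<open>n > 0\<close> U C tr] using n
      by (auto simp: cov_entry[OF U C]) (auto simp: C_def u_def)
  qed
  ultimately show ?thesis using C by blast
qed

text \<open>With the last row zero before the corner, the \<open>U\<close> term of
  \<open>cov_entry\<close> drops out, and row \<open>r - 1\<close> is obtained from row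
  \<open>r\<close> by a shift and a derivative. Going up, the zeros left of the diagonal persist and
  the diagonal entries are all equal, so trace zero kills them. Row \<open>0\<close> of
  \<open>cov\<close> stays unrestricted, as it may be nonzero for the coefficients of
  \<open>Y^j\<close>.\<close>

lemma strictly_upper_if:
  assumes n: "n \<ge> 2" and U: "V_shape n U" and C: "C \<in> carrier_mat n n" and tr: "trace_mat C = 0"
    and last: "\<And>k. k < n - 1 \<Longrightarrow> C $$ (n - 1, k) = 0"
    and cov: "\<And>r s. 0 < r \<Longrightarrow> r < n \<Longrightarrow> s < n - 1 \<Longrightarrow> cov n U C $$ (r, s) = 0"
    and rs: "r < n" "s \<le> r"
  shows "C $$ (r, s) = 0"
proof -
  have rec: "C $$ (r - 1, s) = C $$ (r, Suc s) - d (C $$ (r, s))" if "0 < r" "r < n" "s < n - 1" for r s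
    using cov[OF that] cov_entry[OF U C that(2,3)] that last by (simp add: algebra_simps eq_neg_iff_add_eq_0)
  \<comment> \<open>\<open>i\<close> counts the rows from the bottom.\<close>
  have *: "i < n \<Longrightarrow> (\<forall>s<n - 1 - i. C $$ (n - 1 - i, s) = 0) \<and> C $$ (n - 1 - i, n - 1 - i) = C $$ (n - 1, n - 1)" for i
  proof (induction i)
    case (Suc i)
    have IH: "\<And>s. s < n - 1 - i \<Longrightarrow> C $$ (n - 1 - i, s) = 0" "C $$ (n - 1 - i, n - 1 - i) = C $$ (n - 1, n - 1)"
      using Suc by auto
    have eq: "n - 1 - Suc i = n - 1 - i - 1" by simp
    have rec': "C $$ (n - 1 - i - 1, s) = C $$ (n - 1 - i, Suc s) - d (C $$ (n - 1 - i, s))" if "s < n - 1 - i" for s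
      using Suc.prems that by (intro rec) auto
    show ?case
    proof (intro conjI allI impI)
      fix s assume "s < n - 1 - Suc i"
      then show "C $$ (n - 1 - Suc i, s) = 0"
        unfolding eq using IH(1)[of s] IH(1)[of "Suc s"] by (subst rec') auto
    next
      have s: "n - 1 - i - 1 < n - 1 - i" using Suc.prems by simp
      then have "Suc (n - 1 - i - 1) = n - 1 - i" by simp
      then show "C $$ (n - 1 - Suc i, n - 1 - Suc i) = C $$ (n - 1, n - 1)"
        unfolding eq using rec'[OF s] IH s by simp
    qed
  qed (use last in auto)
  have diag: "C $$ (r, r) = C $$ (n - 1, n - 1)" and low: "\<And>s. s < r \<Longrightarrow> C $$ (r, s) = 0" if "r < n" for r
    using *[of "n - 1 - r"] that by auto
  have "trace_mat C = (\<Sum>i<n. C $$ (n - 1, n - 1))"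
    unfolding trace_mat_def carrier_matD(1)[OF C] by (rule sum.cong[OF refl]) (rule diag, simp)
  then have "C $$ (n - 1, n - 1) = 0"
    using of_nat_mult_eq_0[of n "C $$ (n - 1, n - 1)"] n tr by simp
  then show ?thesis using diag[OF rs(1)] low[OF rs(1), of s] rs by (cases "s = r") auto
qed

lemma cov_zero_col:
  assumes U: "V_shape n U" and C: "C \<in> carrier_mat n n"
    and col: "\<And>r. r < n \<Longrightarrow> C $$ (r, 0) = 0"
    and cov: "\<And>r s. r < n \<Longrightarrow> s < n - 1 \<Longrightarrow> cov n U C $$ (r, s) = 0"
  shows "C = 0\<^sub>m n n"
proof -
  have "s < n \<Longrightarrow> r < n \<Longrightarrow> C $$ (r, s) = 0" for r s
  proof (induction s arbitrary: r)
    case (Suc s)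
    then have s: "s < n" "s < n - 1" "n - 1 < n" by auto
    have "C $$ (r, s) = 0" "C $$ (r - 1, s) = 0" "C $$ (n - 1, s) = 0"
      using Suc.IH s Suc.prems by auto
    then show ?case
      using cov[OF Suc.prems(2) s(2)] cov_entry[OF U C Suc.prems(2) s(2)] by (auto split: if_splits)
  qed (use col in auto)
  then show ?thesis using C by (auto intro!: eq_matI)
qed

text \<open>By \<open>strictly_upper_if\<close> the difference has zero first column, and
  \<open>cov_zero_col\<close> propagates this to all columns.\<close>

lemma P_unique:
  assumes n: "n \<ge> 2" and U: "V_shape n U"
    and C: "C \<in> carrier_mat n n" "trace_mat C = 0" "V_shape n (cov n U C)"
    and C': "C' \<in> carrier_mat n n" "trace_mat C' = 0" "V_shape n (cov n U C')"
    and eq: "\<And>k. k < n - 1 \<Longrightarrow> C $$ (n - 1, k) = C' $$ (n - 1, k)"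
  shows "C = C'"
proof -
  have U': "U \<in> carrier_mat n n" using U by (rule V_shape_carrier)
  have D: "C - C' \<in> carrier_mat n n" using C C' by simp
  have cov: "cov n U (C - C') $$ (r, s) = 0" if "r < n" "s < n - 1" for r s
    unfolding cov_diff[OF U' C(1) C'(1)] using C(3) C'(3) that cov_carrier[OF U' C'(1)]
    by (auto simp: V_shape_def)
  have "(C - C') $$ (r, 0) = 0" if "r < n" for r
  proof (rule strictly_upper_if[OF n U D])
    show "trace_mat (C - C') = 0" using C C' by (simp add: trace_sq[of _ n])
    show "(C - C') $$ (n - 1, k) = 0" if "k < n - 1" for k
      using C C' eq[OF that] that n by auto
    show "cov n U (C - C') $$ (r, s) = 0" if "r < n" "s < n - 1" for r s
      using that by (rule cov)
  qed (use that in auto)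
  then have "C - C' = 0\<^sub>m n n" by (rule cov_zero_col[OF U D _ cov])
  show ?thesis
  proof (rule eq_matI)
    fix i j assume "i < dim_row C'" "j < dim_col C'"
    then have "(C - C') $$ (i, j) = 0" using \<open>C - C' = 0\<^sub>m n n\<close> C'(1) by auto
    then show "C $$ (i, j) = C' $$ (i, j)" using \<open>i < dim_row C'\<close> \<open>j < dim_col C'\<close> by simp
  qed (use C C' in auto)
qed

text \<open>\<open>cov\<close> obeys the product rule and traces of commutators vanish; after
  integration this makes \<open>cov\<close> skew for the pairing.\<close>

lemma trace_cov_mult:
  assumes U: "U \<in> carrier_mat n n" and A: "A \<in> carrier_mat n n" and B: "B \<in> carrier_mat n n"
  shows "trace_mat (cov n U A * B) + trace_mat (A * cov n U B) = d (trace_mat (A * B))"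
proof -
  let ?L = "b_mat n + U"
  have L: "?L \<in> carrier_mat n n" using U by simp
  have dA: "map_mat d A \<in> carrier_mat n n" and dB: "map_mat d B \<in> carrier_mat n n" using A B by auto
  have "d (trace_mat (A * B)) = trace_mat (map_mat d A * B) + trace_mat (A * map_mat d B)"
    using A B dA dB by (simp add: trace[of _ n] mat_mult[of _ n n _ n] trace_sq[of _ n])
  moreover have "cov n U A * B = map_mat d A * B + (?L * (A * B) - A * (?L * B))"
    "A * cov n U B = A * map_mat d B + (A * (?L * B) - A * (B * ?L))"
    unfolding cov_def commutator_def using A B L dA dB
    by (simp_all add: sq_simps(1,4,5)[of _ n] sq_simps(2,3)[OF dA] sq_simps(2,3)[OF dB] del: add_carrier_mat)
  moreover have "trace_mat (?L * (A * B)) = trace_mat (A * (B * ?L))"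
  proof -
    have "trace_mat (?L * (A * B)) = trace_mat ((A * B) * ?L)"
      using A B L by (intro trace_mult_commute[of _ n n]) auto
    then show ?thesis using A B L by (simp only: sq_simps(1)[of _ n])
  qed
  ultimately show ?thesis
    using A B L dA dB by (simp add: trace_sq[of _ n] del: add_carrier_mat)
qed

end

text \<open>Against a matrix supported in the last column above the corner, the trace sees only the
  last row before the corner. Hence pairings with such matrices depend on \<open>pi0\<close>
  alone.\<close>

lemma trace_strictly_upper_V:
  fixes A W :: "'a::comm_ring_1 mat"
  assumes A: "A \<in> carrier_mat n n" "\<And>k. k < n - 1 \<Longrightarrow> A $$ (n - 1, k) = 0"
    and W: "W \<in> carrier_mat n n" "\<And>k l. k < n \<Longrightarrow> l < n \<Longrightarrow> \<not> (k < n - 1 \<and> l = n - 1) \<Longrightarrow> W $$ (k, l) = 0"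
  shows "trace_mat (A * W) = 0" "trace_mat (W * A) = 0"
proof -
  have "(A * W) $$ (i, i) = 0" if i: "i < n" for i
  proof -
    have "A $$ (i, k) * W $$ (k, i) = 0" if "k < n" for k
      using A(2)[of k] W(2)[of k i] that i by (cases "k < n - 1 \<and> i = n - 1") auto
    then show ?thesis using sq_mult_entry[OF A(1) W(1) i i] by simp
  qed
  then show "trace_mat (A * W) = 0" using A(1) by (simp add: trace_mat_def)
  then show "trace_mat (W * A) = 0" using trace_mult_commute[OF A(1) W(1)] by simp
qed

lemma commutator_elem_mat_strictly_upper:
  fixes A :: "'a::comm_ring_1 mat"
  assumes A: "A \<in> carrier_mat n n" and n: "n > 0"
    and col: "\<And>r. r < n \<Longrightarrow> A $$ (r, 0) = 0" and row: "\<And>s. s < n \<Longrightarrow> A $$ (n - 1, s) = 0"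
  shows "commutator (elem_mat n 0 (n - 1)) A = 0\<^sub>m n n"
proof -
  let ?E = "elem_mat n 0 (n - 1) :: 'a mat"
  have E: "?E \<in> carrier_mat n n" by simp
  have "(?E * A) $$ (r, s) = 0" "(A * ?E) $$ (r, s) = 0" if rs: "r < n" "s < n" for r s
  proof -
    have "?E $$ (r, i) * A $$ (i, s) = 0" if "i < n" for i
      using rs that row by (simp add: elem_mat_def)
    then show "(?E * A) $$ (r, s) = 0" using sq_mult_entry[OF E A rs] by simp
    have "A $$ (r, i) * ?E $$ (i, s) = 0" if "i < n" for i
      using rs that col by (simp add: elem_mat_def)
    then show "(A * ?E) $$ (r, s) = 0" using sq_mult_entry[OF A E rs] by simp
  qed
  then show ?thesis
    unfolding commutator_def using A E by (auto intro!: eq_matI simp del: index_mult_mat(1))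
qed

section \<open>Matrices of smooth functions\<close>

lemma cder_add: "cder (f + g) = cder f + cder g"
proof (rule cfun_eqI)
  fix x
  have "(cval (f + g) has_real_derivative cval (cder f) x + cval (cder g) x) (at x)"
    using DERIV_add[OF cval_has_real_derivative[of f x] cval_has_real_derivative[of g x]]
    by (simp add: plus_cfun.rep_eq)
  then show "cval (cder (f + g)) x = cval (cder f + cder g) x"
    using DERIV_unique[OF cval_has_real_derivative] by fastforce
qed

lemma cder_mult: "cder (f * g) = cder f * g + f * cder g"
proof (rule cfun_eqI)
  fix x
  have *: "(cval (f * g) has_real_derivative cval (cder f) x * cval g x + cval (cder g) x * cval f x) (at x)"
    using DERIV_mult[OF cval_has_real_derivative[of f x] cval_has_real_derivative[of g x]]
    by (simp add: times_cfun.rep_eq)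
  then show "cval (cder (f * g)) x = cval (cder f * g + f * cder g) x"
    using DERIV_unique[OF cval_has_real_derivative *] by (simp add: mult.commute)
qed

interpretation cder: diff_ring cder
proof
  fix k :: nat assume "k > 0"
  then show "\<exists>y. of_nat k * y = (1 :: cfun)"
    by (intro exI[of _ "cconst (1 / real k)"] cfun_eqI) simp
qed (rule cder_add cder_mult)+

interpretation sdt: derivation sdt
proof
  fix f g
  show "sdt (f + g) = sdt f + sdt g"
  proof (rule sfun_eqI)
    fix t x
    show "sval (sdt (f + g)) (t, x) = sval (sdt f + sdt g) (t, x)"
      using DERIV_unique[OF sval_sdt[of "f + g" x t]] DERIV_add[OF sval_sdt[of f x t] sval_sdt[of g x t]] by simp
  qed
  show "sdt (f * g) = sdt f * g + f * sdt g"
  proof (rule sfun_eqI)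
    fix t x
    show "sval (sdt (f * g)) (t, x) = sval (sdt f * g + f * sdt g) (t, x)"
      using DERIV_unique[OF sval_sdt[of "f * g" x t]] DERIV_mult[OF sval_sdt[of f x t] sval_sdt[of g x t]]
      by (simp add: mult.commute)
  qed
qed

interpretation sdx: diff_ring sdx
proof
  fix f g
  show "sdx (f + g) = sdx f + sdx g"
  proof (rule sfun_eqI)
    fix t x
    show "sval (sdx (f + g)) (t, x) = sval (sdx f + sdx g) (t, x)"
      using DERIV_unique[OF sval_sdx[of "f + g" t x]] DERIV_add[OF sval_sdx[of f t x] sval_sdx[of g t x]] by simp
  qed
  show "sdx (f * g) = sdx f * g + f * sdx g"
  proof (rule sfun_eqI)
    fix t x
    show "sval (sdx (f * g)) (t, x) = sval (sdx f * g + f * sdx g) (t, x)"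
      using DERIV_unique[OF sval_sdx[of "f * g" t x]] DERIV_mult[OF sval_sdx[of f t x] sval_sdx[of g t x]]
      by (simp add: mult.commute)
  qed
  fix k :: nat assume "k > 0"
  then show "\<exists>y. of_nat k * y = (1 :: sfun)"
    by (intro exI[of _ "sconst (cconst (1 / real k))"] sfun_eqI) simp
qed

interpretation cval: comm_ring_hom "\<lambda>f. cval f x" for x
  by standard auto

interpretation sfreeze: comm_ring_hom "sfreeze t" for t
  by standard (auto intro!: cfun_eqI)

abbreviation ev :: "real \<Rightarrow> cfun fls \<Rightarrow> real fls" where
  "ev x \<equiv> fls_map (\<lambda>f. cval f x)"

abbreviation mat_at :: "cfun mat \<Rightarrow> real \<Rightarrow> real mat" where
  "mat_at A x \<equiv> map_mat (\<lambda>f. cval f x) A"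

interpretation ev: comm_ring_hom "ev x" for x
  by (rule comm_ring_hom_fls_map) (rule cval.comm_ring_hom_axioms)

lemma ev_nth [simp]: "fls_nth (ev x f) k = cval (fls_nth f k) x"
  by (rule fls_map_nth) simp

lemma ev_eqI: "(\<And>x. ev x f = ev x g) \<Longrightarrow> f = g"
  by (intro fls_eqI cfun_eqI) (metis ev_nth)

lemma mat_at_eqI:
  assumes "A \<in> carrier_mat n m" "B \<in> carrier_mat n m" "\<And>x. mat_at A x = mat_at B x"
  shows "A = B"
proof (rule eq_matI)
  fix i j assume "i < dim_row B" "j < dim_col B"
  moreover from this have "mat_at A x $$ (i, j) = mat_at B x $$ (i, j)" for x
    by (simp only: assms(3))
  ultimately show "A $$ (i, j) = B $$ (i, j)"
    using assms(1,2) by (intro cfun_eqI) simp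
qed (use assms in auto)

lemma map_ev_eqI:
  assumes "A \<in> carrier_mat n m" "B \<in> carrier_mat n m" "\<And>x. map_mat (ev x) A = map_mat (ev x) B"
  shows "A = B"
proof (rule eq_matI)
  fix i j assume "i < dim_row B" "j < dim_col B"
  moreover from this have "map_mat (ev x) A $$ (i, j) = map_mat (ev x) B $$ (i, j)" for x
    by (simp only: assms(3))
  ultimately show "A $$ (i, j) = B $$ (i, j)"
    using assms(1,2) by (intro ev_eqI) simp
qed (use assms in auto)

lemma smooth_maps_mat_at:
  assumes "A \<in> carrier_mat n n" "\<And>x. mat_at A x \<in> W"
  shows "mat_at A \<in> smooth_maps n W"
  using assms circle_smooth_cval by (auto simp: smooth_maps_def)

text \<open>Together with \<open>smooth_maps_mat_at\<close> this identifies smooth families with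
  matrices over \<open>cfun\<close>; a competitor in a definite description is lifted through it to
  the ring.\<close>

lemma ex_mat_at:
  assumes "A \<in> smooth_maps n W" "W \<subseteq> carrier_mat n n"
  obtains M where "M \<in> carrier_mat n n" "A = mat_at M"
proof
  show "mat n n (\<lambda>(i, j). Abs_cfun (\<lambda>x. A x $$ (i, j))) \<in> carrier_mat n n" by simp
  show "A = mat_at (mat n n (\<lambda>(i, j). Abs_cfun (\<lambda>x. A x $$ (i, j))))"
  proof
    fix x
    have "A x \<in> carrier_mat n n" using assms by (auto simp: smooth_maps_def)
    then show "A x = mat_at (mat n n (\<lambda>(i, j). Abs_cfun (\<lambda>x. A x $$ (i, j)))) x"
      using assms(1) by (auto intro!: eq_matI simp: smooth_maps_def cval_Abs_cfun)
  qed
qed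

lemma mat_deriv_mat_at: "A \<in> carrier_mat n n \<Longrightarrow> mat_deriv n (mat_at A) x = mat_at (map_mat cder A) x"
  by (rule eq_matI) (auto simp: mat_deriv_def cval_cder)

lemma map_mat_b_mat: "h 0 = 0 \<Longrightarrow> h 1 = 1 \<Longrightarrow> map_mat h (b_mat n) = b_mat n"
  by (rule eq_matI) (auto simp: b_mat_def)

lemma map_mat_elem_mat: "h 0 = 0 \<Longrightarrow> h 1 = 1 \<Longrightarrow> map_mat h (elem_mat n i j) = elem_mat n i j"
  by (rule eq_matI) (auto simp: elem_mat_def)

lemma (in comm_ring_hom) map_mat_add:
  assumes "A \<in> carrier_mat n m" "B \<in> carrier_mat n m"
  shows "map_mat hom (A + B) = map_mat hom A + map_mat hom B"
  using assms by (auto intro!: eq_matI simp: hom_add)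

lemma (in comm_ring_hom) map_mat_diff:
  assumes "A \<in> carrier_mat n m" "B \<in> carrier_mat n m"
  shows "map_mat hom (A - B) = map_mat hom A - map_mat hom B"
  using assms by (auto intro!: eq_matI simp: hom_minus)

lemma (in comm_ring_hom) map_mat_commutator:
  assumes "A \<in> carrier_mat n n" "B \<in> carrier_mat n n"
  shows "map_mat hom (commutator A B) = commutator (map_mat hom A) (map_mat hom B)"
  unfolding commutator_def using assms
  by (simp add: map_mat_diff[of _ n n] mat_hom_mult[of _ n n _ n])

lemma (in comm_ring_hom) hom_trace:
  "A \<in> carrier_mat n n \<Longrightarrow> hom (trace_mat A) = trace_mat (map_mat hom A)"
  by (simp add: trace_mat_def hom_distribs)

lemma cov_deriv_mat_at:
  assumes "U \<in> carrier_mat n n" "C \<in> carrier_mat n n"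
  shows "cov_deriv n (\<lambda>x. b_mat n + mat_at U x) (mat_at C) x = mat_at (cder.cov n U C) x"
proof -
  have "mat_at (b_mat n + U) x = b_mat n + mat_at U x"
    using assms cval.map_mat_add[of "b_mat n" n n U x] by (simp add: map_mat_b_mat)
  then show ?thesis
    unfolding cov_deriv_def cder.cov_def using assms
    by (simp add: cval.map_mat_add[of _ n n] cval.map_mat_commutator[of _ n] mat_deriv_mat_at)
qed

lemma mat_at_V_mats: "A \<in> carrier_mat n n \<Longrightarrow> (\<forall>x. mat_at A x \<in> V_mats n) \<longleftrightarrow> cder.V_shape n A"
  unfolding V_mats_def cder.V_shape_def
  by (auto intro!: cfun_eqI)

lemma mat_at_sl_mats: "A \<in> carrier_mat n n \<Longrightarrow> (\<forall>x. mat_at A x \<in> sl_mats n) \<longleftrightarrow> trace_mat A = 0"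
  unfolding sl_mats_def
  by (auto simp: cval.hom_trace[of A n, symmetric] intro!: cfun_eqI)

lemma pairing_mat_at:
  assumes "A \<in> carrier_mat n n" "B \<in> carrier_mat n n"
  shows "pairing n (mat_at A) (mat_at B) = integral {0..2 * pi} (cval (trace_mat (A * B)))"
proof -
  have "trace_mat (mat_at A x * mat_at B x) = cval (trace_mat (A * B)) x" for x
    using assms by (simp add: cval.hom_trace[of _ n] cval.mat_hom_mult[of _ n n _ n])
  then show ?thesis by (simp add: pairing_def)
qed

lemma subset_carrier: "sl_mats n \<subseteq> carrier_mat n n" "V_mats n \<subseteq> carrier_mat n n"
  "Vt_mats n \<subseteq> carrier_mat n n" "strictly_upper_mats n \<subseteq> carrier_mat n n"
  by (auto simp: sl_mats_def V_mats_def Vt_mats_def strictly_upper_mats_def)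

lemma pi0_mat_at_eq_iff:
  assumes "C \<in> carrier_mat n n" "D \<in> carrier_mat n n"
  shows "(\<forall>x. pi0 n (mat_at C x) = pi0 n (mat_at D x)) \<longleftrightarrow> (\<forall>k<n - 1. C $$ (n - 1, k) = D $$ (n - 1, k))"
proof
  assume *: "\<forall>x. pi0 n (mat_at C x) = pi0 n (mat_at D x)"
  show "\<forall>k<n - 1. C $$ (n - 1, k) = D $$ (n - 1, k)"
  proof (intro allI impI cfun_eqI)
    fix k x assume "k < n - 1"
    then show "cval (C $$ (n - 1, k)) x = cval (D $$ (n - 1, k)) x"
      using arg_cong[OF spec[OF *, of x], of "\<lambda>M. M $$ (n - 1, k)"] assms by (simp add: pi0_def)
  qed
qed (use assms in \<open>auto simp: pi0_def intro!: eq_matI\<close>)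

text \<open>The argument is presented as \<open>pi0\<close> of a full matrix \<open>D\<close>,
  because in the applications it is the last row of a coefficient of \<open>Y^j\<close> or of a
  lifted test map.\<close>

lemma P_op_eq:
  assumes n: "n \<ge> 2" and U: "cder.V_shape n U"
    and C: "C \<in> carrier_mat n n" "trace_mat C = 0" "cder.V_shape n (cder.cov n U C)"
    and D: "D \<in> carrier_mat n n" "\<And>k. k < n - 1 \<Longrightarrow> C $$ (n - 1, k) = D $$ (n - 1, k)"
  shows "P_op n (mat_at U) (\<lambda>x. pi0 n (mat_at D x)) = mat_at C"
  unfolding P_op_def
proof (rule the_equality)
  have U': "U \<in> carrier_mat n n" using U by (rule cder.V_shape_carrier)
  have 1: "cov_deriv n (\<lambda>x. b_mat n + mat_at U x) (mat_at C) = mat_at (cder.cov n U C)" if "C \<in> carrier_mat n n" for C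
    using cov_deriv_mat_at[OF U' that] by blast
  show "mat_at C \<in> smooth_maps n (sl_mats n) \<and> (\<forall>x. pi0 n (mat_at C x) = pi0 n (mat_at D x)) \<and>
      cov_deriv n (\<lambda>x. b_mat n + mat_at U x) (mat_at C) \<in> smooth_maps n (V_mats n)"
    unfolding 1[OF C(1)] pi0_mat_at_eq_iff[OF C(1) D(1)]
    using C D U' mat_at_sl_mats[OF C(1)] mat_at_V_mats[of "cder.cov n U C" n]
    by (auto intro!: smooth_maps_mat_at)
  fix A
  assume A: "A \<in> smooth_maps n (sl_mats n) \<and> (\<forall>x. pi0 n (A x) = pi0 n (mat_at D x)) \<and>
      cov_deriv n (\<lambda>x. b_mat n + mat_at U x) A \<in> smooth_maps n (V_mats n)"
  then obtain C' where C': "C' \<in> carrier_mat n n" "A = mat_at C'"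
    using ex_mat_at[of A n "sl_mats n"] subset_carrier by auto
  have "trace_mat C' = 0"
    using A C' mat_at_sl_mats[OF C'(1)] by (auto simp: smooth_maps_def)
  moreover have "\<forall>k<n - 1. C' $$ (n - 1, k) = D $$ (n - 1, k)"
    using A C' pi0_mat_at_eq_iff[OF C'(1) D(1)] by auto
  moreover have "cder.V_shape n (cder.cov n U C')"
    using A mat_at_V_mats[of "cder.cov n U C'" n] C'(1) U'
    unfolding C'(2) 1[OF C'(1)] by (auto simp: smooth_maps_def)
  ultimately have "C' = C"
    using C C' D by (intro cder.P_unique[OF n U]) auto
  then show "A = mat_at C" using C' by simp
qed

section \<open>The series \<open>Y\<close> and the functions \<open>f\<^sub>i\<close>\<close>

text \<open>The bound \<open>N\<close> is uniform in \<open>x\<close>; only then do the coefficient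
  functions form one Laurent series over \<open>cfun\<close>.\<close>

lemma ex_series_mat:
  fixes A :: "real \<Rightarrow> real fls mat"
  assumes A: "\<And>x. A x \<in> carrier_mat n n"
    and low: "\<And>x k i j. k < N \<Longrightarrow> i < n \<Longrightarrow> j < n \<Longrightarrow> fls_nth (A x $$ (i, j)) k = 0"
    and smooth: "\<And>k i j. i < n \<Longrightarrow> j < n \<Longrightarrow> circle_smooth (\<lambda>x. fls_nth (A x $$ (i, j)) k)"
  obtains M where "M \<in> carrier_mat n n" "\<And>x. map_mat (ev x) M = A x"
    "\<And>i j k x. i < n \<Longrightarrow> j < n \<Longrightarrow> cval (fls_nth (M $$ (i, j)) k) x = fls_nth (A x $$ (i, j)) k"
proof -
  define c where "c i j k = Abs_cfun (\<lambda>x. fls_nth (A x $$ (i, j)) k)" for i j k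
  define M where "M = mat n n (\<lambda>(i, j). Abs_fls (c i j))"
  have nth: "fls_nth (Abs_fls (c i j)) k = c i j k" if "i < n" "j < n" for i j k
  proof (rule nth_Abs_fls_lower_bound)
    show "\<forall>k<N. c i j k = 0" using that low by (auto simp: c_def zero_cfun_def)
  qed
  have c: "cval (c i j k) x = fls_nth (A x $$ (i, j)) k" if "i < n" "j < n" for i j k x
    using smooth[OF that] by (simp add: c_def cval_Abs_cfun)
  show ?thesis
  proof (rule that)
    show "M \<in> carrier_mat n n" by (simp add: M_def)
    show "map_mat (ev x) M = A x" for x
      by (rule eq_matI) (use A[of x] in \<open>auto simp: M_def nth c intro!: fls_eqI\<close>)
    show "cval (fls_nth (M $$ (i, j)) k) x = fls_nth (A x $$ (i, j)) k" if "i < n" "j < n" for i j k x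
      using that by (simp add: M_def nth c)
  qed
qed

lemma series_deriv_map_ev:
  assumes "M \<in> carrier_mat n n"
  shows "series_deriv n (\<lambda>x. map_mat (ev x) M) x = map_mat (ev x) (map_mat (fls_map cder) M)"
proof (rule eq_matI)
  fix i j
  assume "i < dim_row (map_mat (ev x) (map_mat (fls_map cder) M))"
    "j < dim_col (map_mat (ev x) (map_mat (fls_map cder) M))"
  then have ij: "i < n" "j < n" using assms by auto
  have "(\<lambda>k. deriv (\<lambda>y. fls_nth (map_mat (ev y) M $$ (i, j)) k) x)
      = (\<lambda>k. cval (fls_nth (fls_map cder (M $$ (i, j))) k) x)"
    using ij assms by (auto simp: fls_map_nth cval_cder)
  then show "series_deriv n (\<lambda>x. map_mat (ev x) M) x $$ (i, j)
      = map_mat (ev x) (map_mat (fls_map cder) M) $$ (i, j)"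
    using ij assms by (simp add: series_deriv_def fls_map_def[of "\<lambda>f. cval f x"])
qed (use assms in \<open>auto simp: series_deriv_def\<close>)

lemma J_mat_eq: "n \<ge> 2 \<Longrightarrow> J_mat n = mult_mat n Z"
  by (simp add: J_mat_def mult_mat_Z)

lemma ev_Z [simp]: "ev x Z = Z"
  by (rule fls_eqI) simp

lemma J_plus_mat_at:
  assumes "n \<ge> 2" "cder.V_shape n U"
  shows "J_plus n (mat_at U) x = map_mat (ev x) (cder.JU n U)"
proof -
  have U: "U \<in> carrier_mat n n" using assms(2) by (rule cder.V_shape_carrier)
  have "map_mat fls_const (mat_at U x) = map_mat (ev x) (map_mat fls_const U)"
    by (rule eq_matI) (auto intro!: fls_eqI)
  moreover have "map_mat (ev x) (mult_mat n Z) = mult_mat n Z"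
    by (simp add: mult_mat_map[symmetric])
  ultimately show ?thesis
    using U assms by (simp add: J_plus_def J_mat_eq cder.JU_def ev.map_mat_add[of _ n n])
qed

lemma lam_coeff_map_ev: "lam_coeff i (map_mat (ev x) M) = mat_at (map_mat (\<lambda>f. fls_nth f (- i)) M) x"
  by (rule eq_matI) (auto simp: lam_coeff_def)

lemma lam_coeff_entry:
  "A \<in> carrier_mat n n \<Longrightarrow> i < n \<Longrightarrow> j < n \<Longrightarrow> lam_coeff m A $$ (i, j) = fls_nth (A $$ (i, j)) (- m)"
  by (simp add: lam_coeff_def)

text \<open>A competitor is lifted to a matrix of series over \<open>cfun\<close>, where
  \<open>dressed_Z_unique\<close> applies.\<close>

lemma Y_series_eq:
  assumes n: "n \<ge> 2" and dr: "cder.dressing n U h T S"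
  shows "Y_series n (mat_at U) = (\<lambda>x. map_mat (ev x) (cder.dressed n T S Z))"
  unfolding Y_series_def
proof (rule the_equality)
  have U: "cder.V_shape n U" using dr by (simp add: cder.dressing_def)
  note J = cder.JU_carrier[OF U]
  define Y where "Y = cder.dressed n T S Z"
  have Y: "Y \<in> carrier_mat n n" unfolding Y_def by (rule cder.dressed_carrier[OF dr])
  have lead: "deg_le 0 (Y $$ (r, s) - (if r = 0 \<and> s = n - 1 then Z else 0))" if "r < n" "s < n" for r s
    unfolding Y_def using that by (rule cder.dressed_Z_leading[OF n dr])
  have nth: "fls_nth (Y $$ (r, s)) k = (if r = 0 \<and> s = n - 1 \<and> k = - 1 then 1 else 0)" if "r < n" "s < n" "k < 0" for r s k
    using deg_leD[OF lead[OF that(1,2)], of k] that(3) by (auto split: if_splits)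
  have ode: "map_mat (fls_map cder) Y = Y * cder.JU n U - cder.JU n U * Y"
    unfolding Y_def by (rule cder.dressed_ode[OF dr]) (auto intro!: fls_eqI simp: fls_map_nth)
  \<comment> \<open>The trace reads the coefficient of \<open>z\<close> at index \<open>n k\<close>,
    and \<open>n k = - 1\<close> has no solution with \<open>k \<ge> 0\<close>.\<close>
  have trace: "fls_nth (trace_mat Y) k = 0" if "k \<ge> 0" for k
  proof -
    have "int n * k \<noteq> - 1" using that by (smt (verit) mult_nonneg_nonneg of_nat_0_le_iff)
    then show ?thesis
      unfolding Y_def cder.trace_dressed[OF dr] trace_mult_mat_nth by simp
  qed
  show "(\<forall>x. map_mat (ev x) (cder.dressed n T S Z) \<in> carrier_mat n n) \<and>
     (\<forall>i>1. \<forall>x. lam_coeff i (map_mat (ev x) (cder.dressed n T S Z)) = 0\<^sub>m n n) \<and>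
     (\<forall>x. lam_coeff 1 (map_mat (ev x) (cder.dressed n T S Z)) = elem_mat n 0 (n - 1)) \<and>
     (\<forall>i\<le>0. (\<lambda>x. lam_coeff i (map_mat (ev x) (cder.dressed n T S Z))) \<in> smooth_maps n (sl_mats n)) \<and>
     (\<forall>x. series_deriv n (\<lambda>x. map_mat (ev x) (cder.dressed n T S Z)) x
        + commutator (J_plus n (mat_at U) x) (map_mat (ev x) (cder.dressed n T S Z)) = 0\<^sub>m n n) \<and>
     (\<forall>x. map_mat (ev x) (cder.dressed n T S Z) ^\<^sub>m n = fls_X_inv \<cdot>\<^sub>m 1\<^sub>m n)"
    unfolding Y_def[symmetric]
  proof (intro conjI allI impI)
    show "map_mat (ev x) Y \<in> carrier_mat n n" for x using Y by simp
    show "lam_coeff i (map_mat (ev x) Y) = 0\<^sub>m n n" if "i > 1" for i x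
      by (rule eq_matI) (use Y that nth in \<open>auto simp: lam_coeff_def\<close>)
    show "lam_coeff 1 (map_mat (ev x) Y) = elem_mat n 0 (n - 1)" for x
      by (rule eq_matI) (use Y nth in \<open>auto simp: lam_coeff_def elem_mat_def\<close>)
    show "(\<lambda>x. lam_coeff i (map_mat (ev x) Y)) \<in> smooth_maps n (sl_mats n)" if i: "i \<le> 0" for i
    proof -
      let ?M = "map_mat (\<lambda>f. fls_nth f (- i)) Y"
      have M: "?M \<in> carrier_mat n n" using Y by simp
      have "trace_mat ?M = fls_nth (trace_mat Y) (- i)" using Y by (simp add: trace_mat_def fls_nth_sum)
      then have "trace_mat ?M = 0" using trace i by simp
      then show ?thesis
        unfolding lam_coeff_map_ev using mat_at_sl_mats[OF M] by (intro smooth_maps_mat_at M) blast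
    qed
    show "series_deriv n (\<lambda>x. map_mat (ev x) Y) x + commutator (J_plus n (mat_at U) x) (map_mat (ev x) Y) = 0\<^sub>m n n" for x
    proof -
      have "series_deriv n (\<lambda>x. map_mat (ev x) Y) x + commutator (J_plus n (mat_at U) x) (map_mat (ev x) Y)
          = map_mat (ev x) ((Y * cder.JU n U - cder.JU n U * Y) + commutator (cder.JU n U) Y)"
        unfolding series_deriv_map_ev[OF Y] J_plus_mat_at[OF n U] ode[symmetric]
        using Y J by (simp add: ev.map_mat_add[of _ n n] ev.map_mat_commutator[of _ n])
      also have "(Y * cder.JU n U - cder.JU n U * Y) + commutator (cder.JU n U) Y = 0\<^sub>m n n"
        unfolding commutator_def using Y J by (auto intro!: eq_matI simp del: index_mult_mat(1))
      finally show ?thesis by (simp add: ev.hom_zero) (auto intro!: eq_matI)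
    qed
    show "map_mat (ev x) Y ^\<^sub>m n = fls_X_inv \<cdot>\<^sub>m 1\<^sub>m n" for x
    proof -
      have "Y ^\<^sub>m n = Z \<cdot>\<^sub>m 1\<^sub>m n"
        unfolding Y_def cder.dressed_power[OF dr]
        using cder.dressed_Z_power_n[OF dr, of 1] cder.dressed_1[OF dr] by simp
      then have "map_mat (ev x) Y ^\<^sub>m n = map_mat (ev x) (Z \<cdot>\<^sub>m 1\<^sub>m n)"
        using ev.mat_hom_pow[OF Y, of x n] by simp
      also have "\<dots> = fls_X_inv \<cdot>\<^sub>m 1\<^sub>m n" by (rule eq_matI) (auto simp: ev.hom_mult)
      finally show ?thesis .
    qed
  qed
  fix Y'
  assume Y': "(\<forall>x. Y' x \<in> carrier_mat n n) \<and>
     (\<forall>i>1. \<forall>x. lam_coeff i (Y' x) = 0\<^sub>m n n) \<and>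
     (\<forall>x. lam_coeff 1 (Y' x) = elem_mat n 0 (n - 1)) \<and>
     (\<forall>i\<le>0. (\<lambda>x. lam_coeff i (Y' x)) \<in> smooth_maps n (sl_mats n)) \<and>
     (\<forall>x. series_deriv n Y' x + commutator (J_plus n (mat_at U) x) (Y' x) = 0\<^sub>m n n) \<and>
     (\<forall>x. Y' x ^\<^sub>m n = fls_X_inv \<cdot>\<^sub>m 1\<^sub>m n)"
  then have c: "Y' x \<in> carrier_mat n n" for x by blast
  \<comment> \<open>The positive powers of \<open>lambda\<close> are prescribed, which gives both
    the uniform lower bound for the lift and the leading term for uniqueness.\<close>
  have nth': "fls_nth (Y' x $$ (r, s)) k = (if r = 0 \<and> s = n - 1 \<and> k = - 1 then 1 else 0)"
    if rs: "r < n" "s < n" and k: "k < 0" for r s k x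
  proof (cases "k = - 1")
    case True
    have "lam_coeff 1 (Y' x) $$ (r, s) = fls_nth (Y' x $$ (r, s)) (- 1)" by (rule lam_coeff_entry[OF c rs])
    then show ?thesis using Y' rs True by (simp add: elem_mat_def)
  next
    case False
    have "lam_coeff (- k) (Y' x) $$ (r, s) = fls_nth (Y' x $$ (r, s)) (- (- k))" by (rule lam_coeff_entry[OF c rs])
    moreover have "lam_coeff (- k) (Y' x) = 0\<^sub>m n n" using Y' False k by auto
    ultimately show ?thesis using rs False by simp
  qed
  have smooth: "circle_smooth (\<lambda>x. fls_nth (Y' x $$ (r, s)) k)" if rs: "r < n" "s < n" for r s k
  proof (cases "k < 0")
    case True
    then show ?thesis using nth'[OF rs True] circle_smooth_cval[of "cconst _"]
      by (simp add: circle_smooth_def smooth_on_const)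
  next
    case False
    then have "(\<lambda>x. lam_coeff (- k) (Y' x)) \<in> smooth_maps n (sl_mats n)" using Y' by auto
    then have "circle_smooth (\<lambda>x. lam_coeff (- k) (Y' x) $$ (r, s))" using rs by (simp add: smooth_maps_def)
    then show ?thesis using lam_coeff_entry[OF c rs, of "- k"] by simp
  qed
  obtain M where M: "M \<in> carrier_mat n n" "\<And>x. map_mat (ev x) M = Y' x"
    "\<And>i j k x. i < n \<Longrightarrow> j < n \<Longrightarrow> cval (fls_nth (M $$ (i, j)) k) x = fls_nth (Y' x $$ (i, j)) k"
    by (rule ex_series_mat[of Y' n "- 1"]) (use c nth' smooth in auto)
  have "M = cder.dressed n T S Z"
  proof (rule cder.dressed_Z_unique[OF n dr M(1)])
    have "map_mat (fls_map cder) M + commutator (cder.JU n U) M = 0\<^sub>m n n"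
    proof (rule map_ev_eqI[of _ n n])
      fix x
      have "map_mat (ev x) (map_mat (fls_map cder) M + commutator (cder.JU n U) M)
        = series_deriv n Y' x + commutator (J_plus n (mat_at U) x) (Y' x)"
        using series_deriv_map_ev[OF M(1), of x] M J
        by (simp add: J_plus_mat_at[OF n U] ev.map_mat_add[of _ n n] ev.map_mat_commutator[of _ n])
      then show "map_mat (ev x) (map_mat (fls_map cder) M + commutator (cder.JU n U) M) = map_mat (ev x) (0\<^sub>m n n)"
        using Y' by (auto intro!: eq_matI)
    qed (use M J in auto)
    then have "map_mat (fls_map cder) M + (cder.JU n U * M - M * cder.JU n U) = 0\<^sub>m n n"
      by (simp add: commutator_def)
    then show "map_mat (fls_map cder) M = M * cder.JU n U - cder.JU n U * M"
      by (rule sq_eq_diff_if_add_eq_0[rotated 3]) (use M J in auto)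
    show "M ^\<^sub>m n = Z \<cdot>\<^sub>m 1\<^sub>m n"
    proof (rule map_ev_eqI[of _ n n])
      fix x
      have "map_mat (ev x) (M ^\<^sub>m n) = fls_X_inv \<cdot>\<^sub>m 1\<^sub>m n"
        using ev.mat_hom_pow[OF M(1), of x n] M(2) Y' by simp
      also have "\<dots> = map_mat (ev x) (Z \<cdot>\<^sub>m 1\<^sub>m n)" by (rule eq_matI) (auto simp: ev.hom_mult)
      finally show "map_mat (ev x) (M ^\<^sub>m n) = map_mat (ev x) (Z \<cdot>\<^sub>m 1\<^sub>m n)" .
    qed (use M in auto)
    show "deg_le 0 (M $$ (r, s) - (if r = 0 \<and> s = n - 1 then Z else 0))" if "r < n" "s < n" for r s
      unfolding deg_le_def
    proof (intro allI impI cfun_eqI)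
      fix k x assume "k < - (0 :: int)"
      then show "cval (fls_nth (M $$ (r, s) - (if r = 0 \<and> s = n - 1 then Z else 0)) k) x = cval 0 x"
        using M(3)[OF that, of k x] nth'[OF that, of k x] by auto
    qed
  qed
  then show "Y' = (\<lambda>x. map_mat (ev x) (cder.dressed n T S Z))" using M(2) by auto
qed

section \<open>Adic convergence and the coefficients \<open>f_i\<close>\<close>

lemma inverse_mat_eq:
  fixes A :: "'a::comm_ring_1 mat"
  assumes A: "A \<in> carrier_mat n n" "B \<in> carrier_mat n n" "A * B = 1\<^sub>m n" "B * A = 1\<^sub>m n"
  shows "inverse_mat n A = B"
  unfolding inverse_mat_def
proof (rule the_equality)
  show "B \<in> carrier_mat n n \<and> inverts_mat A B \<and> inverts_mat B A"
    using assms by (auto simp: inverts_mat_def)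
  fix C assume C: "C \<in> carrier_mat n n \<and> inverts_mat A C \<and> inverts_mat C A"
  then have C': "C \<in> carrier_mat n n" "C * A = 1\<^sub>m n" by (auto simp: inverts_mat_def)
  have "C = C * (A * B)" using C' A by (simp add: sq_units[of _ n])
  also have "\<dots> = C * A * B" by (rule sq_simps(1)[OF C'(1) A(1,2), symmetric])
  also have "\<dots> = B" by (simp only: C' sq_units(1)[OF A(2)])
  finally show "C = B" .
qed

lemma fls_tendstoI:
  fixes f :: "nat \<Rightarrow> 'a::group_add fls"
  assumes "\<And>m. eventually (\<lambda>N. \<forall>k<int m. fls_nth (f N) k = fls_nth g k) sequentially"
  shows "f \<longlonglongrightarrow> g"
proof (rule tendstoI)
  fix e :: real assume "e > 0"
  then obtain m where m: "inverse (2 ^ m) < e"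
    using real_arch_pow_inv[of e "1 / 2"] by (auto simp: power_one_over inverse_eq_divide)
  show "\<forall>\<^sub>F N in sequentially. dist (f N) g < e"
    using assms[of m]
  proof eventually_elim
    case (elim N)
    show ?case
    proof (cases "f N = g")
      case False
      then have "int m \<le> fls_subdegree (f N - g)"
        using elim by (intro fls_subdegree_geI) auto
      then have "dist (f N) g \<le> inverse (2 ^ m)"
        using False by (auto simp: dist_fls_def intro!: le_imp_inverse_le power_increasing)
      then show ?thesis using m by simp
    qed (use \<open>e > 0\<close> in simp)
  qed
qed

text \<open>Each coefficient of an entry receives a contribution from a single power
  \<open>z^-i\<close>, so the partial sums become stationary.\<close>

lemma sums_mult_mat:
  fixes F :: "'a::comm_ring_1 fls"
  assumes F: "deg_le 0 F" and kl: "k < n" "l < n"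
  shows "(\<lambda>i. fls_const (fls_nth F (int i)) * mult_mat n (fls_X ^ i) $$ (k, l)) sums (mult_mat n F $$ (k, l))"
  unfolding sums_def
proof (rule fls_tendstoI)
  fix m :: nat
  have nth: "fls_nth (\<Sum>i<N. fls_const (fls_nth F (int i)) * mult_mat n (fls_X ^ i) $$ (k, l)) q
      = (\<Sum>i<N. if int n * q - int k + int l = int i then fls_nth F (int i) else 0)" for N q
    unfolding fls_nth_sum by (rule sum.cong) (use kl in \<open>auto simp: mult_mat_nth\<close>)
  show "\<forall>\<^sub>F N in sequentially. \<forall>q<int m. fls_nth (\<Sum>i<N. fls_const (fls_nth F (int i)) * mult_mat n (fls_X ^ i) $$ (k, l)) q
      = fls_nth (mult_mat n F $$ (k, l)) q"
  proof (rule eventually_sequentiallyI[of "n * m + n"], intro allI impI)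
    fix N q assume N: "n * m + n \<le> N" and q: "q < int m"
    \<comment> \<open>The only summation index that can contribute at \<open>q\<close>; it lies
      below \<open>n m + n\<close> because \<open>q < m\<close> and \<open>l < n\<close>.\<close>
    define j where "j = int n * q - int k + int l"
    have "int n * q \<le> int n * int m" using q by (intro mult_left_mono) auto
    then have j: "j < int N" using N kl by (auto simp: j_def simp flip: of_nat_mult)
    show "fls_nth (\<Sum>i<N. fls_const (fls_nth F (int i)) * mult_mat n (fls_X ^ i) $$ (k, l)) q
      = fls_nth (mult_mat n F $$ (k, l)) q"
    proof (cases "j < 0")
      case True
      then show ?thesis
        unfolding nth using kl deg_leD[OF F, of j] by (auto simp: mult_mat_nth j_def intro!: sum.neutral)
    next
      case False
      have "(\<Sum>i<N. if int n * q - int k + int l = int i then fls_nth F (int i) else 0)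
          = (\<Sum>i<N. if i = nat j then fls_nth F (int i) else 0)"
        using False by (intro sum.cong) (auto simp: j_def[symmetric])
      also have "\<dots> = fls_nth F j" using False j by (subst sum.delta) auto
      finally show ?thesis unfolding nth using kl by (simp add: mult_mat_nth j_def)
    qed
  qed
qed

lemma gauge_map_ev:
  assumes n: "n \<ge> 2" and U: "cder.V_shape n U"
    and TS: "T \<in> carrier_mat n n" "S \<in> carrier_mat n n" "T * S = 1\<^sub>m n" "S * T = 1\<^sub>m n"
  shows "gauge n (\<lambda>x. map_mat (ev x) T) (J_plus n (mat_at U)) x
    = map_mat (ev x) (T * cder.JU n U * S - map_mat (fls_map cder) T * S)"
proof -
  note J = cder.JU_carrier[OF U]
  have "inverse_mat n (map_mat (ev x) T) = map_mat (ev x) S"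
    using TS ev.mat_hom_mult[OF TS(1,2), of x] ev.mat_hom_mult[OF TS(2,1), of x]
    by (intro inverse_mat_eq) (auto simp: ev.mat_hom_one)
  then show ?thesis
    unfolding gauge_def series_deriv_map_ev[OF TS(1)] J_plus_mat_at[OF n U]
    using TS(1,2) J by (simp add: ev.map_mat_diff[of _ n n] ev.mat_hom_mult[of _ n n _ n])
qed

lemma inverse_J_mat:
  assumes "n \<ge> 2"
  shows "inverse_mat n (J_mat n) ^\<^sub>m i = mult_mat n (fls_X ^ i)"
proof -
  have "inverse_mat n (J_mat n) = mult_mat n fls_X"
    unfolding J_mat_eq[OF assms]
    by (rule inverse_mat_eq) (simp_all add: mult_mat_mult[symmetric] mult_mat_1 fls_X_inv_times_conv_shift fls_X_times_conv_shift)
  then show ?thesis by (simp add: mult_mat_power)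
qed

text \<open>The gauge transform by \<open>T\<close> is multiplication by \<open>h\<close>, so the
  \<open>f_i\<close> are the coefficients of \<open>h - z\<close>. A competing \<open>f\<close> is
  packed into a series \<open>F\<close>, and \<open>gauge_unique\<close> yields
  \<open>z + F = h\<close>.\<close>

lemma f_coeffs_eq:
  assumes n: "n \<ge> 2" and dr: "cder.dressing n U h T S"
  shows "f_coeffs n (mat_at U) = (\<lambda>i. cval (fls_nth (h - Z) (int i)))"
  unfolding f_coeffs_def
proof (rule the_equality)
  have U: "cder.V_shape n U" and h: "deg_le 0 (h - Z)"
    and deg: "\<And>r s. r < n \<Longrightarrow> s < n \<Longrightarrow> deg_le 0 (T $$ (r, s))"
    and diag: "\<And>r. r < n \<Longrightarrow> fls_nth (T $$ (r, r)) 0 = 1"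
    and upper: "\<And>r s. r < n \<Longrightarrow> s < r \<Longrightarrow> fls_nth (T $$ (r, s)) 0 = 0"
    and col: "\<And>r. r < n \<Longrightarrow> T $$ (r, 0) = (if r = 0 then 1 else 0)"
    and ode: "map_mat (fls_map cder) T = T * cder.JU n U - mult_mat n h * T"
    using dr by (auto simp: cder.dressing_def)
  note TS = cder.dressing_sq[OF dr]
  have g: "gauge n (\<lambda>x. map_mat (ev x) T) (J_plus n (mat_at U)) x - J_mat n = mult_mat n (ev x (h - Z))" for x
  proof -
    have "T * cder.JU n U * S - map_mat (fls_map cder) T * S = T * (cder.JU n U * S) - (T * (cder.JU n U * S) - mult_mat n h)"
      unfolding ode using TS by (simp add: sq_simps[of _ n] sq_units[of _ n])
    also have "\<dots> = mult_mat n h"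
      using TS by (auto intro!: eq_matI simp del: index_mult_mat(1))
    finally have "gauge n (\<lambda>x. map_mat (ev x) T) (J_plus n (mat_at U)) x = mult_mat n (ev x h)"
      unfolding gauge_map_ev[OF n U TS(1,2,6,7)] by (simp add: mult_mat_map)
    then show ?thesis
      by (simp add: J_mat_eq[OF n] mult_mat_diff[symmetric] ev.hom_minus)
  qed
  show "(\<forall>i. circle_smooth (cval (fls_nth (h - Z) (int i)))) \<and>
     (\<exists>T. (\<forall>x. T x \<in> carrier_mat n n) \<and>
        (\<forall>i>0. \<forall>x. lam_coeff i (T x) = 0\<^sub>m n n) \<and>
        (\<forall>i\<le>0. (\<lambda>x. lam_coeff i (T x)) \<in> smooth_maps n (carrier_mat n n)) \<and>
        (\<forall>x. upper_triangular (lam_coeff 0 (T x)) \<and> (\<forall>k<n. lam_coeff 0 (T x) $$ (k, k) = 1)) \<and>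
        (\<forall>x. col (T x) 0 = unit_vec n 0) \<and>
        (\<forall>x. \<forall>k<n. \<forall>l<n.
           (\<lambda>i. fls_const (cval (fls_nth (h - Z) (int i)) x) * (inverse_mat n (J_mat n) ^\<^sub>m i) $$ (k, l)) sums
             ((gauge n T (J_plus n (mat_at U)) x - J_mat n) $$ (k, l))))"
  proof (intro conjI allI exI[of _ "\<lambda>x. map_mat (ev x) T"] impI)
    show "circle_smooth (cval (fls_nth (h - Z) (int i)))" for i by (rule circle_smooth_cval)
    show "map_mat (ev x) T \<in> carrier_mat n n" for x using TS by simp
    show "lam_coeff i (map_mat (ev x) T) = 0\<^sub>m n n" if "i > 0" for i x
      by (rule eq_matI) (use TS that deg_leD[OF deg] in \<open>auto simp: lam_coeff_def\<close>)
    show "(\<lambda>x. lam_coeff i (map_mat (ev x) T)) \<in> smooth_maps n (carrier_mat n n)" for i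
      unfolding lam_coeff_map_ev using TS by (intro smooth_maps_mat_at) auto
    show "upper_triangular (lam_coeff 0 (map_mat (ev x) T))" for x
      using TS upper by (auto simp: lam_coeff_def)
    show "lam_coeff 0 (map_mat (ev x) T) $$ (k, k) = 1" if "k < n" for x k
      using TS diag that by (auto simp: lam_coeff_def)
    show "col (map_mat (ev x) T) 0 = unit_vec n 0" for x
      by (rule eq_vecI) (use TS col n in \<open>auto simp: ev.hom_one\<close>)
    fix x k l assume "k < n" "l < n"
    moreover have "deg_le 0 (ev x (h - Z))" by (rule deg_le_map[OF _ h]) simp
    ultimately show "(\<lambda>i. fls_const (cval (fls_nth (h - Z) (int i)) x) * (inverse_mat n (J_mat n) ^\<^sub>m i) $$ (k, l)) sums
             ((gauge n (\<lambda>x. map_mat (ev x) T) (J_plus n (mat_at U)) x - J_mat n) $$ (k, l))"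
      unfolding g inverse_J_mat[OF n] using sums_mult_mat[of "ev x (h - Z)" k n l] by simp
  qed
  fix f
  assume *: "(\<forall>i. circle_smooth (f i)) \<and> (\<exists>T. (\<forall>x. T x \<in> carrier_mat n n) \<and>
        (\<forall>i>0. \<forall>x. lam_coeff i (T x) = 0\<^sub>m n n) \<and>
        (\<forall>i\<le>0. (\<lambda>x. lam_coeff i (T x)) \<in> smooth_maps n (carrier_mat n n)) \<and>
        (\<forall>x. upper_triangular (lam_coeff 0 (T x)) \<and> (\<forall>k<n. lam_coeff 0 (T x) $$ (k, k) = 1)) \<and>
        (\<forall>x. col (T x) 0 = unit_vec n 0) \<and>
        (\<forall>x. \<forall>k<n. \<forall>l<n.
           (\<lambda>i. fls_const (f i x) * (inverse_mat n (J_mat n) ^\<^sub>m i) $$ (k, l)) sums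
             ((gauge n T (J_plus n (mat_at U)) x - J_mat n) $$ (k, l))))"
  then have f: "\<And>i. circle_smooth (f i)" by blast
  from * obtain T' where T': "(\<forall>x. T' x \<in> carrier_mat n n) \<and>
        (\<forall>i>0. \<forall>x. lam_coeff i (T' x) = 0\<^sub>m n n) \<and>
        (\<forall>i\<le>0. (\<lambda>x. lam_coeff i (T' x)) \<in> smooth_maps n (carrier_mat n n)) \<and>
        (\<forall>x. upper_triangular (lam_coeff 0 (T' x)) \<and> (\<forall>k<n. lam_coeff 0 (T' x) $$ (k, k) = 1)) \<and>
        (\<forall>x. col (T' x) 0 = unit_vec n 0) \<and>
        (\<forall>x. \<forall>k<n. \<forall>l<n.
           (\<lambda>i. fls_const (f i x) * (inverse_mat n (J_mat n) ^\<^sub>m i) $$ (k, l)) sums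
             ((gauge n T' (J_plus n (mat_at U)) x - J_mat n) $$ (k, l)))"
    by (elim conjE exE) (rule that, intro conjI)
  have c: "\<And>x. T' x \<in> carrier_mat n n"
    and T'_pos: "\<And>i x. i > 0 \<Longrightarrow> lam_coeff i (T' x) = 0\<^sub>m n n"
    and T'_smooth: "\<And>i. i \<le> 0 \<Longrightarrow> (\<lambda>x. lam_coeff i (T' x)) \<in> smooth_maps n (carrier_mat n n)"
    and T'_upper: "\<And>x. upper_triangular (lam_coeff 0 (T' x))"
    and T'_diag: "\<And>x k. k < n \<Longrightarrow> lam_coeff 0 (T' x) $$ (k, k) = 1"
    and T'_col: "\<And>x. col (T' x) 0 = unit_vec n 0"
    and T'_sums: "\<And>x k l. k < n \<Longrightarrow> l < n \<Longrightarrow>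
           (\<lambda>i. fls_const (f i x) * (inverse_mat n (J_mat n) ^\<^sub>m i) $$ (k, l)) sums
             ((gauge n T' (J_plus n (mat_at U)) x - J_mat n) $$ (k, l))"
    using T' by simp_all
  have nth': "fls_nth (T' x $$ (r, s)) k = 0" if rs: "r < n" "s < n" and k: "k < 0" for r s k x
    using lam_coeff_entry[OF c rs, of "- k" x] T'_pos[of "- k" x] rs k by simp
  have smooth: "circle_smooth (\<lambda>x. fls_nth (T' x $$ (r, s)) k)" if rs: "r < n" "s < n" for r s k
  proof (cases "k < 0")
    case True
    then show ?thesis using nth'[OF rs True] by (simp add: circle_smooth_def smooth_on_const)
  next
    case False
    then have "circle_smooth (\<lambda>x. lam_coeff (- k) (T' x) $$ (r, s))"
      using rs T'_smooth[of "- k"] by (simp add: smooth_maps_def)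
    then show ?thesis using lam_coeff_entry[OF c rs, of "- k"] by simp
  qed
  obtain M where M: "M \<in> carrier_mat n n" "\<And>x. map_mat (ev x) M = T' x"
    "\<And>i j k x. i < n \<Longrightarrow> j < n \<Longrightarrow> cval (fls_nth (M $$ (i, j)) k) x = fls_nth (T' x $$ (i, j)) k"
    by (rule ex_series_mat[of T' n 0]) (use c nth' smooth in auto)
  have T': "T' = (\<lambda>x. map_mat (ev x) M)" using M(2) by auto
  have nth0: "fls_nth (T' x $$ (r, s)) 0 = lam_coeff 0 (T' x) $$ (r, s)" if "r < n" "s < n" for r s x
    using lam_coeff_entry[OF c that, of 0 x] by simp
  \<comment> \<open>\<open>gauge\<close> contains a definite description of an inverse, so an
    inverse of the competitor must be exhibited before its gauge transform can be computed.\<close>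
  obtain S' where S': "S' \<in> carrier_mat n n" "S' * M = 1\<^sub>m n" "M * S' = 1\<^sub>m n"
  proof (rule ex_inverse_unipotent_series[OF M(1)])
    show "deg_le 0 (M $$ (r, s))" if "r < n" "s < n" for r s
      unfolding deg_le_def by (intro allI impI cfun_eqI) (use that M(3) nth' in auto)
    show "fls_nth (M $$ (r, r)) 0 = 1" if "r < n" for r
      by (rule cfun_eqI) (use that M(3) nth0 T'_diag in auto)
    show "fls_nth (M $$ (r, s)) 0 = 0" if "s < r" "r < n" for r s
    proof (rule cfun_eqI)
      fix x
      have "lam_coeff 0 (T' x) $$ (r, s) = 0"
        using T'_upper[of x] that c[of x] by (auto simp: upper_triangular_def lam_coeff_def)
      then show "cval (fls_nth (M $$ (r, s)) 0) x = cval 0 x" using that M(3) nth0 by auto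
    qed
  qed blast
  define F where "F = Abs_fls (\<lambda>k. if k < 0 then 0 else Abs_cfun (f (nat k)))"
  have F_nth: "fls_nth F k = (if k < 0 then 0 else Abs_cfun (f (nat k)))" for k
    unfolding F_def by (rule nth_Abs_fls_lower_bound[of 0]) auto
  have F: "deg_le 0 F" by (simp add: deg_le_def F_nth)
  have f_F: "f i x = cval (fls_nth F (int i)) x" for i x
    using f by (simp add: F_nth cval_Abs_cfun)
  have gauge_F: "(gauge n T' (J_plus n (mat_at U)) x - J_mat n) $$ (k, l) = mult_mat n (ev x F) $$ (k, l)"
    if kl: "k < n" "l < n" for k l x
  proof (rule sums_unique2)
    show "(\<lambda>i. fls_const (f i x) * (inverse_mat n (J_mat n) ^\<^sub>m i) $$ (k, l)) sums
       ((gauge n T' (J_plus n (mat_at U)) x - J_mat n) $$ (k, l))" by (rule T'_sums[OF kl])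
    have "deg_le 0 (ev x F)" by (rule deg_le_map[OF _ F]) simp
    from sums_mult_mat[OF this kl]
    show "(\<lambda>i. fls_const (f i x) * (inverse_mat n (J_mat n) ^\<^sub>m i) $$ (k, l)) sums mult_mat n (ev x F) $$ (k, l)"
      by (simp add: inverse_J_mat[OF n] f_F)
  qed
  have "M * cder.JU n U * S' - map_mat (fls_map cder) M * S' = mult_mat n (Z + F)"
  proof (rule map_ev_eqI[of _ n n])
    fix x
    let ?G = "gauge n T' (J_plus n (mat_at U)) x"
    have G: "?G = map_mat (ev x) (M * cder.JU n U * S' - map_mat (fls_map cder) M * S')"
      unfolding T' by (rule gauge_map_ev[OF n U M(1) S'(1,3,2)])
    have "?G = mult_mat n (ev x (Z + F))"
    proof (rule eq_matI)
      fix k l assume "k < dim_row (mult_mat n (ev x (Z + F)))" "l < dim_col (mult_mat n (ev x (Z + F)))"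
      then have kl: "k < n" "l < n" by auto
      have "?G $$ (k, l) - mult_mat n Z $$ (k, l) = mult_mat n (ev x F) $$ (k, l)"
        using gauge_F[OF kl, of x] kl by (simp add: J_mat_eq[OF n])
      then show "?G $$ (k, l) = mult_mat n (ev x (Z + F)) $$ (k, l)"
        using kl by (simp add: ev.hom_add mult_mat_add algebra_simps)
    qed (use G M S' TS in auto)
    then show "map_mat (ev x) (M * cder.JU n U * S' - map_mat (fls_map cder) M * S') = map_mat (ev x) (mult_mat n (Z + F))"
      unfolding G by (simp add: mult_mat_map)
  qed (use M S' TS in auto)
  note MZ = this
  have "M * cder.JU n U - map_mat (fls_map cder) M = mult_mat n (Z + F) * M"
  proof -
    have "(M * cder.JU n U * S' - map_mat (fls_map cder) M * S') * M = M * cder.JU n U - map_mat (fls_map cder) M"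
      using M S' TS(3) by (simp add: sq_simps[of _ n] sq_units[of _ n])
    then show ?thesis using MZ by simp
  qed
  then have ode': "map_mat (fls_map cder) M = M * cder.JU n U - mult_mat n (Z + F) * M"
    by (intro sq_eq_diff_if_diff_eq[of _ n]) (use M TS(3) in auto)
  have "Z + F = h"
  proof (rule cder.gauge_unique[OF n U TS(1) ode col h M(1) ode'])
    show "M $$ (r, 0) = (if r = 0 then 1 else 0)" if "r < n" for r
    proof (rule ev_eqI)
      fix x
      have "T' x $$ (r, 0) = col (T' x) 0 $ r" using c[of x] that n by simp
      also have "\<dots> = (if r = 0 then 1 else 0)" unfolding T'_col using that by simp
      finally show "ev x (M $$ (r, 0)) = ev x (if r = 0 then 1 else 0)"
        using that n M(1) by (simp add: M(2)[symmetric] ev.hom_one)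
    qed
    show "deg_le 0 (Z + F - Z)" using F by simp
  qed auto
  then have "F = h - Z" by (simp add: algebra_simps)
  then show "f = (\<lambda>i. cval (fls_nth (h - Z) (int i)))" using f_F by auto
qed

section \<open>The gradient of \<open>H\<^sub>j\<close>\<close>

text \<open>All conditions on a dressing are equations, or vanishing conditions on coefficients, and
  are preserved by a homomorphism that intertwines the derivations. It is applied to
  \<open>sfreeze t\<close>.\<close>

lemma dressing_hom:
  assumes d: "diff_ring d" and e: "diff_ring e" and hom: "comm_ring_hom \<phi>"
    and comm: "\<And>a. \<phi> (d a) = e (\<phi> a)" and dr: "diff_ring.dressing d n U h T S"
  shows "diff_ring.dressing e n (map_mat \<phi> U) (fls_map \<phi> h) (map_mat (fls_map \<phi>) T) (map_mat (fls_map \<phi>) S)"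
proof -
  interpret d: diff_ring d by fact
  interpret e: diff_ring e by fact
  interpret \<phi>: comm_ring_hom \<phi> by fact
  interpret F: comm_ring_hom "fls_map \<phi>" by (rule comm_ring_hom_fls_map[OF hom])
  note TS = d.dressing_sq[OF dr]
  have U: "d.V_shape n U" and h: "deg_le 0 (h - Z)"
    and ode: "map_mat (fls_map d) T = T * d.JU n U - mult_mat n h * T"
    using dr by (auto simp: d.dressing_def)
  have Uc: "U \<in> carrier_mat n n" using U by (rule d.V_shape_carrier)
  have Z: "fls_map \<phi> Z = Z" by (rule fls_eqI) (simp add: fls_map_nth)
  have U': "e.V_shape n (map_mat \<phi> U)" using U by (auto simp: d.V_shape_def e.V_shape_def)
  have "map_mat (fls_map \<phi>) (map_mat fls_const U) = map_mat fls_const (map_mat \<phi> U)"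
    by (rule eq_matI) (auto intro!: fls_eqI simp: fls_map_nth)
  then have J: "map_mat (fls_map \<phi>) (d.JU n U) = e.JU n (map_mat \<phi> U)"
    unfolding d.JU_def e.JU_def using Uc by (simp add: F.map_mat_add[of _ n n] mult_mat_map[symmetric] Z)
  have "map_mat (fls_map e) (map_mat (fls_map \<phi>) T) = map_mat (fls_map \<phi>) (map_mat (fls_map d) T)"
    by (rule eq_matI) (auto intro!: fls_eqI simp: fls_map_nth comm)
  also have "\<dots> = map_mat (fls_map \<phi>) T * e.JU n (map_mat \<phi> U) - mult_mat n (fls_map \<phi> h) * map_mat (fls_map \<phi>) T"
    unfolding ode using TS by (simp add: F.map_mat_diff[of _ n n] F.mat_hom_mult[of _ n n _ n] J mult_mat_map)
  finally have ode': "map_mat (fls_map e) (map_mat (fls_map \<phi>) T)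
    = map_mat (fls_map \<phi>) T * e.JU n (map_mat \<phi> U) - mult_mat n (fls_map \<phi> h) * map_mat (fls_map \<phi>) T" .
  have "deg_le 0 (fls_map \<phi> h - Z)"
    using deg_le_map[of \<phi> 0 "h - Z", OF \<phi>.hom_zero h] by (simp add: F.hom_minus Z)
  moreover have "map_mat (fls_map \<phi>) T * map_mat (fls_map \<phi>) S = 1\<^sub>m n"
    "map_mat (fls_map \<phi>) S * map_mat (fls_map \<phi>) T = 1\<^sub>m n"
    using F.mat_hom_mult[OF TS(1,2)] F.mat_hom_mult[OF TS(2,1)] TS by (simp_all add: F.mat_hom_one)
  ultimately show ?thesis
    using U' ode' dr TS deg_le_map[of \<phi> 0] unfolding e.dressing_def d.dressing_def
    by (auto simp: fls_map_nth F.hom_one)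
qed

lemma ex_V_shape_mat_at: "A \<in> smooth_maps n (V_mats n) \<Longrightarrow> \<exists>U. cder.V_shape n U \<and> A = mat_at U"
proof -
  assume A: "A \<in> smooth_maps n (V_mats n)"
  then obtain U where U: "U \<in> carrier_mat n n" "A = mat_at U"
    using ex_mat_at[OF A subset_carrier(2)] by blast
  moreover have "cder.V_shape n U"
    using mat_at_V_mats[OF U(1)] A unfolding U(2) by (auto simp: smooth_maps_def)
  ultimately show ?thesis by blast
qed

definition Y_pow :: "nat \<Rightarrow> nat \<Rightarrow> int \<Rightarrow> cfun fls mat \<Rightarrow> cfun fls mat \<Rightarrow> cfun mat" where
  "Y_pow n j i T S = map_mat (\<lambda>f. fls_nth f (- i)) (cder.dressed n T S (Z ^ j))"

lemma Y_coeff_eq: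
  assumes n: "n \<ge> 2" and dr: "cder.dressing n U h T S"
  shows "Y_coeff n j i (mat_at U) = mat_at (Y_pow n j i T S)"
proof
  fix x
  show "Y_coeff n j i (mat_at U) x = mat_at (Y_pow n j i T S) x"
    unfolding Y_coeff_def Y_series_eq[OF n dr] Y_pow_def
      ev.mat_hom_pow[OF cder.dressed_carrier[OF dr], symmetric]
    by (simp only: cder.dressed_power[OF dr] lam_coeff_map_ev)
qed

lemma trace_V_pi0:
  fixes A V :: "real mat"
  assumes "A \<in> carrier_mat n n" "V \<in> V_mats n"
  shows "trace_mat (pi0 n A * V) = trace_mat (A * V)"
proof -
  have p: "pi0 n A \<in> carrier_mat n n" by (simp add: pi0_def)
  have V: "V \<in> carrier_mat n n" using assms(2) by (simp add: V_mats_def)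
  have "trace_mat ((A - pi0 n A) * V) = 0"
    by (rule trace_strictly_upper_V[of _ n]) (use assms p in \<open>auto simp: V_mats_def pi0_def\<close>)
  then show ?thesis using assms p V by (simp add: sq_simps(4)[of _ n] trace_sq[of _ n])
qed

text \<open>The coefficient of \<open>lambda^0\<close> in \<open>dressing_variation\<close> equates
  the \<open>t\<close>-derivative of \<open>n f_j\<close> with the trace of
  \<open>Y_{j,0} v\<close>, up to an \<open>x\<close>-derivative that integrates to zero.\<close>

lemma H_gradient:
  assumes n: "n \<ge> 2" and dr: "cder.dressing n U h T S"
  shows "has_functional_gradient n (H_functional n j) (mat_at U) (\<lambda>x. pi0 n (mat_at (Y_pow n j 0 T S) x))"
  unfolding has_functional_gradient_def
proof (intro conjI ballI)
  have U: "cder.V_shape n U" using dr by (simp add: cder.dressing_def)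
  have Uc: "U \<in> carrier_mat n n" using U by (rule cder.V_shape_carrier)
  note YZ = cder.dressed_carrier[OF dr, of "Z ^ j"]
  have Yc: "Y_pow n j 0 T S \<in> carrier_mat n n" using YZ by (simp add: Y_pow_def)
  let ?\<xi> = "\<lambda>x. pi0 n (mat_at (Y_pow n j 0 T S) x)"
  show "?\<xi> \<in> smooth_maps n (Vt_mats n)"
  proof -
    let ?M = "mat n n (\<lambda>(k, l). if k = n - 1 \<and> l < n - 1 then Y_pow n j 0 T S $$ (k, l) else 0)"
    have "?\<xi> = mat_at ?M" by (rule ext, rule eq_matI) (use Yc in \<open>auto simp: pi0_def\<close>)
    then show ?thesis by (auto intro!: smooth_maps_mat_at simp: Vt_mats_def)
  qed
  fix v assume v: "v \<in> smooth_maps n (V_mats n)"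
  then obtain V where V: "cder.V_shape n V" "v = mat_at V" using ex_V_shape_mat_at by blast
  have Vc: "V \<in> carrier_mat n n" using V(1) by (rule cder.V_shape_carrier)
  \<comment> \<open>The whole line \<open>U + t V\<close> is one matrix over \<open>sfun\<close>; a
    dressing of it contains the dressings for all \<open>t\<close>, smoothly in
    \<open>t\<close>.\<close>
  define W where "W = map_mat sconst U + stime \<cdot>\<^sub>m map_mat sconst V"
  have sconst0: "sconst 0 = 0" by (rule sfun_eqI) simp
  have W: "sdx.V_shape n W"
    using U V Uc Vc by (auto simp: W_def sdx.V_shape_def cder.V_shape_def sconst0)
  have sdtW: "map_mat sdt W = map_mat sconst V"
    unfolding W_def using Uc Vc
    by (auto intro!: eq_matI simp: sdt.add sdt.mult sdt_sconst sdt_stime)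
  obtain h' T' S' where dr': "sdx.dressing n W h' T' S'" using sdx.dressing_exists[OF n W] by blast
  have fr: "cder.dressing n (map_mat (sfreeze t) W) (fls_map (sfreeze t) h')
      (map_mat (fls_map (sfreeze t)) T') (map_mat (fls_map (sfreeze t)) S')" for t
    by (rule dressing_hom[OF sdx.diff_ring_axioms cder.diff_ring_axioms sfreeze.comm_ring_hom_axioms _ dr'])
      (simp add: cder_sfreeze)
  have W_at: "mat_at (map_mat (sfreeze t) W) = (\<lambda>x. mat_at U x + t \<cdot>\<^sub>m v x)" for t
    unfolding V(2) W_def by (rule ext, rule eq_matI) (use Uc Vc in auto)
  have H: "H_functional n j (\<lambda>x. mat_at U x + t \<cdot>\<^sub>m v x)
      = real n * integral {0..2 * pi} (cval (sfreeze t (fls_nth (h' - Z) (int j))))" for t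
  proof -
    have "fls_nth (fls_map (sfreeze t) h' - Z) (int j) = sfreeze t (fls_nth (h' - Z) (int j))"
      by (simp add: fls_map_nth sfreeze.hom_minus)
    then show ?thesis
      unfolding H_functional_def W_at[symmetric] f_coeffs_eq[OF n fr] by simp
  qed
  have deriv: "((\<lambda>t. H_functional n j (\<lambda>x. mat_at U x + t \<cdot>\<^sub>m v x)) has_real_derivative
      real n * integral {0..2 * pi} (cval (sfreeze 0 (sdt (fls_nth (h' - Z) (int j)))))) (at 0)"
    unfolding H by (intro DERIV_cmult integral_sfun_has_derivative)
  have Zj: "fls_map sdx (Z ^ j) = 0" by (rule sdx.map_Z_power)
  obtain g where g: "trace_mat (sdx.dressed n T' S' (Z ^ j) * map_mat fls_const (map_mat sdt W))
      - trace_mat (mult_mat n (Z ^ j * fls_map sdt h')) = fls_map sdx g"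
    using sdx.dressing_variation[OF sdt.derivation_axioms sdt_sdx dr' Zj] by blast
  define D where "D = sdx.dressed n T' S' (Z ^ j)"
  have D: "D \<in> carrier_mat n n" unfolding D_def by (rule sdx.dressed_carrier[OF dr'])
  define D0 where "D0 = map_mat (\<lambda>f. fls_nth f 0) D"
  have D0: "D0 \<in> carrier_mat n n" using D by (simp add: D0_def)
  have sV: "map_mat sconst V \<in> carrier_mat n n" using Vc by simp
  have "fls_nth (trace_mat (D * map_mat fls_const (map_mat sconst V))) 0 = trace_mat (D0 * map_mat sconst V)"
    using D D0 Vc
    by (simp add: trace_mat_def fls_nth_sum scalar_prod_def D0_def mult.commute[of _ "fls_const _"])
      (simp add: mult.commute)
  \<comment> \<open>\<open>z^j\<close> moves the coefficient of \<open>z^-j\<close> to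
    \<open>z^0\<close>, where the trace counts it \<open>n\<close> times. As \<open>z\<close> does
    not depend on \<open>t\<close>, \<open>h'\<close> and \<open>h' - z\<close> have the same
    \<open>t\<close>-derivative.\<close>
  moreover have "fls_nth (trace_mat (mult_mat n (Z ^ j * fls_map sdt h'))) 0
      = of_nat n * sdt (fls_nth (h' - Z) (int j))"
    unfolding trace_mult_mat_nth
    by (simp add: fls_X_inv_power_times_conv_shift fls_map_nth sdt.diff)
  ultimately have key: "trace_mat (D0 * map_mat sconst V) - of_nat n * sdt (fls_nth (h' - Z) (int j)) = sdx (fls_nth g 0)"
    using arg_cong[OF g, of "\<lambda>f. fls_nth f 0"] by (simp add: D_def[symmetric] sdtW fls_map_nth)
  have fr0: "map_mat (sfreeze 0) W = U"
    by (rule mat_at_eqI[of _ n n]) (use W_at[of 0] Uc Vc V in \<open>auto simp: W_def intro!: eq_matI\<close>)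
  \<comment> \<open>The dressing frozen at \<open>t = 0\<close> is a priori not the given
    \<open>T\<close>, \<open>S\<close>; both compute the same \<open>Y_coeff\<close>, which
    suffices.\<close>
  have "Y_coeff n j 0 (mat_at U) = mat_at (map_mat (sfreeze 0) D0)"
  proof -
    have "cder.dressed n (map_mat (fls_map (sfreeze 0)) T') (map_mat (fls_map (sfreeze 0)) S') (Z ^ j)
        = map_mat (fls_map (sfreeze 0)) D"
    proof -
      interpret F: comm_ring_hom "fls_map (sfreeze 0)"
        by (rule comm_ring_hom_fls_map[OF sfreeze.comm_ring_hom_axioms])
      have "fls_map (sfreeze 0) (Z ^ j) = Z ^ j"
        by (rule fls_eqI) (auto simp: fls_map_nth sfreeze.hom_one)
      then show ?thesis
        unfolding D_def sdx.dressed_def cder.dressed_def using sdx.dressing_sq[OF dr']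
        by (simp add: F.mat_hom_mult[of _ n n _ n] mult_mat_map[symmetric])
    qed
    then show ?thesis
      using Y_coeff_eq[OF n fr[of 0], of j 0] unfolding fr0 Y_pow_def D0_def
      by (auto intro!: eq_matI simp: fls_map_nth)
  qed
  then have Y0: "mat_at (Y_pow n j 0 T S) = mat_at (map_mat (sfreeze 0) D0)"
    using Y_coeff_eq[OF n dr, of j 0] by simp
  have "real n * integral {0..2 * pi} (cval (sfreeze 0 (sdt (fls_nth (h' - Z) (int j)))))
      = integral {0..2 * pi} (\<lambda>x. real n * cval (sfreeze 0 (sdt (fls_nth (h' - Z) (int j)))) x)"
    by (rule integral_mult_right[symmetric])
  also have "\<dots> = integral {0..2 * pi} (\<lambda>x. cval (sfreeze 0 (trace_mat (D0 * map_mat sconst V))) x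
      - cval (cder (sfreeze 0 (fls_nth g 0))) x)"
    unfolding cder_sfreeze key[symmetric] by simp
  also have "\<dots> = integral {0..2 * pi} (cval (sfreeze 0 (trace_mat (D0 * map_mat sconst V))))"
    using cval_integrable integral_cder by (subst Henstock_Kurzweil_Integration.integral_diff) auto
  also have "\<dots> = pairing n ?\<xi> v"
    unfolding pairing_def
  proof (rule arg_cong[of _ _ "integral {0..2 * pi}"], rule ext)
    fix x
    have "sfreeze 0 (trace_mat (D0 * map_mat sconst V)) = trace_mat (map_mat (sfreeze 0) D0 * V)"
    proof -
      have "map_mat (sfreeze 0) (map_mat sconst V) = V"
        by (rule eq_matI) (auto intro!: cfun_eqI)
      then show ?thesis
        using D0 sV by (simp add: sfreeze.hom_trace[of _ n] sfreeze.mat_hom_mult[of _ n n _ n])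
    qed
    then have "cval (sfreeze 0 (trace_mat (D0 * map_mat sconst V))) x
        = trace_mat (mat_at (map_mat (sfreeze 0) D0) x * v x)"
      using D0 Vc V by (simp only: cval.hom_trace[of _ n] cval.mat_hom_mult[of _ n n _ n] sq_mult_closed map_carrier_mat)
    also have "mat_at (map_mat (sfreeze 0) D0) x = mat_at (Y_pow n j 0 T S) x"
      using fun_cong[OF Y0, of x] by simp
    also have "trace_mat (mat_at (Y_pow n j 0 T S) x * v x) = trace_mat (?\<xi> x * v x)"
      using Yc v by (subst trace_V_pi0[of _ n]) (auto simp: smooth_maps_def)
    finally show "cval (sfreeze 0 (trace_mat (D0 * map_mat sconst V))) x = trace_mat (?\<xi> x * v x)" .
  qed
  finally show "((\<lambda>t. H_functional n j (\<lambda>x. mat_at U x + t \<cdot>\<^sub>m v x)) has_real_derivative pairing n ?\<xi> v) (at 0)"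
    using deriv by simp
qed

section \<open>The Poisson operators\<close>

abbreviation coeff_mat :: "int \<Rightarrow> 'a::comm_ring_1 fls mat \<Rightarrow> 'a mat" where
  "coeff_mat k M \<equiv> map_mat (\<lambda>f. fls_nth f k) M"

lemma coeff_mat_const_mult:
  fixes A :: "'a::comm_ring_1 mat"
  assumes "A \<in> carrier_mat n n" "M \<in> carrier_mat n n"
  shows "coeff_mat k (map_mat fls_const A * M) = A * coeff_mat k M"
    "coeff_mat k (M * map_mat fls_const A) = coeff_mat k M * A"
proof -
  have A: "map_mat fls_const A \<in> carrier_mat n n" and k: "coeff_mat k M \<in> carrier_mat n n" using assms by auto
  show "coeff_mat k (map_mat fls_const A * M) = A * coeff_mat k M"
  proof (rule eq_matI)
    fix r s assume "r < dim_row (A * coeff_mat k M)" "s < dim_col (A * coeff_mat k M)"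
    then have rs: "r < n" "s < n" using assms by auto
    have "coeff_mat k (map_mat fls_const A * M) $$ (r, s) = fls_nth ((map_mat fls_const A * M) $$ (r, s)) k"
      using rs assms by (auto simp del: index_mult_mat(1))
    then show "coeff_mat k (map_mat fls_const A * M) $$ (r, s) = (A * coeff_mat k M) $$ (r, s)"
      unfolding sq_mult_entry[OF A assms(2) rs] sq_mult_entry[OF assms(1) k rs]
      using rs assms by (auto simp: fls_nth_sum intro!: sum.cong)
  qed (use assms in auto)
  show "coeff_mat k (M * map_mat fls_const A) = coeff_mat k M * A"
  proof (rule eq_matI)
    fix r s assume "r < dim_row (coeff_mat k M * A)" "s < dim_col (coeff_mat k M * A)"
    then have rs: "r < n" "s < n" using assms by auto
    have "coeff_mat k (M * map_mat fls_const A) $$ (r, s) = fls_nth ((M * map_mat fls_const A) $$ (r, s)) k"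
      using rs assms by (auto simp del: index_mult_mat(1))
    then show "coeff_mat k (M * map_mat fls_const A) $$ (r, s) = (coeff_mat k M * A) $$ (r, s)"
      unfolding sq_mult_entry[OF assms(2) A rs] sq_mult_entry[OF k assms(1) rs]
      using rs assms by (auto simp: fls_nth_sum intro!: sum.cong)
  qed (use assms in auto)
qed

lemma Y_pow_carrier: "cder.dressing n U h T S \<Longrightarrow> Y_pow n j i T S \<in> carrier_mat n n"
  using cder.dressed_carrier by (simp add: Y_pow_def)

text \<open>\<open>z^n\<close> acts as the scalar \<open>lambda\<close>, hence the shift of the
  index.\<close>

lemma Y_pow_add_n:
  assumes "cder.dressing n U h T S"
  shows "Y_pow n (n + j) i T S = Y_pow n j (i - 1) T S"
  unfolding Y_pow_def power_add cder.dressed_Z_power_n[OF assms]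
  by (rule eq_matI) (auto simp: fls_X_inv_times_conv_shift)

text \<open>The trace of \<open>Y^j\<close> is that of multiplication by \<open>z^j\<close>, which
  sees only exponents divisible by \<open>n\<close>.\<close>

lemma trace_Y_pow:
  assumes dr: "cder.dressing n U h T S" and "\<not> n dvd j"
  shows "trace_mat (Y_pow n j i T S) = 0"
proof -
  have "trace_mat (Y_pow n j i T S) = fls_nth (trace_mat (cder.dressed n T S (Z ^ j))) (- i)"
    using cder.dressed_carrier[OF dr, of "Z ^ j"] by (auto simp: Y_pow_def trace_mat_def fls_nth_sum)
  also have "fls_nth (trace_mat (cder.dressed n T S (Z ^ j))) (- i) = of_nat n * (if int n * (- i) = - int j then 1 else 0)"
    unfolding cder.trace_dressed[OF dr] trace_mult_mat_nth by simp
  moreover have "int n * (- i) \<noteq> - int j"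
  proof
    assume "int n * (- i) = - int j"
    then have "int n dvd int j" by (metis dvd_minus_iff dvd_triv_left)
    then show False using assms(2) by simp
  qed
  ultimately show ?thesis by simp
qed

lemma coeff_mat_linear:
  fixes A B C D :: "'a::comm_ring_1 fls mat"
  assumes "A \<in> carrier_mat n n" "B \<in> carrier_mat n n" "C \<in> carrier_mat n n" "D \<in> carrier_mat n n"
  shows "coeff_mat k ((Z \<cdot>\<^sub>m A + B) - (Z \<cdot>\<^sub>m C + D))
    = (coeff_mat (k + 1) A + coeff_mat k B) - (coeff_mat (k + 1) C + coeff_mat k D)"
  by (rule eq_matI) (use assms in \<open>auto simp: fls_X_inv_times_conv_shift\<close>)

lemma trace_uminus_sq:
  fixes A :: "'a::comm_ring_1 mat"
  shows "A \<in> carrier_mat n n \<Longrightarrow> trace_mat (- A) = - trace_mat A"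
  by (simp add: trace_mat_def sum_negf)

text \<open>This is the coefficient of \<open>lambda^i\<close> in
  \<open>[d + J + U, Y^j] = 0\<close>. The term \<open>lambda e_1n\<close> couples it to the next
  lower coefficient and is the source of the minus sign.\<close>

lemma cov_Y_pow:
  assumes n: "n \<ge> 2" and dr: "cder.dressing n U h T S"
  shows "cder.cov n U (Y_pow n j i T S) = - commutator (elem_mat n 0 (n - 1)) (Y_pow n j (i - 1) T S)"
proof -
  have U: "cder.V_shape n U" using dr by (simp add: cder.dressing_def)
  have Uc: "U \<in> carrier_mat n n" using U by (rule cder.V_shape_carrier)
  define Y where "Y = cder.dressed n T S (Z ^ j)"
  have Y: "Y \<in> carrier_mat n n" unfolding Y_def by (rule cder.dressed_carrier[OF dr])
  let ?E = "elem_mat n 0 (n - 1) :: cfun mat"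
  let ?A = "b_mat n + U"
  let ?E' = "map_mat fls_const ?E"
  let ?A' = "map_mat fls_const ?A"
  have A: "?A \<in> carrier_mat n n" "?A' \<in> carrier_mat n n" using Uc by auto
  have E: "?E' \<in> carrier_mat n n" by simp
  have J: "cder.JU n U = Z \<cdot>\<^sub>m ?E' + ?A'"
    unfolding cder.JU_def mult_mat_Z[OF n]
    by (rule eq_matI) (use Uc in \<open>auto simp: elem_mat_def b_mat_def intro!: fls_eqI\<close>)
  have ode: "map_mat (fls_map cder) Y = Y * cder.JU n U - cder.JU n U * Y"
    unfolding Y_def by (rule cder.dressed_ode[OF dr]) (rule cder.map_Z_power)
  have "map_mat cder (coeff_mat (- i) Y) = coeff_mat (- i) (map_mat (fls_map cder) Y)"
    by (rule eq_matI) (auto simp: fls_map_nth)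
  also have "map_mat (fls_map cder) Y = (Z \<cdot>\<^sub>m (Y * ?E') + Y * ?A') - (Z \<cdot>\<^sub>m (?E' * Y) + ?A' * Y)"
    unfolding ode J using Y A E by (simp add: sq_simps[of _ n] del: add_carrier_mat map_carrier_mat)
  also have "coeff_mat (- i) \<dots> = (coeff_mat (- i + 1) (Y * ?E') + coeff_mat (- i) (Y * ?A'))
      - (coeff_mat (- i + 1) (?E' * Y) + coeff_mat (- i) (?A' * Y))"
    using Y A E by (intro coeff_mat_linear[of _ n]) auto
  also have "\<dots> = (coeff_mat (- i + 1) Y * ?E + coeff_mat (- i) Y * ?A) - (?E * coeff_mat (- i + 1) Y + ?A * coeff_mat (- i) Y)"
    using Y A(1) by (simp only: coeff_mat_const_mult[of _ n] elem_mat_carrier)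
  finally have *: "map_mat cder (Y_pow n j i T S) = (Y_pow n j (i - 1) T S * ?E + Y_pow n j i T S * ?A)
      - (?E * Y_pow n j (i - 1) T S + ?A * Y_pow n j i T S)"
    by (simp add: Y_pow_def Y_def[symmetric])
  have lin: "(A + B - (C + D)) + (D - B) = - (C - A)"
    if "A \<in> carrier_mat n n" "B \<in> carrier_mat n n" "C \<in> carrier_mat n n" "D \<in> carrier_mat n n" for A B C D :: "cfun mat"
    by (rule eq_matI) (use that in auto)
  show ?thesis
    unfolding cder.cov_def * commutator_def by (rule lin) (use Y_pow_carrier[OF dr] A in auto)
qed

lemma commutator_elem_mat_entry:
  fixes A :: "'a::comm_ring_1 mat"
  assumes A: "A \<in> carrier_mat n n" and rs: "0 < r" "r < n" "s < n - 1"
  shows "commutator (elem_mat n 0 (n - 1)) A $$ (r, s) = 0"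
proof -
  let ?E = "elem_mat n 0 (n - 1) :: 'a mat"
  have E: "?E \<in> carrier_mat n n" by simp
  have s: "s < n" using rs by simp
  have "(?E * A) $$ (r, s) = 0" "(A * ?E) $$ (r, s) = 0"
    unfolding sq_mult_entry[OF E A rs(2) s] sq_mult_entry[OF A E rs(2) s]
    using rs by (auto simp: elem_mat_def)
  then show ?thesis unfolding commutator_def using A rs by (auto simp del: index_mult_mat(1))
qed

lemma cov_Y_pow_entry:
  assumes n: "n \<ge> 2" and dr: "cder.dressing n U h T S" and rs: "0 < r" "r < n" "s < n - 1"
  shows "cder.cov n U (Y_pow n j i T S) $$ (r, s) = 0"
proof -
  have "commutator (elem_mat n 0 (n - 1)) (Y_pow n j (i - 1) T S) \<in> carrier_mat n n"
    using Y_pow_carrier[OF dr] by simp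
  then show ?thesis
    unfolding cov_Y_pow[OF n dr] using commutator_elem_mat_entry[OF Y_pow_carrier[OF dr] rs] rs by auto
qed

text \<open>The difference is traceless with zero last row before the corner. Its \<open>cov\<close>
  vanishes below row \<open>0\<close> and left of the last column, as a commutator with
  \<open>e_1n\<close> does, so \<open>strictly_upper_if\<close> applies.\<close>

lemma strictly_upper_Y_pow_diff:
  assumes n: "n \<ge> 2" and dr: "cder.dressing n U h T S" and j: "\<not> n dvd j"
    and C: "C \<in> carrier_mat n n" "trace_mat C = 0" "\<And>k. k < n - 1 \<Longrightarrow> C $$ (n - 1, k) = Y_pow n j i T S $$ (n - 1, k)"
      "cder.V_shape n (cder.cov n U C)"
    and rs: "r < n" "s \<le> r"
  shows "(Y_pow n j i T S - C) $$ (r, s) = 0"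
proof -
  have U: "cder.V_shape n U" using dr by (simp add: cder.dressing_def)
  have Uc: "U \<in> carrier_mat n n" using U by (rule cder.V_shape_carrier)
  note Y = Y_pow_carrier[OF dr, of j i]
  have D: "Y_pow n j i T S - C \<in> carrier_mat n n" using C by simp
  show ?thesis
  proof (rule cder.strictly_upper_if[OF n U D _ _ _ rs])
    show "trace_mat (Y_pow n j i T S - C) = 0" using Y C trace_Y_pow[OF dr j] by (simp add: trace_sq[of _ n])
    show "(Y_pow n j i T S - C) $$ (n - 1, k) = 0" if "k < n - 1" for k
      using Y C that n by auto
    show "cder.cov n U (Y_pow n j i T S - C) $$ (r, s) = 0" if "0 < r" "r < n" "s < n - 1" for r s
      unfolding cder.cov_diff[OF Uc Y C(1)] using cov_Y_pow_entry[OF n dr that] C(4) that cder.cov_carrier[OF Uc C(1)]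
      by (auto simp: cder.V_shape_def)
  qed
qed

lemma mat_at_smooth_V:
  "cder.V_shape n A \<Longrightarrow> mat_at A \<in> smooth_maps n (V_mats n)"
  using mat_at_V_mats[of A n] cder.V_shape_carrier[of n A] by (intro smooth_maps_mat_at) auto

text \<open>\<open>Y - C\<close> is strictly upper triangular and hence a candidate for
  \<open>zeta\<close>. Another candidate has zero trace and zero last row, so
  \<open>P_unique\<close> shows that subtracting it from \<open>Y\<close> also gives
  \<open>C\<close>.\<close>

lemma Z0_eq:
  assumes n: "n \<ge> 2" and dr: "cder.dressing n U h T S" and j: "\<not> n dvd j"
    and C: "C \<in> carrier_mat n n" "trace_mat C = 0" "\<And>k. k < n - 1 \<Longrightarrow> C $$ (n - 1, k) = Y_pow n j 0 T S $$ (n - 1, k)"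
      "cder.V_shape n (cder.cov n U C)"
  shows "Z0 n j (mat_at U) = mat_at C"
proof -
  have U: "cder.V_shape n U" using dr by (simp add: cder.dressing_def)
  have Uc: "U \<in> carrier_mat n n" using U by (rule cder.V_shape_carrier)
  define Y where "Y = Y_pow n j 0 T S"
  have Y: "Y \<in> carrier_mat n n" unfolding Y_def by (rule Y_pow_carrier[OF dr])
  have Yx: "Y_coeff n j 0 (mat_at U) x = mat_at Y x" for x
    using Y_coeff_eq[OF n dr, of j 0] unfolding Y_def by (rule fun_cong)
  have up: "(Y - C) $$ (r, s) = 0" if "r < n" "s \<le> r" for r s
    unfolding Y_def by (rule strictly_upper_Y_pow_diff[OF n dr j C that])
  have D: "Y - C \<in> carrier_mat n n" using C Y by simp
  have diff: "mat_at Y x - mat_at A x = mat_at (Y - A) x" if "A \<in> carrier_mat n n" for A x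
    using cval.map_mat_diff[OF Y that] by simp
  have YYC: "Y - (Y - C) = C" by (rule eq_matI) (use Y C in auto)
  have "zeta n j (mat_at U) = mat_at (Y - C)"
    unfolding zeta_def
  proof (rule the_equality)
    have "(\<lambda>x. Y_coeff n j 0 (mat_at U) x - mat_at (Y - C) x) = mat_at C"
      unfolding Yx diff[OF D] YYC ..
    moreover have "cov_deriv n (\<lambda>x. b_mat n + mat_at U x) (mat_at C) = mat_at (cder.cov n U C)"
      using cov_deriv_mat_at[OF Uc C(1)] by blast
    moreover have "mat_at (Y - C) \<in> smooth_maps n (strictly_upper_mats n)"
    proof (rule smooth_maps_mat_at[OF D])
      fix x
      show "mat_at (Y - C) x \<in> strictly_upper_mats n"
        unfolding strictly_upper_mats_def
      proof (intro CollectI conjI allI impI)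
        fix k l assume "k < n" "l \<le> k"
        then show "mat_at (Y - C) x $$ (k, l) = 0"
          using D up[of k l] C(1) by (subst index_map_mat(1)) (auto simp del: index_minus_mat(1))
      qed (use D in simp)
    qed
    ultimately show "mat_at (Y - C) \<in> smooth_maps n (strictly_upper_mats n) \<and>
      cov_deriv n (\<lambda>x. b_mat n + mat_at U x) (\<lambda>x. Y_coeff n j 0 (mat_at U) x - mat_at (Y - C) x) \<in> smooth_maps n (V_mats n)"
      using mat_at_smooth_V[OF C(4)] by simp
    fix \<zeta>
    assume \<zeta>: "\<zeta> \<in> smooth_maps n (strictly_upper_mats n) \<and>
      cov_deriv n (\<lambda>x. b_mat n + mat_at U x) (\<lambda>x. Y_coeff n j 0 (mat_at U) x - \<zeta> x) \<in> smooth_maps n (V_mats n)"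
    then obtain M where M: "M \<in> carrier_mat n n" "\<zeta> = mat_at M"
      using ex_mat_at[of \<zeta> n "strictly_upper_mats n"] subset_carrier by auto
    have Mup: "M $$ (r, s) = 0" if "r < n" "s \<le> r" for r s
    proof (rule cfun_eqI)
      fix x
      have "\<zeta> x \<in> strictly_upper_mats n" using \<zeta> by (auto simp: smooth_maps_def)
      then show "cval (M $$ (r, s)) x = cval 0 x"
        using that M by (auto simp: strictly_upper_mats_def)
    qed
    have YM: "Y - M \<in> carrier_mat n n" using Y M by simp
    have "(\<lambda>x. Y_coeff n j 0 (mat_at U) x - \<zeta> x) = mat_at (Y - M)"
      unfolding M(2) Yx diff[OF M(1)] ..
    moreover have "cov_deriv n (\<lambda>x. b_mat n + mat_at U x) (mat_at (Y - M)) = mat_at (cder.cov n U (Y - M))"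
      using cov_deriv_mat_at[OF Uc YM] by blast
    ultimately have "mat_at (cder.cov n U (Y - M)) \<in> smooth_maps n (V_mats n)" using \<zeta> by simp
    then have "cder.V_shape n (cder.cov n U (Y - M))"
      using mat_at_V_mats[OF cder.cov_carrier[OF Uc YM]] by (auto simp: smooth_maps_def)
    moreover have "trace_mat (Y - M) = 0"
    proof -
      have "trace_mat M = 0" using M Mup by (simp add: trace_mat_def)
      then show ?thesis using Y M trace_Y_pow[OF dr j] by (simp add: trace_sq[of _ n] Y_def)
    qed
    moreover have "(Y - M) $$ (n - 1, k) = C $$ (n - 1, k)" if "k < n - 1" for k
      using Y M Mup[of "n - 1" k] that n C(3)[OF that] by (auto simp: Y_def)
    ultimately have "Y - M = C" by (intro cder.P_unique[OF n U YM _ _ C(1,2,4)])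
    moreover have "Y - (Y - M) = M" by (rule eq_matI) (use Y M in auto)
    ultimately have "M = Y - C" by simp
    then show "\<zeta> = mat_at (Y - C)" using M by simp
  qed
  then show ?thesis
    unfolding Z0_def[abs_def] Yx by (simp only: diff[OF D] YYC)
qed

lemma poisson2_eq:
  assumes n: "n \<ge> 2" and U: "cder.V_shape n U"
    and C: "C \<in> carrier_mat n n" "trace_mat C = 0" "cder.V_shape n (cder.cov n U C)"
    and D: "D \<in> carrier_mat n n" "\<And>k. k < n - 1 \<Longrightarrow> C $$ (n - 1, k) = D $$ (n - 1, k)"
  shows "poisson2 n (mat_at U) (\<lambda>x. pi0 n (mat_at D x)) = mat_at (cder.cov n U C)"
proof -
  have "P_op n (mat_at U) (\<lambda>x. pi0 n (mat_at D x)) = mat_at C" by (rule P_op_eq[OF assms])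
  then show ?thesis
    unfolding poisson2_def using cov_deriv_mat_at[OF cder.V_shape_carrier[OF U] C(1)] by (intro ext) simp
qed

section \<open>Nondegeneracy of the pairing, and the first Poisson operator\<close>

lemma circle_smooth_periodic_int:
  assumes "\<And>x. f (x + 2 * pi) = f x"
  shows "f (x + 2 * pi * of_int k) = f x"
proof -
  have nat: "f (x + 2 * pi * real m) = f x" for x m
  proof (induction m)
    case (Suc m)
    have "f (x + 2 * pi * real (Suc m)) = f ((x + 2 * pi * real m) + 2 * pi)"
      by (simp add: algebra_simps)
    then show ?case using assms Suc by simp
  qed simp
  show ?thesis
  proof (cases "k \<ge> 0")
    case True
    then show ?thesis using nat[of x "nat k"] by simp
  next
    case False
    then show ?thesis using nat[of "x + 2 * pi * of_int k" "nat (- k)"] by simp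
  qed
qed

text \<open>The integrals over \<open>{0..z}\<close> lie between \<open>0\<close> and the full
  integral, so they vanish for all \<open>z\<close>. Their derivative in \<open>z\<close> is the
  function itself, and periodicity covers the rest of the line.\<close>

lemma cfun_eq_0_if_integral:
  assumes pos: "\<And>x. cval f x \<ge> 0" and int: "integral {0..2 * pi} (cval f) = 0"
  shows "f = 0"
proof (rule cfun_eqI)
  fix x
  define k where "k = \<lfloor>x / (2 * pi)\<rfloor>"
  define y where "y = x - 2 * pi * of_int k"
  have "of_int k \<le> x / (2 * pi)" "x / (2 * pi) < of_int k + 1" by (auto simp: k_def)
  then have "y \<in> {0..2 * pi}" by (auto simp: y_def field_simps)
  have "integral {0..z} (cval f) = 0" if z: "z \<in> {0..2 * pi}" for z
  proof (rule antisym)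
    have i: "cval f integrable_on {0..z}" "cval f integrable_on {0..2 * pi}"
      by (intro integrable_continuous_real cval_continuous_on)+
    have "integral {0..z} (cval f) \<le> integral {0..2 * pi} (cval f)"
      by (rule integral_subset_le) (use z pos i in auto)
    then show "integral {0..z} (cval f) \<le> 0" using int by simp
    show "0 \<le> integral {0..z} (cval f)" using pos i by (intro integral_nonneg) auto
  qed
  then have "((\<lambda>z. integral {0..z} (cval f)) has_vector_derivative 0) (at y within {0..2 * pi})"
    using \<open>y \<in> {0..2 * pi}\<close> by (intro has_vector_derivative_transform[OF _ _ has_vector_derivative_const]) auto
  moreover have "((\<lambda>z. integral {0..z} (cval f)) has_vector_derivative cval f y) (at y within {0..2 * pi})"
    using \<open>y \<in> {0..2 * pi}\<close> by (intro integral_has_vector_derivative cval_continuous_on)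
  ultimately have "cval f y = 0"
    using vector_derivative_unique_within_closed_interval[of 0 "2 * pi" y] \<open>y \<in> {0..2 * pi}\<close> by auto
  moreover have "cval f (y + 2 * pi * of_int k) = cval f y"
    using circle_smooth_cval[of f] by (intro circle_smooth_periodic_int) (auto simp: circle_smooth_def)
  ultimately show "cval f x = cval 0 x" by (simp add: y_def)
qed

text \<open>The trace is the sum of the squares of all entries.\<close>

lemma V_shape_eq_0_if_pairing:
  assumes A: "cder.V_shape n A" and int: "integral {0..2 * pi} (cval (trace_mat (A * transpose_mat A))) = 0"
  shows "A = 0\<^sub>m n n"
proof -
  have Ac: "A \<in> carrier_mat n n" using A by (rule cder.V_shape_carrier)
  have At: "transpose_mat A \<in> carrier_mat n n" using Ac by simp
  have val: "cval (trace_mat (A * transpose_mat A)) x = (\<Sum>i<n. \<Sum>k<n. (cval (A $$ (i, k)) x)\<^sup>2)" for x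
  proof -
    have "trace_mat (A * transpose_mat A) = (\<Sum>i<n. \<Sum>k<n. A $$ (i, k) * A $$ (i, k))"
      unfolding trace_mat_def using Ac sq_mult_entry[OF Ac At]
      by (auto intro!: sum.cong simp del: index_mult_mat(1))
    then show ?thesis by (simp add: power2_eq_square)
  qed
  have zero: "trace_mat (A * transpose_mat A) = 0"
    using int by (intro cfun_eq_0_if_integral) (auto simp: val intro!: sum_nonneg)
  have "A $$ (i, k) = 0" if "i < n" "k < n" for i k
  proof (rule cfun_eqI)
    fix x
    have "(\<Sum>i<n. \<Sum>k<n. (cval (A $$ (i, k)) x)\<^sup>2) = 0" using val[of x] zero by simp
    then show "cval (A $$ (i, k)) x = cval 0 x"
      using that by (simp add: sum_nonneg_eq_0_iff sum_nonneg)
  qed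
  then show ?thesis using Ac by (auto intro!: eq_matI)
qed

lemma Vt_maps_pi0:
  assumes "\<eta> \<in> smooth_maps n (Vt_mats n)" "\<eta> = mat_at M" "M \<in> carrier_mat n n"
  shows "\<eta> = (\<lambda>x. pi0 n (mat_at M x))"
proof
  fix x
  have "mat_at M x \<in> Vt_mats n" using assms by (auto simp: smooth_maps_def)
  then show "\<eta> x = pi0 n (mat_at M x)"
    unfolding assms(2) by (auto simp: Vt_mats_def pi0_def intro!: eq_matI)
qed

text \<open>
  The Lenard relation. Modulo matrices on which the pairing vanishes, \<open>[L, Y\<^bsub>j,0\<^esub>] = - [e\<^bsub>1n\<^esub>, Y\<^bsub>j,-1\<^esub>]\<close>,
  and \<open>Y\<^bsub>j,-1\<^esub> = Y\<^bsub>n+j,0\<^esub>\<close> because \<open>Y\<^sup>n = \<lambda>\<close>.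
\<close>
lemma poisson1_eq:
  assumes n: "n \<ge> 2" and dr: "cder.dressing n U h T S" and j: "\<not> n dvd j"
    and C: "C \<in> carrier_mat n n" "trace_mat C = 0" "\<And>k. k < n - 1 \<Longrightarrow> C $$ (n - 1, k) = Y_pow n j 0 T S $$ (n - 1, k)"
      "cder.V_shape n (cder.cov n U C)"
  shows "poisson1 n (mat_at U) (\<lambda>x. pi0 n (mat_at (- Y_pow n (n + j) 0 T S) x)) = mat_at (cder.cov n U C)"
proof -
  have U: "cder.V_shape n U" using dr by (simp add: cder.dressing_def)
  have Uc: "U \<in> carrier_mat n n" using U by (rule cder.V_shape_carrier)
  let ?E = "elem_mat n 0 (n - 1) :: cfun mat"
  define Y where "Y = Y_pow n j 0 T S"
  define Y' where "Y' = Y_pow n j (- 1) T S"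
  have Y: "Y \<in> carrier_mat n n" "Y' \<in> carrier_mat n n"
    unfolding Y_def Y'_def by (rule Y_pow_carrier[OF dr])+
  have Y'n: "Y_pow n (n + j) 0 T S = Y'" unfolding Y'_def Y_pow_add_n[OF dr] by simp
  \<comment> \<open>\<open>- B\<close> is the value of \<open>P_u\<close> on the gradient of
    \<open>- H_{n+j}\<close>.\<close>
  obtain B where B: "B \<in> carrier_mat n n" "trace_mat B = 0" "\<And>k. k < n - 1 \<Longrightarrow> B $$ (n - 1, k) = Y' $$ (n - 1, k)"
    "cder.V_shape n (cder.cov n U B)"
    using cder.P_exists[OF n U, of "\<lambda>k. Y' $$ (n - 1, k)"] by blast
  have nB: "- B \<in> carrier_mat n n" "trace_mat (- B) = 0" "cder.V_shape n (cder.cov n U (- B))"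
  proof -
    show c: "- B \<in> carrier_mat n n" using B by simp
    show "trace_mat (- B) = 0" using B by (simp add: trace_mat_def sum_negf)
    have "- B = 0\<^sub>m n n - B" by (rule eq_matI) (use B in auto)
    moreover have "cder.cov n U (0\<^sub>m n n) = 0\<^sub>m n n"
      unfolding cder.cov_def commutator_def using Uc by (auto simp: sq_units[of _ n] intro!: eq_matI)
    ultimately have "cder.cov n U (- B) = 0\<^sub>m n n - cder.cov n U B"
      using cder.cov_diff[OF Uc zero_carrier_mat B(1)] by simp
    then show "cder.V_shape n (cder.cov n U (- B))"
      using B(4) by (auto simp: cder.V_shape_def)
  qed
  have P: "P_op n (mat_at U) (\<lambda>x. pi0 n (mat_at (- Y_pow n (n + j) 0 T S) x)) = mat_at (- B)"
    unfolding Y'n by (rule P_op_eq[OF n U nB]) (use Y B n in auto)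
  have up': "(Y' - B) $$ (r, s) = 0" if "r < n" "s \<le> r" for r s
    unfolding Y'_def by (rule strictly_upper_Y_pow_diff[OF n dr j B(1,2) B(3)[unfolded Y'_def] B(4) that])
  have up: "(Y - C) $$ (r, s) = 0" if "r < n" "s \<le> r" for r s
    unfolding Y_def by (rule strictly_upper_Y_pow_diff[OF n dr j C that])
  have EYB: "commutator ?E (Y' - B) = 0\<^sub>m n n"
    by (rule commutator_elem_mat_strictly_upper) (use Y B n up' in auto)
  \<comment> \<open>\<open>Y' - B\<close> is strictly upper triangular and so commutes with
    \<open>e_1n\<close>. Therefore \<open>B\<close> may be replaced by \<open>Y'\<close>, and
    \<open>cov_Y_pow\<close> absorbs the sign.\<close>
  have EB: "commutator ?E (- B) = cder.cov n U Y"
  proof -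
    have c: "commutator ?E Y' \<in> carrier_mat n n" "commutator ?E B \<in> carrier_mat n n" using Y B by auto
    have "commutator ?E Y' - commutator ?E B = commutator ?E (Y' - B)"
      unfolding commutator_def using Y B by (simp add: sq_simps[of _ n])
        (rule eq_matI; auto simp del: index_mult_mat(1))
    then have "commutator ?E Y' - commutator ?E B = 0\<^sub>m n n" unfolding EYB .
    moreover have "commutator ?E B = commutator ?E Y' - (commutator ?E Y' - commutator ?E B)"
      by (rule eq_matI) (use c in auto)
    ultimately have "commutator ?E B = commutator ?E Y'" using c by (auto intro!: eq_matI)
    moreover have "commutator ?E (- B) = - commutator ?E B"
      unfolding commutator_def using B(1)
      by (simp add: uminus_mult_left_mat uminus_mult_right_mat carrier_matD[OF B(1)])
        (rule eq_matI; auto simp del: index_mult_mat(1))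
    ultimately have "commutator ?E (- B) = - commutator ?E Y'" by simp
    also have "\<dots> = cder.cov n U Y"
      using cov_Y_pow[OF n dr, of j 0] by (simp add: Y_def Y'_def)
    finally show ?thesis .
  qed
  have W: "cder.cov n U C \<in> carrier_mat n n" using Uc C by simp
  have YC: "Y - C \<in> carrier_mat n n" using C by simp
  have key: "pairing n (mat_at (cder.cov n U C)) \<eta>
      = pairing n (\<lambda>x. commutator (elem_mat n 0 (n - 1)) (mat_at (- B) x)) (P_op n (mat_at U) \<eta>)"
    if \<eta>: "\<eta> \<in> smooth_maps n (Vt_mats n)" for \<eta>
  proof -
    obtain M where M: "M \<in> carrier_mat n n" "\<eta> = mat_at M"
      using ex_mat_at[OF \<eta> subset_carrier(3)] by blast
    obtain Q where Q: "Q \<in> carrier_mat n n" "trace_mat Q = 0" "\<And>k. k < n - 1 \<Longrightarrow> Q $$ (n - 1, k) = M $$ (n - 1, k)"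
      "cder.V_shape n (cder.cov n U Q)"
      using cder.P_exists[OF n U, of "\<lambda>k. M $$ (n - 1, k)"] by blast
    have PQ: "P_op n (mat_at U) \<eta> = mat_at Q"
      unfolding Vt_maps_pi0[OF \<eta> M(2,1)] by (rule P_op_eq[OF n U Q(1,2,4) M(1) Q(3)])
    have EBx: "(\<lambda>x. commutator (elem_mat n 0 (n - 1)) (mat_at (- B) x)) = mat_at (cder.cov n U Y)"
      unfolding EB[symmetric]
      by (rule ext, subst cval.map_mat_commutator[of _ n]) (use nB in \<open>auto simp: map_mat_elem_mat\<close>)
    have cY: "cder.cov n U Y \<in> carrier_mat n n" using Uc Y by simp
    have Yd: "Y = C + (Y - C)" by (rule eq_matI) (use Y C in auto)
    have cYC: "cder.cov n U (Y - C) \<in> carrier_mat n n" using Uc YC by simp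
    have "trace_mat (cder.cov n U C * M) = trace_mat (cder.cov n U C * Q)"
    proof -
      have "trace_mat (cder.cov n U C * (M - Q)) = 0"
        by (rule trace_strictly_upper_V(2)[of _ n]) (use M Q C(4) W n in \<open>auto simp: cder.V_shape_def\<close>)
      then show ?thesis using W M Q by (simp add: sq_simps(5)[of _ n] trace_sq[of _ n])
    qed
    \<comment> \<open>Integration by parts moves \<open>cov\<close> from \<open>Y - C\<close> to
      \<open>Q\<close>. There it meets \<open>V_n\<close>, against which a strictly upper triangular
      matrix has trace zero.\<close>
    moreover have "trace_mat (cder.cov n U Y * Q) = trace_mat (cder.cov n U C * Q) + cder (trace_mat ((Y - C) * Q))"
    proof -
      have "cder.cov n U (Y - C) * Q = cder.cov n U Y * Q - cder.cov n U C * Q"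
        unfolding cder.cov_diff[OF Uc Y(1) C(1)] using cY W Q by (simp add: sq_simps(4)[of _ n])
      moreover have "trace_mat ((Y - C) * cder.cov n U Q) = 0"
        by (rule trace_strictly_upper_V(1)[of _ n]) (use YC up Q(4) n cder.cov_carrier[OF Uc Q(1)] in \<open>auto simp: cder.V_shape_def\<close>)
      ultimately show ?thesis
        using cder.trace_cov_mult[OF Uc YC Q(1)] cY W Q by (simp add: trace_sq[of _ n] algebra_simps)
    qed
    ultimately have "integral {0..2 * pi} (cval (trace_mat (cder.cov n U Y * Q)))
      = integral {0..2 * pi} (\<lambda>x. cval (trace_mat (cder.cov n U C * M)) x + cval (cder (trace_mat ((Y - C) * Q))) x)"
      by (intro arg_cong[of _ _ "integral {0..2 * pi}"] ext) simp
    also have "\<dots> = integral {0..2 * pi} (cval (trace_mat (cder.cov n U C * M)))"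
      using cval_integrable integral_cder by (subst Henstock_Kurzweil_Integration.integral_add) auto
    finally show ?thesis
      unfolding PQ EBx unfolding M(2) pairing_mat_at[OF W M(1)] pairing_mat_at[OF cY Q(1)] by simp
  qed
  show ?thesis
    unfolding poisson1_def P
  proof (rule the_equality)
    show "mat_at (cder.cov n U C) \<in> smooth_maps n (V_mats n) \<and>
      (\<forall>\<eta>\<in>smooth_maps n (Vt_mats n). pairing n (mat_at (cder.cov n U C)) \<eta>
        = pairing n (\<lambda>x. commutator (elem_mat n 0 (n - 1)) (mat_at (- B) x)) (P_op n (mat_at U) \<eta>))"
      using key mat_at_smooth_V[OF C(4)] by blast
    fix w
    assume w: "w \<in> smooth_maps n (V_mats n) \<and>
      (\<forall>\<eta>\<in>smooth_maps n (Vt_mats n). pairing n w \<eta>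
        = pairing n (\<lambda>x. commutator (elem_mat n 0 (n - 1)) (mat_at (- B) x)) (P_op n (mat_at U) \<eta>))"
    then obtain M where M: "cder.V_shape n M" "w = mat_at M" using ex_V_shape_mat_at by blast
    have Mc: "M \<in> carrier_mat n n" using M(1) by (rule cder.V_shape_carrier)
    define D where "D = M - cder.cov n U C"
    have Dc: "D \<in> carrier_mat n n" using W by (simp add: D_def)
    have Dt: "transpose_mat D \<in> carrier_mat n n" using Dc by simp
    have DV: "cder.V_shape n D" using M(1) C(4) by (auto simp: D_def cder.V_shape_def)
    \<comment> \<open>Testing with the transpose of the difference turns equality of pairings into a
      vanishing sum of squares.\<close>
    have "mat_at (transpose_mat D) \<in> smooth_maps n (Vt_mats n)"
      using DV Dt by (intro smooth_maps_mat_at) (auto simp: Vt_mats_def cder.V_shape_def)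
    then have "pairing n (mat_at M) (mat_at (transpose_mat D)) = pairing n (mat_at (cder.cov n U C)) (mat_at (transpose_mat D))"
      using w key M(2) by simp
    then have eq: "integral {0..2 * pi} (cval (trace_mat (M * transpose_mat D)))
        = integral {0..2 * pi} (cval (trace_mat (cder.cov n U C * transpose_mat D)))"
      by (simp only: pairing_mat_at[OF Mc Dt] pairing_mat_at[OF W Dt])
    have "trace_mat (D * transpose_mat D) = trace_mat (M * transpose_mat D) - trace_mat (cder.cov n U C * transpose_mat D)"
      using Mc W Dt unfolding D_def by (simp add: sq_simps(4)[of _ n] trace_sq[of _ n] del: transpose_carrier_mat)
    then have "integral {0..2 * pi} (cval (trace_mat (D * transpose_mat D)))
      = integral {0..2 * pi} (\<lambda>x. cval (trace_mat (M * transpose_mat D)) x - cval (trace_mat (cder.cov n U C * transpose_mat D)) x)"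
      by (intro arg_cong[of _ _ "integral {0..2 * pi}"] ext) simp
    also have "\<dots> = 0"
      using cval_integrable eq by (subst Henstock_Kurzweil_Integration.integral_diff) auto
    finally have "D = 0\<^sub>m n n" by (rule V_shape_eq_0_if_pairing[OF DV])
    moreover have "M = D + cder.cov n U C" unfolding D_def by (rule eq_matI) (use Mc W in auto)
    ultimately have "M = cder.cov n U C" using sq_units(5)[OF W] by simp
    then show "w = mat_at (cder.cov n U C)" using M(2) by simp
  qed
qed

lemma has_functional_gradient_uminus:
  assumes "has_functional_gradient n F u (\<lambda>x. pi0 n (mat_at A x))" and A: "A \<in> carrier_mat n n"
  shows "has_functional_gradient n (\<lambda>u. - F u) u (\<lambda>x. pi0 n (mat_at (- A) x))"
proof -
  have pi: "pi0 n (mat_at (- A) x) = - pi0 n (mat_at A x)" for x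
    using A by (auto simp: pi0_def intro!: eq_matI)
  have "pairing n (\<lambda>x. - pi0 n (mat_at A x)) v = - pairing n (\<lambda>x. pi0 n (mat_at A x)) v"
    if "v \<in> smooth_maps n (V_mats n)" for v
  proof -
    have "trace_mat (- pi0 n (mat_at A x) * v x) = - trace_mat (pi0 n (mat_at A x) * v x)" for x
    proof -
      have "v x \<in> carrier_mat n n" using that by (simp add: smooth_maps_def V_mats_def)
      moreover have "pi0 n (mat_at A x) \<in> carrier_mat n n" by (simp add: pi0_def)
      ultimately have "- pi0 n (mat_at A x) * v x = - (pi0 n (mat_at A x) * v x)"
        by (auto simp: uminus_mult_left_mat)
      moreover have "pi0 n (mat_at A x) * v x \<in> carrier_mat n n"
        using \<open>v x \<in> carrier_mat n n\<close> \<open>pi0 n (mat_at A x) \<in> carrier_mat n n\<close> by simp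
      ultimately show ?thesis by (simp add: trace_uminus_sq[of _ n])
    qed
    then show ?thesis by (simp add: pairing_def)
  qed
  moreover have "(\<lambda>x. - pi0 n (mat_at A x)) \<in> smooth_maps n (Vt_mats n)"
  proof -
    let ?M = "mat n n (\<lambda>(k, l). if k = n - 1 \<and> l < n - 1 then - A $$ (k, l) else 0)"
    have "(\<lambda>x. - pi0 n (mat_at A x)) = mat_at ?M"
      by (rule ext, rule eq_matI) (use A in \<open>auto simp: pi0_def\<close>)
    then show ?thesis by (auto intro!: smooth_maps_mat_at simp: Vt_mats_def)
  qed
  ultimately show ?thesis
    using assms(1) unfolding has_functional_gradient_def pi by (auto intro!: DERIV_minus)
qed

section \<open>Curves and their central affine curvature\<close>

lemma sq_cancel:
  fixes A B C :: "'a::comm_ring_1 mat"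
  assumes "A \<in> carrier_mat n n" "B \<in> carrier_mat n n" "C \<in> carrier_mat n n"
  shows "B + (A - B) = A" "A + (B - C) + C = A + B"
  using assms by (auto intro!: eq_matI)

definition frame_mat :: "('a \<Rightarrow> 'a) \<Rightarrow> nat \<Rightarrow> (nat \<Rightarrow> 'a) \<Rightarrow> 'a mat" where
  "frame_mat d n c = mat n n (\<lambda>(i, j). (d ^^ j) (c i))"

lemma frame_mat_carrier [simp]: "frame_mat d n c \<in> carrier_mat n n"
  by (simp add: frame_mat_def)

lemma map_frame_mat:
  assumes "\<And>a. h (d a) = e (h a)"
  shows "map_mat h (frame_mat d n c) = frame_mat e n (\<lambda>i. h (c i))"
proof -
  have "h ((d ^^ j) a) = (e ^^ j) (h a)" for j a
    by (induction j) (simp_all add: assms)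
  then show ?thesis by (auto intro!: eq_matI simp: frame_mat_def)
qed

lemma adj_mat_inverse:
  fixes G :: "'a::comm_ring_1 mat"
  assumes "G \<in> carrier_mat n n" "det G = 1"
  shows "adj_mat G \<in> carrier_mat n n" "adj_mat G * G = 1\<^sub>m n" "G * adj_mat G = 1\<^sub>m n"
  using adj_mat[OF assms(1)] assms(2) by (auto intro!: eq_matI)

lemma (in comm_ring_hom) hom_adj_mat:
  assumes "A \<in> carrier_mat n n"
  shows "map_mat hom (adj_mat A) = adj_mat (map_mat hom A)"
proof -
  have "map_mat hom (mat_delete A i j) = mat_delete (map_mat hom A) i j" if "i < n" "j < n" for i j
    using assms that by (auto intro!: eq_matI simp: mat_delete_def)
  then have "hom (cofactor A i j) = cofactor (map_mat hom A) i j" if "i < n" "j < n" for i j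
    using that by (simp add: cofactor_def hom_distribs flip: hom_det)
  then show ?thesis using assms by (auto intro!: eq_matI simp: adj_mat_def)
qed

section \<open>Frames over a differential ring\<close>

context diff_ring
begin

text \<open>Every column of \<open>d G\<close> but the last is the next column of \<open>G\<close>,
  so those columns of \<open>G^-1 d G\<close> are the ones of \<open>b_mat\<close>. The last column
  leaves only the corner entry to be checked.\<close>

lemma frame_mat_curvature:
  assumes n: "n \<ge> 2" and G: "G = frame_mat d n c" "det G = 1"
  shows "\<exists>U. V_shape n U \<and> map_mat d G = G * (b_mat n + U)"
proof -
  have Gc: "G \<in> carrier_mat n n" using G by simp
  note A = adj_mat_inverse[OF Gc G(2)]
  let ?A = "adj_mat G"
  have dG: "map_mat d G \<in> carrier_mat n n" using Gc by simp
  define U where "U = ?A * map_mat d G - b_mat n"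
  have U: "U \<in> carrier_mat n n" by (simp add: U_def)
  have AdG: "?A * map_mat d G \<in> carrier_mat n n" using A dG by simp
  have bU: "b_mat n + U = ?A * map_mat d G"
    unfolding U_def by (rule sq_cancel(1)[OF AdG]) (rule b_mat_carrier)+
  have "G * (b_mat n + U) = map_mat d G"
    unfolding bU using A dG Gc by (simp add: sq_simps(1)[of _ n, symmetric] sq_units[of _ n])
  moreover have "V_shape n U"
  proof -
    have zero: "U $$ (r, s) = 0" if rs: "r < n" "s < n - 1" for r s
    proof -
      have s: "s < n" "Suc s < n" using rs by auto
      have "(?A * map_mat d G) $$ (r, s) = (\<Sum>i<n. ?A $$ (r, i) * map_mat d G $$ (i, s))"
        by (rule sq_mult_entry[OF A(1) dG rs(1) s(1)])
      also have "\<dots> = (\<Sum>i<n. ?A $$ (r, i) * G $$ (i, Suc s))"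
        using s by (intro sum.cong) (auto simp: G(1) frame_mat_def)
      also have "\<dots> = (?A * G) $$ (r, Suc s)"
        by (rule sq_mult_entry[OF A(1) Gc rs(1) s(2), symmetric])
      also have "\<dots> = b_mat n $$ (r, s)" unfolding A(2) using rs s by (auto simp: b_mat_def)
      finally show ?thesis using rs s AdG by (simp add: U_def del: index_mult_mat(1))
    qed
    \<comment> \<open>By Jacobi's formula, since the constant determinant makes the trace vanish and
      the trace of \<open>U\<close> is its corner entry.\<close>
    have "trace_mat (?A * map_mat d G) = d (det G)" by (rule jacobi_formula[OF Gc, symmetric])
    also have "\<dots> = 0" by (simp add: G(2))
    finally have "trace_mat U = 0"
      unfolding U_def using AdG by (simp add: trace_sq[of _ n] trace_mat_def[of "b_mat n"]) (simp add: b_mat_def)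
    moreover have "trace_mat U = (\<Sum>i<n. if i = n - 1 then U $$ (i, i) else 0)"
      unfolding trace_mat_def using U zero by (intro sum.cong) auto
    moreover have "(\<Sum>i<n. if i = n - 1 then U $$ (i, i) else 0) = U $$ (n - 1, n - 1)"
      using n by (subst sum.delta) auto
    ultimately have "U $$ (n - 1, n - 1) = 0" by simp
    moreover have "k = n - 1 \<or> k < n - 1" if "k < n" for k using that by linarith
    ultimately show ?thesis unfolding V_shape_def using U zero by metis
  qed
  ultimately show ?thesis by metis
qed

text \<open>\<open>d (G C) = G C (b + U) + G (cov n U C)\<close>, and the second term lives in the
  last column. Hence differentiation shifts the columns of \<open>G C\<close>: a velocity
  \<open>G C e_1\<close> of the curve makes the frame move with velocity \<open>G C\<close>.\<close>

lemma frame_mat_of_cov: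
  assumes n: "n \<ge> 2" and U: "V_shape n U" and G: "G \<in> carrier_mat n n" "map_mat d G = G * (b_mat n + U)"
    and C: "C \<in> carrier_mat n n" "V_shape n (cov n U C)"
  shows "frame_mat d n (\<lambda>i. (G * C) $$ (i, 0)) = G * C"
proof -
  have Uc: "U \<in> carrier_mat n n" using U by (rule V_shape_carrier)
  have bU: "b_mat n + U \<in> carrier_mat n n" using Uc by simp
  have GC: "G * C \<in> carrier_mat n n" using G C by simp
  have CbU: "C * (b_mat n + U) \<in> carrier_mat n n" using C bU by simp
  have cov: "cov n U C \<in> carrier_mat n n" using Uc C by simp
  have "map_mat d (G * C) = G * (cov n U C + C * (b_mat n + U))"
  proof -
    have "cov n U C + C * (b_mat n + U) = map_mat d C + (b_mat n + U) * C"
      unfolding cov_def commutator_def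
      by (rule sq_cancel(2)[of _ n]) (use C bU in auto)
    moreover have "map_mat d (G * C) = G * ((b_mat n + U) * C) + G * map_mat d C"
      unfolding mat_mult[OF G(1) C(1)] G(2) using G C bU by (simp add: sq_simps(1)[of _ n] del: add_carrier_mat)
    moreover have "G * (map_mat d C + (b_mat n + U) * C) = G * map_mat d C + G * ((b_mat n + U) * C)"
      using G C bU by (intro sq_simps(3)[of _ n]) auto
    moreover have "G * ((b_mat n + U) * C) + G * map_mat d C = G * map_mat d C + G * ((b_mat n + U) * C)"
      using G C bU by (intro comm_add_mat[of _ n n]) auto
    ultimately show ?thesis by simp
  qed
  then have step: "d ((G * C) $$ (i, s)) = (G * C) $$ (i, Suc s)" if i: "i < n" and s: "s < n - 1" for i s
  proof -
    have s': "s < n" "Suc s < n" using s by auto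
    have "d ((G * C) $$ (i, s)) = map_mat d (G * C) $$ (i, s)"
      using i s' GC by (intro index_map_mat(1)[symmetric]) auto
    also have "\<dots> = (G * (cov n U C + C * (b_mat n + U))) $$ (i, s)"
      using \<open>map_mat d (G * C) = _\<close> by simp
    also have "\<dots> = (\<Sum>k<n. G $$ (i, k) * (cov n U C + C * (b_mat n + U)) $$ (k, s))"
      using cov CbU by (intro sq_mult_entry[OF G(1) _ i s'(1)]) simp
    also have "\<dots> = (\<Sum>k<n. G $$ (i, k) * C $$ (k, Suc s))"
    proof (intro sum.cong refl arg_cong2[where f = "(*)"])
      fix k assume k: "k \<in> {..<n}"
      have "cov n U C $$ (k, s) = 0" using C(2) k s s' by (simp add: V_shape_def)
      moreover have "(C * (b_mat n + U)) $$ (k, s) = C $$ (k, Suc s)"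
        using k s by (intro mult_b_U_entry[OF U C(1)]) auto
      ultimately show "(cov n U C + C * (b_mat n + U)) $$ (k, s) = C $$ (k, Suc s)"
        using k s' C(1) Uc by (auto simp del: index_mult_mat(1))
    qed
    also have "\<dots> = (G * C) $$ (i, Suc s)" by (rule sq_mult_entry[OF G(1) C(1) i s'(2), symmetric])
    finally show ?thesis .
  qed
  have "s < n \<Longrightarrow> i < n \<Longrightarrow> (d ^^ s) ((G * C) $$ (i, 0)) = (G * C) $$ (i, s)" for i s
    by (induction s) (auto simp: step simp del: index_mult_mat(1))
  note col = this
  show ?thesis
  proof (rule eq_matI)
    fix i s assume "i < dim_row (G * C)" "s < dim_col (G * C)"
    then have "i < n" "s < n" using GC by (metis carrier_matD)+
    then show "frame_mat d n (\<lambda>i. (G * C) $$ (i, 0)) $$ (i, s) = (G * C) $$ (i, s)"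
      using col by (simp add: frame_mat_def del: index_mult_mat(1))
  qed (use GC in \<open>auto simp: frame_mat_def\<close>)
qed

text \<open>The coefficients in Leibniz' formula \<open>d\<^sup>j (a f) = \<Sum>\<^sub>k leibniz a j k \<cdot> d\<^sup>k f\<close>.\<close>
primrec leibniz :: "'a \<Rightarrow> nat \<Rightarrow> nat \<Rightarrow> 'a" where
  "leibniz a 0 = (\<lambda>k. if k = 0 then a else 0)"
| "leibniz a (Suc j) = (\<lambda>k. d (leibniz a j k) + (if k = 0 then 0 else leibniz a j (k - 1)))"

lemma leibniz_0: "k > j \<Longrightarrow> leibniz a j k = 0"
  by (induction j arbitrary: k) auto

lemma leibniz_diag: "leibniz a j j = a"
  by (induction j) (simp_all add: leibniz_0)

lemma power_derivation_mult: "(d ^^ j) (a * f) = (\<Sum>k\<le>j. (d ^^ k) f * leibniz a j k)"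
proof (induction j)
  case (Suc j)
  have "(d ^^ Suc j) (a * f) = (\<Sum>k\<le>j. (d ^^ Suc k) f * leibniz a j k) + (\<Sum>k\<le>j. (d ^^ k) f * d (leibniz a j k))"
    using Suc by (simp add: sum mult sum.distrib)
  also have "(\<Sum>k\<le>j. (d ^^ k) f * d (leibniz a j k)) = (\<Sum>k\<le>Suc j. (d ^^ k) f * d (leibniz a j k))"
    by (simp add: leibniz_0)
  also have "(\<Sum>k\<le>j. (d ^^ Suc k) f * leibniz a j k)
      = (\<Sum>k\<le>Suc j. (d ^^ k) f * (if k = 0 then 0 else leibniz a j (k - 1)))"
    by (subst sum.atMost_Suc_shift) simp
  finally show ?case by (simp add: sum.distrib[symmetric] algebra_simps del: sum.atMost_Suc funpow.simps)
qed (simp add: mult.commute)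

text \<open>By Leibniz' rule the scaled frame is the old one times an upper triangular matrix with
  diagonal \<open>a\<close>. This explains the \<open>n\<close>-th root in
  \<open>curve_path_exists\<close>.\<close>

lemma det_frame_mat_scale: "det (frame_mat d n (\<lambda>i. a * c i)) = a ^ n * det (frame_mat d n c)"
proof -
  define L where "L = mat n n (\<lambda>(k, j). leibniz a j k)"
  have L: "L \<in> carrier_mat n n" by (simp add: L_def)
  have "frame_mat d n (\<lambda>i. a * c i) = frame_mat d n c * L"
  proof (rule eq_matI)
    fix i j assume "i < dim_row (frame_mat d n c * L)" "j < dim_col (frame_mat d n c * L)"
    then have ij: "i < n" "j < n" by (auto simp: frame_mat_def L_def)
    have "(frame_mat d n c * L) $$ (i, j) = (\<Sum>k<n. (d ^^ k) (c i) * leibniz a j k)"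
      unfolding sq_mult_entry[OF frame_mat_carrier L ij] using ij by (simp add: frame_mat_def L_def)
    also have "\<dots> = (\<Sum>k\<le>j. (d ^^ k) (c i) * leibniz a j k)"
      using ij by (intro sum.mono_neutral_right) (auto simp: leibniz_0)
    finally show "frame_mat d n (\<lambda>i. a * c i) $$ (i, j) = (frame_mat d n c * L) $$ (i, j)"
      using ij by (simp add: frame_mat_def power_derivation_mult)
  qed (auto simp: frame_mat_def L_def)
  moreover have "det L = a ^ n"
  proof -
    have "det L = prod_list (diag_mat L)"
      by (rule det_upper_triangular[OF _ L]) (auto simp: upper_triangular_def L_def leibniz_0)
    also have "diag_mat L = replicate n a"
      by (rule nth_equalityI) (auto simp: diag_mat_def L_def leibniz_diag)
    finally show ?thesis by simp
  qed
  ultimately show ?thesis by (simp add: det_mult[OF frame_mat_carrier L] mult.commute)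
qed

end

lemma cval_funpow_cder: "cval ((cder ^^ j) f) = (deriv ^^ j) (cval f)"
  by (induction j) (simp_all add: cval_cder)

text \<open>Meaningful for \<open>i < n\<close>, where the coordinates of a curve in
  \<open>curves n\<close> are smooth and periodic.\<close>

definition curve_coords :: "(real \<Rightarrow> real vec) \<Rightarrow> nat \<Rightarrow> cfun" where
  "curve_coords \<gamma> i = Abs_cfun (\<lambda>x. \<gamma> x $ i)"

lemma cval_curve_coords:
  "\<gamma> \<in> curves n \<Longrightarrow> i < n \<Longrightarrow> cval (curve_coords \<gamma> i) = (\<lambda>x. \<gamma> x $ i)"
  by (simp add: curve_coords_def curves_def cval_Abs_cfun)

lemma frame_eq:
  fixes \<gamma> :: "real \<Rightarrow> real vec"
  assumes "\<And>i. i < n \<Longrightarrow> cval (c i) = (\<lambda>x. \<gamma> x $ i)"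
  shows "frame n \<gamma> = mat_at (frame_mat cder n c)"
  by (rule ext, rule eq_matI) (auto simp: frame_def frame_mat_def cval_funpow_cder assms)

lemma curves_frame_mat:
  assumes "\<gamma> \<in> curves n"
  shows "frame n \<gamma> = mat_at (frame_mat cder n (curve_coords \<gamma>))"
    and "det (frame_mat cder n (curve_coords \<gamma>)) = 1"
proof -
  show eq: "frame n \<gamma> = mat_at (frame_mat cder n (curve_coords \<gamma>))"
    by (rule frame_eq) (rule cval_curve_coords[OF assms])
  show "det (frame_mat cder n (curve_coords \<gamma>)) = 1"
  proof (rule cfun_eqI)
    fix x
    have "det (frame n \<gamma> x) = 1" using assms by (simp add: curves_def)
    then show "cval (det (frame_mat cder n (curve_coords \<gamma>))) x = cval 1 x"
      unfolding eq cval.hom_det by simp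
  qed
qed

lemma curvature_eq:
  assumes n: "n \<ge> 2" and \<gamma>: "\<gamma> \<in> curves n" and U: "cder.V_shape n U"
    and G: "G = frame_mat cder n (curve_coords \<gamma>)" "map_mat cder G = G * (b_mat n + U)"
  shows "curvature n \<gamma> = mat_at U"
  unfolding curvature_def
proof (rule the_equality)
  have Uc: "U \<in> carrier_mat n n" using U by (rule cder.V_shape_carrier)
  have Gc: "G \<in> carrier_mat n n" by (simp add: G(1))
  have detG: "det G = 1" unfolding G(1) by (rule curves_frame_mat(2)[OF \<gamma>])
  note A = adj_mat_inverse[OF Gc detG]
  have fr: "frame n \<gamma> = mat_at G" unfolding G(1) by (rule curves_frame_mat(1)[OF \<gamma>])
  have at: "mat_at (b_mat n + V) x = b_mat n + mat_at V x" if "V \<in> carrier_mat n n" for V x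
    using that by (simp add: cval.map_mat_add[of _ n n] map_mat_b_mat)
  have dfr: "mat_deriv n (frame n \<gamma>) x = mat_at (map_mat cder G) x" for x
    unfolding fr by (rule mat_deriv_mat_at[OF Gc])
  have mult: "frame n \<gamma> x * (b_mat n + mat_at V x) = mat_at (G * (b_mat n + V)) x" if "V \<in> carrier_mat n n" for V x
    unfolding fr at[OF that, symmetric] using Gc that by (intro cval.mat_hom_mult[of _ n n _ n, symmetric]) auto
  show "mat_at U \<in> smooth_maps n (V_mats n) \<and> (\<forall>x. mat_deriv n (frame n \<gamma>) x = frame n \<gamma> x * (b_mat n + mat_at U x))"
    using mat_at_smooth_V[OF U] by (simp add: dfr mult[OF Uc] G(2))
  fix u
  assume u: "u \<in> smooth_maps n (V_mats n) \<and> (\<forall>x. mat_deriv n (frame n \<gamma>) x = frame n \<gamma> x * (b_mat n + u x))"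
  then obtain V where V: "cder.V_shape n V" "u = mat_at V" using ex_V_shape_mat_at by blast
  have Vc: "V \<in> carrier_mat n n" using V(1) by (rule cder.V_shape_carrier)
  have "map_mat cder G = G * (b_mat n + V)"
    by (rule mat_at_eqI[of _ n n]) (use u V Gc Vc dfr mult[OF Vc] in auto)
  then have "G * (b_mat n + V) = G * (b_mat n + U)" using G(2) by simp
  then have "adj_mat G * (G * (b_mat n + V)) = adj_mat G * (G * (b_mat n + U))" by simp
  then have bUV: "b_mat n + V = b_mat n + U"
    using A Gc Uc Vc by (simp add: sq_simps(1)[of _ n, symmetric] sq_units[of _ n])
  have "V = U"
  proof (rule eq_matI)
    fix i j assume ij: "i < dim_row U" "j < dim_col U"
    then have "(b_mat n + V) $$ (i, j) = (b_mat n + U) $$ (i, j)" using bUV by simp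
    then show "V $$ (i, j) = U $$ (i, j)" using ij Uc Vc by simp
  qed (use Uc Vc in auto)
  then show "u = mat_at U" using V by simp
qed

lemma curves_curvature:
  assumes n: "n \<ge> 2" and \<gamma>: "\<gamma> \<in> curves n"
  obtains U where "cder.V_shape n U" "curvature n \<gamma> = mat_at U"
    "map_mat cder (frame_mat cder n (curve_coords \<gamma>)) = frame_mat cder n (curve_coords \<gamma>) * (b_mat n + U)"
  using cder.frame_mat_curvature[OF n refl curves_frame_mat(2)[OF \<gamma>]] curvature_eq[OF n \<gamma> _ refl] by blast

subsection \<open>Paths of curves\<close>

text \<open>The tube lemma over one compact period gives a uniform time interval; periodicity
  extends it to all \<open>x\<close>.\<close>

lemma eventually_positive_near_0:
  fixes f :: "real \<times> real \<Rightarrow> real"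
  assumes cont: "continuous_on UNIV f" and per: "\<And>t x. f (t, x + 2 * pi) = f (t, x)" and pos: "\<And>x. f (0, x) > 0"
  obtains e where "e > 0" "\<And>t x. \<bar>t\<bar> < e \<Longrightarrow> f (t, x) > 0"
proof -
  have "open (f -` {0<..})"
    using cont by (intro open_vimage) auto
  moreover have "{0} \<times> {0..2 * pi} \<subseteq> f -` {0<..}" using pos by auto
  ultimately obtain A where A: "0 \<in> A" "open A" "A \<times> {0..2 * pi} \<subseteq> f -` {0<..}"
    using tube_lemma[of "{0..2 * pi}" "f -` {0<..}" 0] by auto
  obtain e where e: "e > 0" "ball 0 e \<subseteq> A" using A(1,2) open_contains_ball by metis
  show thesis
  proof (rule that[OF e(1)])
    fix t x :: real assume t: "\<bar>t\<bar> < e"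
    define k where "k = \<lfloor>x / (2 * pi)\<rfloor>"
    define y where "y = x - 2 * pi * of_int k"
    have "of_int k \<le> x / (2 * pi)" "x / (2 * pi) < of_int k + 1" by (auto simp: k_def)
    then have "y \<in> {0..2 * pi}" by (auto simp: y_def field_simps)
    moreover have "t \<in> A" using e t by (auto simp: dist_real_def)
    ultimately have "(t, y) \<in> f -` {0<..}" using A(3) by blast
    then have "f (t, y) > 0" by simp
    moreover have "f (t, y + 2 * pi * of_int k) = f (t, y)"
      by (rule circle_smooth_periodic_int[of "\<lambda>x. f (t, x)"]) (rule per)
    ultimately show "f (t, x) > 0" by (simp add: y_def)
  qed
qed

lemma curves_nonzero:
  assumes "det (frame n \<gamma> x) = 1" "n > 0"
  shows "\<gamma> x \<noteq> 0\<^sub>v n"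
proof
  assume z: "\<gamma> x = 0\<^sub>v n"
  have F: "frame n \<gamma> x \<in> carrier_mat n n" by (simp add: frame_def)
  note A = adj_mat_inverse[OF F assms(1)]
  have "(adj_mat (frame n \<gamma> x) * frame n \<gamma> x) $$ (0, 0) = (\<Sum>i<n. adj_mat (frame n \<gamma> x) $$ (0, i) * frame n \<gamma> x $$ (i, 0))"
    by (rule sq_mult_entry[OF A(1) F assms(2) assms(2)])
  also have "\<dots> = 0" using assms(2) z by (intro sum.neutral) (auto simp: frame_def)
  finally show False using assms(2) by (simp add: A(2))
qed

text \<open>
  The path \<open>\<gamma> + t X\<close> is rescaled by the \<open>n\<close>-th root of the determinant of its frame. When \<open>X\<close> is
  tangent, this determinant is \<open>1 + O(t\<^sup>2)\<close>, so that the velocity is not changed.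
\<close>
lemma curve_path_exists:
  fixes X :: "real \<Rightarrow> real vec"
  assumes n: "n \<ge> 2" and \<gamma>: "\<gamma> \<in> curves n" and U: "cder.V_shape n U"
    and G: "G = frame_mat cder n (curve_coords \<gamma>)" "map_mat cder G = G * (b_mat n + U)"
    and C: "C \<in> carrier_mat n n" "cder.V_shape n (cder.cov n U C)" "trace_mat C = 0"
    and X: "\<And>x i. i < n \<Longrightarrow> X x $ i = cval ((G * C) $$ (i, 0)) x"
  shows "\<exists>c. curve_path n \<gamma> X c"
proof -
  have n0: "n > 0" using n by simp
  have Gc: "G \<in> carrier_mat n n" by (simp add: G(1))
  have detG: "det G = 1" unfolding G(1) by (rule curves_frame_mat(2)[OF \<gamma>])
  define b where "b i = sconst (curve_coords \<gamma> i) + stime * sconst ((G * C) $$ (i, 0))" for i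
  define D where "D = det (frame_mat sdx n b)"
  have b_at: "sval (b i) (t, x) = \<gamma> x $ i + t * X x $ i" if "i < n" for i t x
    using that X cval_curve_coords[OF \<gamma> that] by (simp add: b_def del: index_mult_mat(1))
  have fr: "map_mat (sfreeze t) (frame_mat sdx n b) = frame_mat cder n (\<lambda>i. sfreeze t (b i))" for t
    by (rule map_frame_mat) (simp add: cder_sfreeze)
  have D_at: "sfreeze t D = det (frame_mat cder n (\<lambda>i. sfreeze t (b i)))" for t
    by (simp add: D_def sfreeze.hom_det[symmetric] fr)
  have b0: "sfreeze 0 (b i) = curve_coords \<gamma> i" for i
    by (rule cfun_eqI) (simp add: b_def)
  have D0: "sval D (0, x) = 1" for x
  proof -
    have "sfreeze 0 D = 1" unfolding D_at b0 using detG G(1) by simp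
    then have "cval (sfreeze 0 D) x = cval 1 x" by simp
    then show ?thesis by simp
  qed
  \<comment> \<open>By Jacobi's formula the derivative is the trace of
    \<open>G^-1 (G C) = C\<close>, which is zero.\<close>
  have dtD: "sval (sdt D) (0, x) = 0" for x
  proof -
    let ?F = "frame_mat sdx n b"
    have "sdt D = trace_mat (adj_mat ?F * map_mat sdt ?F)"
      unfolding D_def by (rule sdt.jacobi_formula[where n = n]) simp
    moreover have "map_mat sdt ?F = frame_mat sdx n (\<lambda>i. sdt (b i))"
      by (rule map_frame_mat) (rule sdt_sdx)
    moreover have "sdt (b i) = sconst ((G * C) $$ (i, 0))" for i
      by (simp add: b_def sdt.add sdt.mult sdt_sconst sdt_stime)
    ultimately have dt: "sdt D = trace_mat (adj_mat ?F * frame_mat sdx n (\<lambda>i. sconst ((G * C) $$ (i, 0))))"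
      by simp
    have A: "adj_mat ?F \<in> carrier_mat n n" by (rule adj_mat(1)) simp
    have "sfreeze 0 (sdt D) = trace_mat (map_mat (sfreeze 0) (adj_mat ?F) * map_mat (sfreeze 0) (frame_mat sdx n (\<lambda>i. sconst ((G * C) $$ (i, 0)))))"
      unfolding dt using A by (simp add: sfreeze.hom_trace[of _ n] sfreeze.mat_hom_mult[of _ n n _ n])
    also have "map_mat (sfreeze 0) (adj_mat ?F) = adj_mat G"
      by (simp add: sfreeze.hom_adj_mat[of _ n] fr b0 G(1))
    also have "map_mat (sfreeze 0) (frame_mat sdx n (\<lambda>i. sconst ((G * C) $$ (i, 0)))) = G * C"
    proof -
      have "map_mat (sfreeze 0) (frame_mat sdx n (\<lambda>i. sconst ((G * C) $$ (i, 0))))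
        = frame_mat cder n (\<lambda>i. sfreeze 0 (sconst ((G * C) $$ (i, 0))))"
        by (rule map_frame_mat) (simp add: cder_sfreeze)
      also have "(\<lambda>i. sfreeze 0 (sconst ((G * C) $$ (i, 0)))) = (\<lambda>i. (G * C) $$ (i, 0))"
        by (intro ext cfun_eqI) simp
      finally show ?thesis using cder.frame_mat_of_cov[OF n U Gc G(2) C(1,2)] by simp
    qed
    also have "adj_mat G * (G * C) = C"
      using adj_mat_inverse[OF Gc detG] Gc C by (simp add: sq_simps(1)[of _ n, symmetric] sq_units[of _ n])
    finally have "cval (sfreeze 0 (sdt D)) x = cval 0 x" using C(3) by simp
    then show ?thesis by simp
  qed
  obtain e where e: "e > 0" "\<And>t x. \<bar>t\<bar> < e \<Longrightarrow> sval D (t, x) > 0"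
    by (rule eventually_positive_near_0[OF smooth_on_continuous_on[OF smooth_on_sval[of D]]])
      (use sval[of D] D0 in auto)
  \<comment> \<open>The frame determinant scales with the \<open>n\<close>-th power of the factor,
    so this exponent normalizes it to \<open>1\<close>.\<close>
  define \<rho> where "\<rho> p = sval D p powr (- 1 / real n)" for p
  define c where "c t x = vec n (\<lambda>i. \<rho> (t, x) * sval (b i) (t, x))" for t x
  let ?S = "{- e<..<e} \<times> (UNIV :: real set)"
  have S: "open ?S" by (intro open_Times) auto
  have smooth_\<rho>: "smooth_on ?S \<rho>"
    unfolding \<rho>_def using e by (intro smooth_on_powr[OF S] smooth_on_subset[OF smooth_on_sval]) auto
  have curves: "c t \<in> curves n" if t: "t \<in> {- e<..<e}" for t
  proof -
    have pos: "cval (sfreeze t D) x > 0" for x using e(2)[of t x] t by auto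
    have "circle_smooth (\<lambda>x. cval (sfreeze t D) x powr (- 1 / real n))"
      using circle_smooth_cval[of "sfreeze t D"] pos
      by (auto simp: circle_smooth_def simp del: cval_sfreeze intro!: smooth_on_powr)
    then obtain R where R: "cval R = (\<lambda>x. \<rho> (t, x))"
      using cval_Abs_cfun by (fastforce simp: \<rho>_def)
    have comp: "cval (R * sfreeze t (b i)) = (\<lambda>x. c t x $ i)" if "i < n" for i
      using that R by (auto simp: c_def times_cfun.rep_eq)
    have "frame n (c t) = mat_at (frame_mat cder n (\<lambda>i. R * sfreeze t (b i)))"
      by (rule frame_eq) (rule comp)
    then have "det (frame n (c t) x) = cval (det (frame_mat cder n (\<lambda>i. R * sfreeze t (b i)))) x" for x
      by (simp only: cval.hom_det)
    also have "det (frame_mat cder n (\<lambda>i. R * sfreeze t (b i))) = R ^ n * sfreeze t D"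
      unfolding D_at by (rule cder.det_frame_mat_scale)
    also have "cval (R ^ n * sfreeze t D) x = 1" for x
    proof -
      have "cval (R ^ n) x = (\<rho> (t, x)) ^ n" using R by (simp add: cval.hom_power)
      also have "\<dots> = sval D (t, x) powr (- 1)"
        unfolding \<rho>_def using pos[of x] n0 by (simp add: powr_power)
      also have "\<dots> = 1 / sval D (t, x)" using pos[of x] by (simp add: powr_minus_divide)
      finally show ?thesis using pos[of x] by simp
    qed
    finally have det: "det (frame n (c t) x) = 1" for x .
    have "circle_smooth (\<lambda>x. c t x $ i)" if "i < n" for i
      using comp[OF that] circle_smooth_cval by metis
    then show ?thesis
      using det curves_nonzero[OF det n0] by (auto simp: curves_def) (simp add: c_def)
  qed
  have "smooth_on ?S (\<lambda>(t, x). c t x $ i)" if "i < n" for i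
  proof -
    have "(\<lambda>(t, x). c t x $ i) = (\<lambda>p. \<rho> p * sval (b i) p)" using that by (auto simp: c_def)
    then show ?thesis
      using smooth_on_mult[OF S smooth_\<rho> smooth_on_subset[OF smooth_on_sval]] by simp
  qed
  moreover have "c 0 = \<gamma>"
  proof
    fix x
    have "\<gamma> x \<in> carrier_vec n" using \<gamma> by (simp add: curves_def)
    then show "c 0 x = \<gamma> x" by (auto simp: c_def \<rho>_def D0 b_at)
  qed
  moreover have "((\<lambda>t. c t x $ i) has_real_derivative X x $ i) (at 0)" if i: "i < n" for x i
  proof -
    have "((\<lambda>t. sval D (t, x) powr (- 1 / real n)) has_real_derivative
        (- 1 / real n * sval D (0, x) powr (- 1 / real n - 1)) * sval (sdt D) (0, x)) (at 0)"
      by (rule DERIV_chain2[OF has_real_derivative_powr sval_sdt]) (simp add: D0)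
    then have "((\<lambda>t. \<rho> (t, x)) has_real_derivative 0) (at 0)" by (simp add: dtD \<rho>_def)
    moreover have "((\<lambda>t. \<gamma> x $ i + t * X x $ i) has_real_derivative X x $ i) (at 0)"
      by (auto intro!: derivative_eq_intros)
    ultimately have "((\<lambda>t. \<rho> (t, x) * (\<gamma> x $ i + t * X x $ i)) has_real_derivative
        0 * (\<gamma> x $ i + 0 * X x $ i) + X x $ i * \<rho> (0, x)) (at 0)"
      by (rule DERIV_mult)
    then show ?thesis using i by (simp add: c_def b_at \<rho>_def D0)
  qed
  ultimately have "curve_path n \<gamma> X c"
    unfolding curve_path_def using e(1) curves by blast
  then show ?thesis by blast
qed

text \<open>The \<open>t\<close>-derivative commutes with the \<open>x\<close>-derivatives, so the
  velocity of the curve determines the velocities of all columns of its frame.\<close>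

lemma path_derivative:
  fixes F :: "real \<times> real \<Rightarrow> real"
  assumes e: "e > 0" and F: "smooth_on ({- e<..<e} \<times> UNIV) F"
    and \<xi>: "\<And>y. ((\<lambda>t. F (t, y)) has_real_derivative \<xi> y) (at 0)"
  shows "((\<lambda>t. (deriv ^^ k) (\<lambda>y. F (t, y)) x) has_real_derivative (deriv ^^ k) \<xi> x) (at 0)"
proof -
  let ?S = "{- e<..<e} \<times> (UNIV :: real set)"
  have S: "open ?S" by (intro open_Times) auto
  define Fk where "Fk k = (pd2 ^^ k) F" for k
  have Fk: "Fk 0 = F" "Fk (Suc k) = pd2 (Fk k)" for k by (simp_all add: Fk_def)
  have smooth: "smooth_on ?S (Fk k)" for k
    by (induction k) (simp_all add: Fk F smooth_on_frechet_derivative)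
  have diff: "Fk k differentiable (at (t, y))" if "t \<in> {- e<..<e}" for k t y
    using smooth_on_differentiable[OF smooth] that by auto
  have der: "(deriv ^^ k) (\<lambda>y. F (t, y)) = (\<lambda>y. Fk k (t, y))" if t: "t \<in> {- e<..<e}" for k t
  proof (induction k)
    case (Suc k)
    then show ?case
      using DERIV_imp_deriv[OF partial_derivatives(2)[OF diff[OF t]]] by (simp add: Fk)
  qed (simp add: Fk)
  have 0: "0 \<in> {- e<..<e}" using e by simp
  have pd1: "pd1 (Fk k) (0, y) = (deriv ^^ k) \<xi> y" for k y
  proof (induction k arbitrary: y)
    case 0
    have "((\<lambda>s. F (s, y)) has_real_derivative pd1 F (0, y)) (at 0)"
      using partial_derivatives(1)[of F 0 y] diff[of 0 0 y] e Fk by simp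
    from DERIV_unique[OF this \<xi>] show ?case by (simp add: Fk)
  next
    case (Suc k)
    have "pd1 (Fk (Suc k)) (0, y) = pd2 (pd1 (Fk k)) (0, y)"
      unfolding Fk using e by (intro partial_derivatives_commute[OF S smooth]) auto
    also have "\<dots> = deriv (\<lambda>y. pd1 (Fk k) (0, y)) y"
    proof -
      have "smooth_on ?S (pd1 (Fk k))" by (rule smooth_on_frechet_derivative[OF smooth])
      then have "pd1 (Fk k) differentiable (at (0, y))"
        using smooth_on_differentiable e by fastforce
      from DERIV_imp_deriv[OF partial_derivatives(2)[OF this]] show ?thesis by simp
    qed
    also have "(\<lambda>y. pd1 (Fk k) (0, y)) = (deriv ^^ k) \<xi>" using Suc by auto
    finally show ?case by simp
  qed
  have "((\<lambda>t. Fk k (t, x)) has_real_derivative (deriv ^^ k) \<xi> x) (at 0)"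
    using partial_derivatives(1)[OF diff[OF 0], of k x] by (simp only: pd1)
  then show ?thesis
  proof (rule has_field_derivative_transform_within_open[of _ _ _ "{- e<..<e}"])
    show "Fk k (t, x) = (deriv ^^ k) (\<lambda>y. F (t, y)) x" if "t \<in> {- e<..<e}" for t
      by (simp add: der[OF that])
  qed (use e in auto)
qed

section \<open>Differentiability of adjugates, and the differential of the curvature\<close>

lemma differentiable_prod:
  fixes f :: "'i \<Rightarrow> real \<Rightarrow> real"
  shows "(\<And>i. i \<in> A \<Longrightarrow> f i differentiable (at x)) \<Longrightarrow> (\<lambda>t. \<Prod>i\<in>A. f i t) differentiable (at x)"
  by (induction A rule: infinite_finite_induct) (auto intro: differentiable_mult)

lemma differentiable_det:
  fixes A :: "real \<Rightarrow> real mat"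
  assumes A: "\<And>t. A t \<in> carrier_mat n n" and d: "\<And>i j. i < n \<Longrightarrow> j < n \<Longrightarrow> (\<lambda>t. A t $$ (i, j)) differentiable (at x)"
  shows "(\<lambda>t. det (A t)) differentiable (at x)"
proof -
  have "(\<lambda>t. \<Sum>p\<in>{p. p permutes {0..<n}}. signof p * (\<Prod>i = 0..<n. A t $$ (i, p i))) differentiable (at x)"
  proof (intro differentiable_sum ballI differentiable_mult differentiable_const differentiable_prod)
    fix p i assume "p \<in> {p. p permutes {0..<n}}" "i \<in> {0..<n}"
    then have "p i < n" using permutes_in_image[of p "{0..<n}" i] by auto
    then show "(\<lambda>t. A t $$ (i, p i)) differentiable (at x)" using d \<open>i \<in> {0..<n}\<close> by auto
  qed (simp add: finite_permutations)
  then show ?thesis by (simp add: det_def'[OF A])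
qed

text \<open>Gives the existence of the time derivative of the curvature; its value is computed
  separately from the frame equation.\<close>

lemma differentiable_adj_mat:
  fixes A :: "real \<Rightarrow> real mat"
  assumes A: "\<And>t. A t \<in> carrier_mat n n" and d: "\<And>i j. i < n \<Longrightarrow> j < n \<Longrightarrow> (\<lambda>t. A t $$ (i, j)) differentiable (at x)"
    and ij: "i < n" "j < n"
  shows "(\<lambda>t. adj_mat (A t) $$ (i, j)) differentiable (at x)"
proof -
  have dims: "dim_row (A t) = n" "dim_col (A t) = n" for t using A[of t] by auto
  have "(\<lambda>t. det (mat_delete (A t) j i)) differentiable (at x)"
  proof (rule differentiable_det[of _ "n - 1"])
    fix k l assume kl: "k < n - 1" "l < n - 1"
    have "(\<lambda>t. mat_delete (A t) j i $$ (k, l)) = (\<lambda>t. A t $$ (if k < j then k else Suc k, if l < i then l else Suc l))"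
      using kl by (simp add: mat_delete_def dims)
    then show "(\<lambda>t. mat_delete (A t) j i $$ (k, l)) differentiable (at x)" using d kl by auto
  qed (simp add: mat_delete_def dims)
  then show ?thesis using ij by (simp add: adj_mat_def dims cofactor_def)
qed

text \<open>Along any path with this velocity the frame \<open>g\<close> has time derivative
  \<open>G C\<close>. Differentiating \<open>g_x = g (b + u)\<close> in \<open>t\<close> and
  comparing with the product rule for \<open>(G C)_x\<close> leaves
  \<open>G u_t = G (cov n U C)\<close>, and \<open>G\<close> is invertible.\<close>

lemma curvature_differential:
  fixes X :: "real \<Rightarrow> real vec"
  assumes n: "n \<ge> 2" and \<gamma>: "\<gamma> \<in> curves n" and U: "cder.V_shape n U"
    and G: "G = frame_mat cder n (curve_coords \<gamma>)" "map_mat cder G = G * (b_mat n + U)"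
    and C: "C \<in> carrier_mat n n" "cder.V_shape n (cder.cov n U C)" "trace_mat C = 0"
    and X: "\<And>x. X x \<in> carrier_vec n" "\<And>x i. i < n \<Longrightarrow> X x $ i = cval ((G * C) $$ (i, 0)) x"
  shows "has_curvature_differential n \<gamma> X (mat_at (cder.cov n U C))"
  unfolding has_curvature_differential_def
proof (intro conjI allI impI)
  show "X x \<in> carrier_vec n" for x by (rule X(1))
  show "mat_at (cder.cov n U C) \<in> smooth_maps n (V_mats n)" by (rule mat_at_smooth_V[OF C(2)])
  show "\<exists>c. curve_path n \<gamma> X c" by (rule curve_path_exists[OF n \<gamma> U G C X(2)])
  fix c x i j assume path: "curve_path n \<gamma> X c" and ij: "i < n" "j < n"
  obtain e where e: "e > 0" "\<And>t. t \<in> {- e<..<e} \<Longrightarrow> c t \<in> curves n"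
    "\<And>i. i < n \<Longrightarrow> smooth_on ({- e<..<e} \<times> UNIV) (\<lambda>(t, x). c t x $ i)"
    using path unfolding curve_path_def by blast
  have c0: "c 0 = \<gamma>" and vel: "\<And>y i. i < n \<Longrightarrow> ((\<lambda>t. c t y $ i) has_real_derivative X y $ i) (at 0)"
    using path unfolding curve_path_def by blast+
  have Uc: "U \<in> carrier_mat n n" using U by (rule cder.V_shape_carrier)
  have Gc: "G \<in> carrier_mat n n" by (simp add: G(1))
  have GC: "G * C \<in> carrier_mat n n" using Gc C by simp
  have detG: "det G = 1" unfolding G(1) by (rule curves_frame_mat(2)[OF \<gamma>])
  have fr0: "frame n \<gamma> = mat_at G" unfolding G(1) by (rule curves_frame_mat(1)[OF \<gamma>])
  have curv0: "curvature n \<gamma> = mat_at U" by (rule curvature_eq[OF n \<gamma> U G])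
  have XF: "frame_mat cder n (\<lambda>i. (G * C) $$ (i, 0)) = G * C"
    by (rule cder.frame_mat_of_cov[OF n U Gc G(2) C(1,2)])
  have derk: "((\<lambda>t. (deriv ^^ k) (\<lambda>y. c t y $ i) x) has_real_derivative (deriv ^^ k) (\<lambda>y. X y $ i) x) (at 0)"
    if "i < n" for i k
    using path_derivative[OF e(1) e(3)[OF that], of "\<lambda>y. X y $ i" k x] vel[OF that] by simp
  have Xk: "(deriv ^^ k) (\<lambda>y. X y $ i) x = cval ((G * C) $$ (i, k)) x" if "i < n" "k < n" for i k
  proof -
    have "(\<lambda>y. X y $ i) = cval ((G * C) $$ (i, 0))" using X(2) that by auto
    moreover have "(cder ^^ k) ((G * C) $$ (i, 0)) = (G * C) $$ (i, k)"
      using arg_cong[OF XF, of "\<lambda>M. M $$ (i, k)"] that by (simp add: frame_mat_def del: index_mult_mat(1))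
    ultimately show ?thesis using cval_funpow_cder[of k "(G * C) $$ (i, 0)"] by simp
  qed
  \<comment> \<open>At the fixed point \<open>x\<close>: the frame, its \<open>x\<close>-derivative
    and the curvature as functions of time.\<close>
  define g where "g t = frame n (c t) x" for t
  define h where "h t = mat_deriv n (frame n (c t)) x" for t
  define u where "u t = curvature n (c t) x" for t
  have gc: "g t \<in> carrier_mat n n" and hc: "h t \<in> carrier_mat n n" for t
    by (simp_all add: g_def h_def frame_def mat_deriv_def)
  have g_entry: "g t $$ (i, k) = (deriv ^^ k) (\<lambda>y. c t y $ i) x" if "i < n" "k < n" for t i k
    using that by (simp add: g_def frame_def)
  have h_entry: "h t $$ (i, k) = (deriv ^^ Suc k) (\<lambda>y. c t y $ i) x" if "i < n" "k < n" for t i k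
    using that by (simp add: h_def mat_deriv_def frame_def)
  have g': "((\<lambda>t. g t $$ (i, k)) has_real_derivative cval ((G * C) $$ (i, k)) x) (at 0)" if "i < n" "k < n" for i k
    using derk[OF that(1), of k] that by (simp only: g_entry Xk)
  have h': "((\<lambda>t. h t $$ (i, k)) has_real_derivative cval (cder ((G * C) $$ (i, k))) x) (at 0)" if ik: "i < n" "k < n" for i k
  proof -
    have "(deriv ^^ k) (\<lambda>y. X y $ i) = cval ((cder ^^ k) ((G * C) $$ (i, 0)))"
      using X(2) that unfolding cval_funpow_cder by (intro arg_cong[of _ _ "deriv ^^ k"] ext) simp
    also have "(cder ^^ k) ((G * C) $$ (i, 0)) = (G * C) $$ (i, k)"
      using arg_cong[OF XF, of "\<lambda>M. M $$ (i, k)"] that by (simp add: frame_mat_def del: index_mult_mat(1))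
    finally have "(deriv ^^ Suc k) (\<lambda>y. X y $ i) x = cval (cder ((G * C) $$ (i, k))) x"
      by (simp add: cval_cder del: index_mult_mat(1))
    then show ?thesis using derk[OF ik(1), of "Suc k"] ik by (simp only: h_entry)
  qed
  have uc: "u t \<in> carrier_mat n n" and hgu: "h t = g t * (b_mat n + u t)" and detg: "det (g t) = 1"
    if t: "t \<in> {- e<..<e}" for t
  proof -
    let ?H = "frame_mat cder n (curve_coords (c t))"
    obtain V where V: "cder.V_shape n V" "curvature n (c t) = mat_at V" "map_mat cder ?H = ?H * (b_mat n + V)"
      by (rule curves_curvature[OF n e(2)[OF t]])
    have Vc: "V \<in> carrier_mat n n" using V(1) by (rule cder.V_shape_carrier)
    show "u t \<in> carrier_mat n n" using Vc by (simp add: u_def V(2))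
    have fr: "frame n (c t) = mat_at ?H" by (rule curves_frame_mat(1)[OF e(2)[OF t]])
    show "det (g t) = 1" using e(2)[OF t] by (simp add: g_def curves_def)
    have "h t = mat_at (?H * (b_mat n + V)) x"
      unfolding h_def fr V(3)[symmetric] by (rule mat_deriv_mat_at) simp
    also have "\<dots> = mat_at ?H x * mat_at (b_mat n + V) x"
      using Vc by (intro cval.mat_hom_mult[of _ n n _ n]) auto
    also have "mat_at (b_mat n + V) x = b_mat n + u t"
      using Vc by (simp add: u_def V(2) cval.map_mat_add[of _ n n] map_mat_b_mat)
    finally show "h t = g t * (b_mat n + u t)" by (simp add: g_def fr)
  qed
  \<comment> \<open>Since the determinant is \<open>1\<close>, the adjugate is the inverse. This
    writes \<open>u\<close> through \<open>g\<close> and \<open>h\<close> and shows that it is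
    differentiable, before \<open>h = g (b + u)\<close> may be differentiated.\<close>
  have u_adj: "u t = adj_mat (g t) * h t - b_mat n" if t: "t \<in> {- e<..<e}" for t
  proof -
    note A = adj_mat_inverse[OF gc detg[OF t]]
    have bu: "b_mat n + u t \<in> carrier_mat n n" using uc[OF t] by simp
    have "adj_mat (g t) * h t = b_mat n + u t"
      unfolding hgu[OF t] using A gc[of t] bu by (simp add: sq_simps(1)[of _ n, symmetric] sq_units[of _ n] del: add_carrier_mat)
    then show ?thesis using uc[OF t] by (auto intro!: eq_matI)
  qed
  have 0: "0 \<in> {- e<..<e}" using e by simp
  have g_diff: "(\<lambda>t. g t $$ (i, k)) differentiable (at 0)" "(\<lambda>t. h t $$ (i, k)) differentiable (at 0)"
    if ik: "i < n" "k < n" for i k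
    using g'[OF ik] h'[OF ik] unfolding real_differentiable_def by blast+
  have u_diff: "(\<lambda>t. u t $$ (i, k)) differentiable (at 0)" if ik: "i < n" "k < n" for i k
  proof -
    have "(\<lambda>t. (\<Sum>l<n. adj_mat (g t) $$ (i, l) * h t $$ (l, k)) - b_mat n $$ (i, k)) differentiable (at 0)"
      using g_diff ik
      by (intro differentiable_diff differentiable_sum ballI differentiable_mult differentiable_const
          differentiable_adj_mat[OF gc]) auto
    then obtain D where "((\<lambda>t. (\<Sum>l<n. adj_mat (g t) $$ (i, l) * h t $$ (l, k)) - b_mat n $$ (i, k)) has_real_derivative D) (at 0)"
      by (auto simp: real_differentiable_def)
    then have "((\<lambda>t. u t $$ (i, k)) has_real_derivative D) (at 0)"
    proof (rule has_field_derivative_transform_within_open[of _ _ _ "{- e<..<e}"])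
      fix t assume t: "t \<in> {- e<..<e}"
      have A: "adj_mat (g t) \<in> carrier_mat n n" by (rule adj_mat(1)[OF gc])
      show "(\<Sum>l<n. adj_mat (g t) $$ (i, l) * h t $$ (l, k)) - b_mat n $$ (i, k) = u t $$ (i, k)"
        unfolding u_adj[OF t] using ik A hc[of t] by (simp add: sq_mult_entry[OF A hc ik, symmetric] del: index_mult_mat(1))
    qed (use e in auto)
    then show ?thesis by (auto simp: real_differentiable_def)
  qed
  define W where "W = mat n n (\<lambda>(i, k). deriv (\<lambda>t. u t $$ (i, k)) 0)"
  have Wc: "W \<in> carrier_mat n n" by (simp add: W_def)
  have W: "((\<lambda>t. u t $$ (i, k)) has_real_derivative W $$ (i, k)) (at 0)" if ik: "i < n" "k < n" for i k
    using u_diff[OF ik] ik by (auto simp: real_differentiable_def W_def DERIV_imp_deriv)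
  have g0: "g 0 = mat_at G x" and u0: "u 0 = mat_at U x"
    by (simp_all add: g_def u_def c0 fr0 curv0)
  have "W = mat_at (cder.cov n U C) x"
  proof -
    have bU: "b_mat n + U \<in> carrier_mat n n" using Uc by simp
    have cov: "cder.cov n U C \<in> carrier_mat n n" using Uc C by simp
    let ?g = "mat_at G x" and ?C = "mat_at C x" and ?B = "mat_at (b_mat n + U) x"
    have B: "?B = b_mat n + u 0" using Uc by (simp add: u0 cval.map_mat_add[of _ n n] map_mat_b_mat)
    have carr: "?g \<in> carrier_mat n n" "?C \<in> carrier_mat n n" "?B \<in> carrier_mat n n" using Gc C bU by auto
    \<comment> \<open>The time derivative of \<open>h = g (b + u)\<close> at \<open>0\<close>; the
      left side is that of \<open>h\<close>, as the frame moves with velocity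
      \<open>G C\<close>.\<close>
    have "mat_at (map_mat cder (G * C)) x = mat_at (G * C) x * ?B + ?g * W"
    proof (rule eq_matI)
      fix i k assume "i < dim_row (mat_at (G * C) x * ?B + ?g * W)" "k < dim_col (mat_at (G * C) x * ?B + ?g * W)"
      then have ik: "i < n" "k < n" using Gc Wc by auto
      have gcx: "mat_at (G * C) x \<in> carrier_mat n n" using GC by simp
      have GC_at: "mat_at (G * C) x $$ (i, l) = cval ((G * C) $$ (i, l)) x" if "l < n" for l
        using GC ik that by (intro index_map_mat(1)) auto
      have ev: "((\<lambda>t. \<Sum>l<n. g t $$ (i, l) * (b_mat n $$ (l, k) + u t $$ (l, k))) has_real_derivative
          (\<Sum>l<n. cval ((G * C) $$ (i, l)) x * (b_mat n $$ (l, k) + u 0 $$ (l, k)) + W $$ (l, k) * g 0 $$ (i, l))) (at 0)"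
        using ik g' W by (intro DERIV_sum DERIV_mult) (auto intro!: derivative_eq_intros)
      have "((\<lambda>t. h t $$ (i, k)) has_real_derivative
          (\<Sum>l<n. cval ((G * C) $$ (i, l)) x * (b_mat n $$ (l, k) + u 0 $$ (l, k)) + W $$ (l, k) * g 0 $$ (i, l))) (at 0)"
        using ev
      proof (rule has_field_derivative_transform_within_open[of _ _ _ "{- e<..<e}"])
        fix t assume t: "t \<in> {- e<..<e}"
        have bu: "b_mat n + u t \<in> carrier_mat n n" using uc[OF t] by simp
        show "(\<Sum>l<n. g t $$ (i, l) * (b_mat n $$ (l, k) + u t $$ (l, k))) = h t $$ (i, k)"
          unfolding hgu[OF t] sq_mult_entry[OF gc bu ik] using uc[OF t] ik by (intro sum.cong) auto
      qed (use e in auto)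
      from DERIV_unique[OF h'[OF ik] this]
      have "cval (cder ((G * C) $$ (i, k))) x
        = (\<Sum>l<n. cval ((G * C) $$ (i, l)) x * (b_mat n $$ (l, k) + u 0 $$ (l, k))) + (\<Sum>l<n. g 0 $$ (i, l) * W $$ (l, k))"
        by (simp add: sum.distrib mult.commute del: index_mult_mat(1))
      also have "(\<Sum>l<n. cval ((G * C) $$ (i, l)) x * (b_mat n $$ (l, k) + u 0 $$ (l, k))) = (mat_at (G * C) x * ?B) $$ (i, k)"
        unfolding sq_mult_entry[OF gcx carr(3) ik] unfolding B using ik uc[OF 0] by (intro sum.cong) (auto simp: GC_at simp del: index_mult_mat(1) index_map_mat(1))
      also have "(\<Sum>l<n. g 0 $$ (i, l) * W $$ (l, k)) = (?g * W) $$ (i, k)"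
        unfolding g0 by (rule sq_mult_entry[OF carr(1) Wc ik, symmetric])
      finally show "mat_at (map_mat cder (G * C)) x $$ (i, k) = (mat_at (G * C) x * ?B + ?g * W) $$ (i, k)"
        using ik GC carr Wc by (auto simp del: index_mult_mat(1))
    qed (use GC carr Wc in auto)
    \<comment> \<open>The same left side, now by the product rule in \<open>x\<close> and the frame
      equation for \<open>G\<close>.\<close>
    moreover have "mat_at (map_mat cder (G * C)) x = mat_at (G * C) x * ?B + ?g * mat_at (cder.cov n U C) x"
    proof -
      have lin: "P + Q = R + (Q + (P - R))"
        if "P \<in> carrier_mat n n" "Q \<in> carrier_mat n n" "R \<in> carrier_mat n n" for P Q R :: "cfun mat"
        by (rule eq_matI) (use that in auto)
      have dC: "map_mat cder C \<in> carrier_mat n n" using C by simp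
      have "map_mat cder (G * C) = G * ((b_mat n + U) * C) + G * map_mat cder C"
        unfolding cder.mat_mult[OF Gc C(1)] G(2) using Gc C bU by (simp add: sq_simps(1)[of _ n] del: add_carrier_mat)
      also have "\<dots> = G * (C * (b_mat n + U)) + (G * map_mat cder C + (G * ((b_mat n + U) * C) - G * (C * (b_mat n + U))))"
        by (rule lin) (use Gc C bU in auto)
      also have "\<dots> = G * C * (b_mat n + U) + G * cder.cov n U C"
      proof -
        have "G * cder.cov n U C = G * map_mat cder C + (G * ((b_mat n + U) * C) - G * (C * (b_mat n + U)))"
          unfolding cder.cov_def commutator_def
          using Gc C bU dC sq_simps(3)[OF dC, of "(b_mat n + U) * C - C * (b_mat n + U)" G]
            sq_simps(5)[of "(b_mat n + U) * C" n "C * (b_mat n + U)" G]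
          by (simp del: add_carrier_mat)
        then show ?thesis using Gc C bU by (simp add: sq_simps(1)[of _ n] del: add_carrier_mat)
      qed
      finally show ?thesis
        using GC Gc bU cov cval.map_mat_add[of "G * C * (b_mat n + U)" n n "G * cder.cov n U C" x]
          cval.mat_hom_mult[OF GC bU, of x] cval.mat_hom_mult[OF Gc cov, of x] by simp
    qed
    ultimately have eq: "mat_at (G * C) x * ?B + ?g * W = mat_at (G * C) x * ?B + ?g * mat_at (cder.cov n U C) x"
      by simp
    have cx: "mat_at (cder.cov n U C) x \<in> carrier_mat n n" using cov by simp
    have gcb: "mat_at (G * C) x * ?B \<in> carrier_mat n n" using GC carr by simp
    have "?g * W = ?g * mat_at (cder.cov n U C) x"
    proof (rule eq_matI)
      fix i k assume "i < dim_row (?g * mat_at (cder.cov n U C) x)" "k < dim_col (?g * mat_at (cder.cov n U C) x)"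
      then have ik: "i < n" "k < n" using Gc cov by auto
      have "(mat_at (G * C) x * ?B + ?g * W) $$ (i, k) = (mat_at (G * C) x * ?B + ?g * mat_at (cder.cov n U C) x) $$ (i, k)"
        using eq by simp
      then show "(?g * W) $$ (i, k) = (?g * mat_at (cder.cov n U C) x) $$ (i, k)"
        using ik carr Wc cx gcb by (auto simp del: index_mult_mat(1))
    qed (use Wc cov Gc in auto)
    then have "adj_mat ?g * (?g * W) = adj_mat ?g * (?g * mat_at (cder.cov n U C) x)" by simp
    moreover have "det ?g = 1" using detg[OF 0] by (simp add: g0)
    ultimately show ?thesis
      using adj_mat_inverse[OF carr(1)] carr Wc cx
      by (simp add: sq_simps(1)[of _ n, symmetric] sq_units[of _ n])
  qed
  then show "((\<lambda>t. curvature n (c t) x $$ (i, j)) has_real_derivative mat_at (cder.cov n U C) x $$ (i, j)) (at 0)"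
    using W[OF ij] by (simp add: u_def)
qed

text \<open>One matrix \<open>C\<close> serves both halves. It equals \<open>Z_{j,0}\<close>, so it
  governs the flow, and both Poisson operators produce \<open>cov n U C\<close>: the second from the
  gradient of \<open>H_j\<close>, the first from that of \<open>- H_{n+j}\<close>.\<close>

theorem corollary6p2:
  fixes n j :: nat
  assumes "n \<ge> 2" and "j \<ge> 1" and "\<not> [j = 0] (mod n)"
  shows "is_hamiltonian_curve_flow n (poisson2 n) (H_functional n j) (curve_flow n j) \<and>
    is_hamiltonian_curve_flow n (poisson1 n) (\<lambda>u. - H_functional n (n + j) u) (curve_flow n j)"
proof -
  note n = assms(1)
  have j: "\<not> n dvd j" using assms(3) by (simp add: cong_0_iff)
  have "(\<exists>\<xi>. has_functional_gradient n (H_functional n j) (curvature n \<gamma>) \<xi> \<and>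
      has_curvature_differential n \<gamma> (curve_flow n j \<gamma>) (poisson2 n (curvature n \<gamma>) \<xi>)) \<and>
    (\<exists>\<xi>. has_functional_gradient n (\<lambda>u. - H_functional n (n + j) u) (curvature n \<gamma>) \<xi> \<and>
      has_curvature_differential n \<gamma> (curve_flow n j \<gamma>) (poisson1 n (curvature n \<gamma>) \<xi>))"
    if \<gamma>: "\<gamma> \<in> curves n" for \<gamma>
  proof -
    define G where "G = frame_mat cder n (curve_coords \<gamma>)"
    obtain U where U: "cder.V_shape n U" "curvature n \<gamma> = mat_at U" "map_mat cder G = G * (b_mat n + U)"
      unfolding G_def by (rule curves_curvature[OF n \<gamma>])
    obtain h T S where dr: "cder.dressing n U h T S" using cder.dressing_exists[OF n U(1)] by blast
    \<comment> \<open>\<open>P_u\<close> of the gradient of \<open>H_j\<close>, produced from its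
      last row and trace.\<close>
    obtain C where C: "C \<in> carrier_mat n n" "trace_mat C = 0"
      "\<And>k. k < n - 1 \<Longrightarrow> C $$ (n - 1, k) = Y_pow n j 0 T S $$ (n - 1, k)" "cder.V_shape n (cder.cov n U C)"
      using cder.P_exists[OF n U(1), of "\<lambda>k. Y_pow n j 0 T S $$ (n - 1, k)"] by blast
    have Gc: "G \<in> carrier_mat n n" by (simp add: G_def)
    have fr: "frame n \<gamma> = mat_at G" unfolding G_def by (rule curves_frame_mat(1)[OF \<gamma>])
    have Z: "Z0 n j (mat_at U) = mat_at C" by (rule Z0_eq[OF n dr j C])
    have flow: "curve_flow n j \<gamma> x = mat_at (G * C) x *\<^sub>v unit_vec n 0" for x
    proof -
      have "curve_flow n j \<gamma> x = mat_at G x *\<^sub>v (mat_at C x *\<^sub>v unit_vec n 0)"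
        by (simp add: curve_flow_def fr U(2) Z)
      also have "\<dots> = mat_at G x * mat_at C x *\<^sub>v unit_vec n 0"
        using Gc C by (intro assoc_mult_mat_vec[symmetric, of _ n n _ n]) auto
      finally show ?thesis using cval.mat_hom_mult[OF Gc C(1), of x] by simp
    qed
    have X: "curve_flow n j \<gamma> x \<in> carrier_vec n" for x
      unfolding flow using Gc C by (intro mult_mat_vec_carrier[of _ n n]) auto
    have X0: "curve_flow n j \<gamma> x $ i = cval ((G * C) $$ (i, 0)) x" if "i < n" for x i
    proof -
      have unit: "(M *\<^sub>v unit_vec n 0) $ i = M $$ (i, 0)" if "M \<in> carrier_mat n n" for M :: "real mat"
        using that \<open>i < n\<close> n scalar_prod_right_unit[of 0 n "row M i"] by auto
      have GC: "G * C \<in> carrier_mat n n" using Gc C by simp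
      then have "curve_flow n j \<gamma> x $ i = mat_at (G * C) x $$ (i, 0)"
        unfolding flow by (intro unit) simp
      also have "\<dots> = cval ((G * C) $$ (i, 0)) x"
        using GC that n by (intro index_map_mat(1)) auto
      finally show ?thesis .
    qed
    have diff: "has_curvature_differential n \<gamma> (curve_flow n j \<gamma>) (mat_at (cder.cov n U C))"
      by (rule curvature_differential[OF n \<gamma> U(1) G_def U(3) C(1,4,2) X X0])
    have Y: "Y_pow n j 0 T S \<in> carrier_mat n n" "Y_pow n (n + j) 0 T S \<in> carrier_mat n n"
      by (rule Y_pow_carrier[OF dr])+
    have p2: "poisson2 n (mat_at U) (\<lambda>x. pi0 n (mat_at (Y_pow n j 0 T S) x)) = mat_at (cder.cov n U C)"
      by (rule poisson2_eq[OF n U(1) C(1,2,4) Y(1) C(3)])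
    have p1: "poisson1 n (mat_at U) (\<lambda>x. pi0 n (mat_at (- Y_pow n (n + j) 0 T S) x)) = mat_at (cder.cov n U C)"
      by (rule poisson1_eq[OF n dr j C])
    show ?thesis
      unfolding U(2) using diff p1 p2 H_gradient[OF n dr, of j]
        has_functional_gradient_uminus[OF H_gradient[OF n dr, of "n + j"] Y(2)] by metis
  qed
  then show ?thesis by (simp add: is_hamiltonian_curve_flow_def)
qed

end
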